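(* Let $(M=B\times_f F,g^f,\Pi)$ be a Riemannian Poisson warped product space whose warping function $f$ is a Casimir function on $(B,\Pi_B)$, and let $\lambda$ be a real constant. Then $M$ is Einstein with $Ric=\lambda g^f$ if and only if $B$ and $F$ are Einstein with $Ric_B=\lambda g_B$ and $Ric_F=\tilde\lambda g_F$ respectively, where $\tilde\lambda$ is a constant with $\tilde\lambda=\dfrac{\lambda}{f^2}$.
   Context: Contravariant geometry. Let $(N,\Pi)$ be a Poisson manifold with Poisson bivector field $\Pi$. The anchor map $\sharp_\Pi:T^*N\to TN$ is defined by $\beta(\sharp_\Pi(\alpha))=\Pi(\alpha,\beta)$. The Koszul bracket on 1-forms is $[\alpha,\beta]_\Pi=\mathcal L_{\sharp_\Pi(\alpha)}\beta-\mathcal L_{\sharp_\Pi(\beta)}\alpha-d(\Pi(\alpha,\beta))$. A pseudo-Riemannian metric $\tilde g$ on $N$ induces a metric $g$ on $T^*N$ (its cometric) through the isomorphism $X\mapsto\tilde g(X,\cdot)$. The contravariant Levi-Civita connection of $(\Pi,g)$ is the unique $\mathbb R$-bilinear map $\mathcal D:\Gamma(T^*N)\times\Gamma(T^*N)\to\Gamma(T^*N)$ with $\mathcal D_{u\alpha}\beta=u\mathcal D_\alpha\beta$, $\mathcal D_\alpha(u\beta)=u\mathcal D_\alpha\beta+\sharp_\Pi(\alpha)(u)\beta$ for $u\in C^\infty(N)$, $\mathcal D_\alpha\beta-\mathcal D_\beta\alpha=[\alpha,\beta]_\Pi$, and $\sharp_\Pi(\alpha)(g(\beta,\gamma))=g(\mathcal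 D_\alpha\beta,\gamma)+g(\beta,\mathcal D_\alpha\gamma)$. Its curvature is $\mathcal R(\alpha,\beta)\gamma=\mathcal D_\alpha\mathcal D_\beta\gamma-\mathcal D_\beta\mathcal D_\alpha\gamma-\mathcal D_{[\alpha,\beta]_\Pi}\gamma$. For a local $g$-orthonormal coframe $\{\eta_i\}$ with $\varepsilon_i=g(\eta_i,\eta_i)=\pm1$, the Ricci curvature is $Ric(\alpha,\beta)=\sum_i\varepsilon_i\,g(\mathcal R(\alpha,\eta_i)\eta_i,\beta)$. "Einstein" means $Ric=\lambda g$ for a constant $\lambda$. The triple $(N,g,\Pi)$, with $g$ possibly indefinite, is a (pseudo-)Riemannian Poisson manifold if $\mathcal D\Pi=0$, i.e. $\sharp_\Pi(\alpha)(\Pi(\beta,\gamma))-\Pi(\mathcal D_\alpha\beta,\gamma)-\Pi(\beta,\mathcal D_\alpha\gamma)=0$ for all 1-forms $\alpha,\beta,\gamma$. A function $f$ is Casimir if $\sharp_\Pi(df)=0$. Warped products. Let $(B,\tilde g_B)$, $(F,\tilde g_F)$ be pseudo-Riemannian manifolds of positive dimensions with cometrics $g_B,g_F$ and Poisson bivector fields $\Pi_B,\Pi_F$; let $f>0$ be a smooth function on $B$ (the warping function), and let $\pi,\sigma$ be the projections of $B\times F$ onto $B$ and $F$. Put $u^h=u\circ\pi$, $\alpha_1^h=\pi^*\alpha_1$ for functions and 1-forms on $B$, and $w^v=w\circ\sigma$, $\alpha_2^v=\sigma^*\alpha_2$ for functions and 1-forms on $F$. On $M=B\times_fF$ (the manifold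 $B\times F$) one takes the warped metric $\tilde g^f=\pi^*\tilde g_B+(f^h)^2\sigma^*\tilde g_F$, whose cometric $g^f$ satisfies $g^f(\alpha_1^h,\beta_1^h)=g_B(\alpha_1,\beta_1)^h$, $g^f(\alpha_1^h,\beta_2^v)=0$, $g^f(\alpha_2^v,\beta_2^v)=\frac1{(f^h)^2}g_F(\alpha_2,\beta_2)^v$, and the Poisson bivector $\Pi=\Pi_B+\Pi_F$ given by $\Pi(\alpha_1^h,\beta_1^h)=\Pi_B(\alpha_1,\beta_1)^h$, $\Pi(\alpha_1^h,\beta_2^v)=0$, $\Pi(\alpha_2^v,\beta_2^v)=\Pi_F(\alpha_2,\beta_2)^v$. The triple $(M,g^f,\Pi)$ is a (pseudo-)Riemannian Poisson warped product space if it is a (pseudo-)Riemannian Poisson manifold. $Ric,Ric_B,Ric_F$ are the Ricci curvatures of $(M,\Pi,g^f)$, $(B,\Pi_B,g_B)$, $(F,\Pi_F,g_F)$. *)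

theory Defs
  imports "HOL-Analysis.Analysis"
begin

section \<open>Smooth maps between Euclidean spaces\<close>

text \<open>Both notions are meant for open sets, on which continuity of all iterated directional
  derivatives is the usual condition.\<close>

primrec times_cont_diff_on ::
    "nat \<Rightarrow> ('a::real_normed_vector \<Rightarrow> 'b::real_normed_vector) \<Rightarrow> 'a set \<Rightarrow> bool" where
  "times_cont_diff_on 0 f S \<longleftrightarrow> continuous_on S f"
| "times_cont_diff_on (Suc n) f S \<longleftrightarrow>
     (\<forall>x\<in>S. f differentiable at x) \<and>
     (\<forall>v. times_cont_diff_on n (\<lambda>x. frechet_derivative f (at x) v) S)"

definition smooth_on :: "'a::real_normed_vector set \<Rightarrow> ('a \<Rightarrow> 'b::real_normed_vector) \<Rightarrow> bool" where
  "smooth_on S f \<longleftrightarrow> (\<forall>n. times_cont_diff_on n f S)"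


section \<open>Smooth manifolds\<close>

text \<open>A manifold modelled on \<open>'e\<close> is given by an atlas on a whole topological type \<open>'m\<close>. The atlas is
  indexed by points: \<open>A p\<close> is a chart around \<open>p\<close>, as a pair of its domain and its coordinate map.
  Every smooth structure arises in this way, by choosing for each \<open>p\<close> one of its charts around \<open>p\<close>.
  The Hausdorff and second countability axioms are sort constraints on \<open>'m\<close> where a manifold is
  assumed; \<open>DIM('e)\<close> is positive for every Euclidean space \<open>'e\<close>.\<close>

type_synonym ('m, 'e) atlas = "'m \<Rightarrow> 'm set \<times> ('m \<Rightarrow> 'e)"

definition chart_dom :: "('m, 'e) atlas \<Rightarrow> 'm \<Rightarrow> 'm set" where
  "chart_dom A p = fst (A p)"

definition chart_map :: "('m, 'e) atlas \<Rightarrow> 'm \<Rightarrow> 'm \<Rightarrow> 'e" where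
  "chart_map A p = snd (A p)"

definition chart_inv :: "('m, 'e) atlas \<Rightarrow> 'm \<Rightarrow> 'e \<Rightarrow> 'm" where
  "chart_inv A p = inv_into (chart_dom A p) (chart_map A p)"

definition smooth_manifold :: "('m::topological_space, 'e::euclidean_space) atlas \<Rightarrow> bool" where
  "smooth_manifold A \<longleftrightarrow>
     (\<forall>p. p \<in> chart_dom A p \<and> open (chart_dom A p) \<and>
        open (chart_map A p ` chart_dom A p) \<and>
        homeomorphism (chart_dom A p) (chart_map A p ` chart_dom A p)
          (chart_map A p) (chart_inv A p)) \<and>
     (\<forall>p q. smooth_on (chart_map A p ` (chart_dom A p \<inter> chart_dom A q))
        (chart_map A q \<circ> chart_inv A p))"

definition smooth_in_chart ::
    "('m, 'e::euclidean_space) atlas \<Rightarrow> 'm \<Rightarrow> ('m \<Rightarrow> 'b::real_normed_vector) \<Rightarrow> bool" where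
  "smooth_in_chart A p u \<longleftrightarrow> smooth_on (chart_map A p ` chart_dom A p) (u \<circ> chart_inv A p)"

definition smooth_fun :: "('m, 'e::euclidean_space) atlas \<Rightarrow> ('m \<Rightarrow> real) \<Rightarrow> bool" where
  "smooth_fun A u \<longleftrightarrow> (\<forall>p. smooth_in_chart A p u)"

text \<open>The tangent space at \<open>p\<close> is \<open>'e\<close>, identified through the chart \<open>A p\<close>; the cotangent space is
  its dual \<open>'e \<Rightarrow>\<^sub>L real\<close>. So a vector field is a map \<open>'m \<Rightarrow> 'e\<close> and a 1-form a map
  \<open>'m \<Rightarrow> 'e \<Rightarrow>\<^sub>L real\<close>; neither is smooth in the naive sense, since the chart changes with the
  point. \<open>chart_change A p q r\<close> is the Jacobian at \<open>r\<close> of the transition from \<open>A p\<close> to \<open>A q\<close>. Thus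
  \<open>chart_change A p r r v\<close> is the tangent vector at \<open>r\<close> with components \<open>v\<close> in the chart \<open>A p\<close>, and
  \<open>chart_change A r p r\<close> sends a tangent vector at \<open>r\<close> to its components in \<open>A p\<close>.\<close>

definition chart_change ::
    "('m, 'e::euclidean_space) atlas \<Rightarrow> 'm \<Rightarrow> 'm \<Rightarrow> 'm \<Rightarrow> 'e \<Rightarrow> 'e" where
  "chart_change A p q r = frechet_derivative (chart_map A q \<circ> chart_inv A p) (at (chart_map A p r))"

type_synonym 'e covector = "'e \<Rightarrow>\<^sub>L real"

type_synonym ('m, 'e) form = "'m \<Rightarrow> 'e covector"

definition one_forms :: "('m, 'e::euclidean_space) atlas \<Rightarrow> ('m, 'e) form set" where
  "one_forms A =
     {\<alpha>. \<forall>p v. smooth_in_chart A p (\<lambda>q. blinfun_apply (\<alpha> q) (chart_change A p q q v))}"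

definition differential ::
    "('m, 'e::euclidean_space) atlas \<Rightarrow> ('m \<Rightarrow> real) \<Rightarrow> ('m, 'e) form" where
  "differential A u p =
     Blinfun (frechet_derivative (u \<circ> chart_inv A p) (at (chart_map A p p)))"

text \<open>The Lie derivative of a 1-form, in the components of the chart \<open>A q\<close>:
  \<open>(L\<^sub>X \<beta>)\<^sub>j = X\<^sup>i \<partial>\<^sub>i \<beta>\<^sub>j + \<beta>\<^sub>i \<partial>\<^sub>j X\<^sup>i\<close>.\<close>

definition lie_derivative ::
    "('m, 'e::euclidean_space) atlas \<Rightarrow> ('m \<Rightarrow> 'e) \<Rightarrow> ('m, 'e) form \<Rightarrow> ('m, 'e) form" where
  "lie_derivative A X \<beta> q =
     Blinfun (\<lambda>v.
       frechet_derivative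
         ((\<lambda>r. blinfun_apply (\<beta> r) (chart_change A q r r v)) \<circ> chart_inv A q)
         (at (chart_map A q q)) (X q)
       + blinfun_apply (\<beta> q)
           (frechet_derivative
              ((\<lambda>r. chart_change A r q r (X r)) \<circ> chart_inv A q)
              (at (chart_map A q q)) v))"


section \<open>Poisson manifolds\<close>

type_synonym ('m, 'e) bivector = "'m \<Rightarrow> 'e covector \<Rightarrow> 'e covector \<Rightarrow> real"

definition poisson_bracket ::
    "('m, 'e::euclidean_space) atlas \<Rightarrow> ('m, 'e) bivector \<Rightarrow>
     ('m \<Rightarrow> real) \<Rightarrow> ('m \<Rightarrow> real) \<Rightarrow> 'm \<Rightarrow> real" where
  "poisson_bracket A P u w p = P p (differential A u p) (differential A w p)"

definition poisson_manifold ::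
    "('m::topological_space, 'e::euclidean_space) atlas \<Rightarrow> ('m, 'e) bivector \<Rightarrow> bool" where
  "poisson_manifold A P \<longleftrightarrow>
     smooth_manifold A \<and>
     (\<forall>p. bilinear (P p) \<and> (\<forall>a b. P p a b = - P p b a)) \<and>
     (\<forall>\<alpha>\<in>one_forms A. \<forall>\<beta>\<in>one_forms A. smooth_fun A (\<lambda>p. P p (\<alpha> p) (\<beta> p))) \<and>
     (\<forall>u v w. smooth_fun A u \<longrightarrow> smooth_fun A v \<longrightarrow> smooth_fun A w \<longrightarrow>
        (\<forall>p. poisson_bracket A P u (poisson_bracket A P v w) p
           + poisson_bracket A P v (poisson_bracket A P w u) p
           + poisson_bracket A P w (poisson_bracket A P u v) p = 0))"

definition sharp ::
    "('m, 'e::euclidean_space) bivector \<Rightarrow> ('m, 'e) form \<Rightarrow> 'm \<Rightarrow> 'e" where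
  "sharp P \<alpha> p = (THE X. \<forall>b. blinfun_apply b X = P p (\<alpha> p) b)"

definition anchor_deriv ::
    "('m, 'e::euclidean_space) atlas \<Rightarrow> ('m, 'e) bivector \<Rightarrow>
     ('m, 'e) form \<Rightarrow> ('m \<Rightarrow> real) \<Rightarrow> 'm \<Rightarrow> real" where
  "anchor_deriv A P \<alpha> u p = blinfun_apply (differential A u p) (sharp P \<alpha> p)"

definition casimir ::
    "('m, 'e::euclidean_space) atlas \<Rightarrow> ('m, 'e) bivector \<Rightarrow> ('m \<Rightarrow> real) \<Rightarrow> bool" where
  "casimir A P u \<longleftrightarrow> smooth_fun A u \<and> (\<forall>p. sharp P (differential A u) p = 0)"

definition koszul_bracket ::
    "('m, 'e::euclidean_space) atlas \<Rightarrow> ('m, 'e) bivector \<Rightarrow>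
     ('m, 'e) form \<Rightarrow> ('m, 'e) form \<Rightarrow> ('m, 'e) form" where
  "koszul_bracket A P \<alpha> \<beta> p =
     lie_derivative A (sharp P \<alpha>) \<beta> p
     - lie_derivative A (sharp P \<beta>) \<alpha> p
     - differential A (\<lambda>q. P q (\<alpha> q) (\<beta> q)) p"


section \<open>Metrics and cometrics\<close>

type_synonym ('m, 'e) metric = "'m \<Rightarrow> 'e \<Rightarrow> 'e \<Rightarrow> real"

type_synonym ('m, 'e) cometric = "'m \<Rightarrow> 'e covector \<Rightarrow> 'e covector \<Rightarrow> real"

definition pseudo_riemannian_manifold ::
    "('m::topological_space, 'e::euclidean_space) atlas \<Rightarrow> ('m, 'e) metric \<Rightarrow> bool" where
  "pseudo_riemannian_manifold A h \<longleftrightarrow>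
     smooth_manifold A \<and>
     (\<forall>p. bilinear (h p) \<and> (\<forall>v w. h p v w = h p w v) \<and>
        (\<forall>v. (\<forall>w. h p v w = 0) \<longrightarrow> v = 0)) \<and>
     (\<forall>p v w. smooth_in_chart A p (\<lambda>q. h q (chart_change A p q q v) (chart_change A p q q w)))"

definition raise :: "('m, 'e::euclidean_space) metric \<Rightarrow> 'm \<Rightarrow> 'e covector \<Rightarrow> 'e" where
  "raise h p a = (THE X. \<forall>Y. h p X Y = blinfun_apply a Y)"

definition cometric_of :: "('m, 'e::euclidean_space) metric \<Rightarrow> ('m, 'e) cometric" where
  "cometric_of h p a b = h p (raise h p a) (raise h p b)"


section \<open>Contravariant Levi-Civita connection and curvature\<close>

type_synonym ('m, 'e) connection = "('m, 'e) form \<Rightarrow> ('m, 'e) form \<Rightarrow> ('m, 'e) form"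

text \<open>These conditions determine \<open>D\<close> on \<open>one_forms A\<close>; its values elsewhere are irrelevant.\<close>

definition contravariant_levi_civita ::
    "('m, 'e::euclidean_space) atlas \<Rightarrow> ('m, 'e) bivector \<Rightarrow> ('m, 'e) cometric \<Rightarrow>
     ('m, 'e) connection \<Rightarrow> bool" where
  "contravariant_levi_civita A P g D \<longleftrightarrow>
     (\<forall>\<alpha>\<in>one_forms A. \<forall>\<beta>\<in>one_forms A. D \<alpha> \<beta> \<in> one_forms A) \<and>
     (\<forall>\<alpha>\<in>one_forms A. \<forall>\<beta>\<in>one_forms A. \<forall>\<gamma>\<in>one_forms A.
        D (\<lambda>p. \<alpha> p + \<beta> p) \<gamma> = (\<lambda>p. D \<alpha> \<gamma> p + D \<beta> \<gamma> p) \<and>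
        D \<gamma> (\<lambda>p. \<alpha> p + \<beta> p) = (\<lambda>p. D \<gamma> \<alpha> p + D \<gamma> \<beta> p)) \<and>
     (\<forall>c. \<forall>\<alpha>\<in>one_forms A. \<forall>\<beta>\<in>one_forms A.
        D (\<lambda>p. c *\<^sub>R \<alpha> p) \<beta> = (\<lambda>p. c *\<^sub>R D \<alpha> \<beta> p) \<and>
        D \<alpha> (\<lambda>p. c *\<^sub>R \<beta> p) = (\<lambda>p. c *\<^sub>R D \<alpha> \<beta> p)) \<and>
     (\<forall>u. \<forall>\<alpha>\<in>one_forms A. \<forall>\<beta>\<in>one_forms A. smooth_fun A u \<longrightarrow>
        D (\<lambda>p. u p *\<^sub>R \<alpha> p) \<beta> = (\<lambda>p. u p *\<^sub>R D \<alpha> \<beta> p) \<and>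
        D \<alpha> (\<lambda>p. u p *\<^sub>R \<beta> p) =
          (\<lambda>p. u p *\<^sub>R D \<alpha> \<beta> p + anchor_deriv A P \<alpha> u p *\<^sub>R \<beta> p)) \<and>
     (\<forall>\<alpha>\<in>one_forms A. \<forall>\<beta>\<in>one_forms A.
        (\<lambda>p. D \<alpha> \<beta> p - D \<beta> \<alpha> p) = koszul_bracket A P \<alpha> \<beta>) \<and>
     (\<forall>\<alpha>\<in>one_forms A. \<forall>\<beta>\<in>one_forms A. \<forall>\<gamma>\<in>one_forms A. \<forall>p.
        anchor_deriv A P \<alpha> (\<lambda>q. g q (\<beta> q) (\<gamma> q)) p =
          g p (D \<alpha> \<beta> p) (\<gamma> p) + g p (\<beta> p) (D \<alpha> \<gamma> p))"

definition curvature ::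
    "('m, 'e::euclidean_space) atlas \<Rightarrow> ('m, 'e) bivector \<Rightarrow> ('m, 'e) connection \<Rightarrow>
     ('m, 'e) form \<Rightarrow> ('m, 'e) form \<Rightarrow> ('m, 'e) form \<Rightarrow> ('m, 'e) form" where
  "curvature A P D \<alpha> \<beta> \<gamma> p =
     D \<alpha> (D \<beta> \<gamma>) p - D \<beta> (D \<alpha> \<gamma>) p - D (koszul_bracket A P \<alpha> \<beta>) \<gamma> p"

text \<open>A connection acts on globally defined forms, so a local coframe near \<open>p\<close> consists of global
  1-forms that are orthonormal on a neighbourhood of \<open>p\<close>. After shrinking the neighbourhood, any
  local coframe extends to such forms, and the curvature at \<open>p\<close> does not depend on the extension.\<close>

definition local_orthonormal_coframe ::
    "('m::topological_space, 'e::euclidean_space) atlas \<Rightarrow> ('m, 'e) cometric \<Rightarrow> 'm \<Rightarrow>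
     (nat \<Rightarrow> ('m, 'e) form) \<Rightarrow> bool" where
  "local_orthonormal_coframe A g p \<eta> \<longleftrightarrow>
     (\<forall>i<DIM('e). \<eta> i \<in> one_forms A) \<and>
     (\<exists>U. open U \<and> p \<in> U \<and>
        (\<forall>q\<in>U. \<forall>i<DIM('e). \<forall>j<DIM('e).
           if i = j then g q (\<eta> i q) (\<eta> j q) \<in> {1, -1} else g q (\<eta> i q) (\<eta> j q) = 0))"

definition ricci ::
    "('m::topological_space, 'e::euclidean_space) atlas \<Rightarrow> ('m, 'e) bivector \<Rightarrow>
     ('m, 'e) cometric \<Rightarrow> ('m, 'e) connection \<Rightarrow> ('m, 'e) form \<Rightarrow> ('m, 'e) form \<Rightarrow> 'm \<Rightarrow> real" where
  "ricci A P g D \<alpha> \<beta> p =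
     (let \<eta> = (SOME \<eta>. local_orthonormal_coframe A g p \<eta>) in
      \<Sum>i<DIM('e). g p (\<eta> i p) (\<eta> i p) * g p (curvature A P D \<alpha> (\<eta> i) (\<eta> i) p) (\<beta> p))"

definition einstein ::
    "('m::topological_space, 'e::euclidean_space) atlas \<Rightarrow> ('m, 'e) bivector \<Rightarrow>
     ('m, 'e) cometric \<Rightarrow> ('m, 'e) connection \<Rightarrow> real \<Rightarrow> bool" where
  "einstein A P g D \<kappa> \<longleftrightarrow>
     (\<forall>\<alpha>\<in>one_forms A. \<forall>\<beta>\<in>one_forms A. \<forall>p. ricci A P g D \<alpha> \<beta> p = \<kappa> * g p (\<alpha> p) (\<beta> p))"

text \<open>The metric \<open>h\<close> may be indefinite; \<open>D\<close> is the connection of \<open>(P, cometric_of h)\<close>.\<close>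

definition riemannian_poisson_manifold ::
    "('m::topological_space, 'e::euclidean_space) atlas \<Rightarrow> ('m, 'e) metric \<Rightarrow>
     ('m, 'e) bivector \<Rightarrow> ('m, 'e) connection \<Rightarrow> bool" where
  "riemannian_poisson_manifold A h P D \<longleftrightarrow>
     pseudo_riemannian_manifold A h \<and> poisson_manifold A P \<and>
     contravariant_levi_civita A P (cometric_of h) D \<and>
     (\<forall>\<alpha>\<in>one_forms A. \<forall>\<beta>\<in>one_forms A. \<forall>\<gamma>\<in>one_forms A. \<forall>p.
        anchor_deriv A P \<alpha> (\<lambda>q. P q (\<beta> q) (\<gamma> q)) p
        - P p (D \<alpha> \<beta> p) (\<gamma> p) - P p (\<beta> p) (D \<alpha> \<gamma> p) = 0)"


section \<open>Warped products\<close>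

definition prod_atlas ::
    "('b, 'e) atlas \<Rightarrow> ('f, 'k) atlas \<Rightarrow> ('b \<times> 'f, 'e \<times> 'k) atlas" where
  "prod_atlas A B = (\<lambda>(x, y).
     (chart_dom A x \<times> chart_dom B y, \<lambda>(x', y'). (chart_map A x x', chart_map B y y')))"

text \<open>The tangent space at \<open>(x, y)\<close> is \<open>'e \<times> 'k\<close>, and a covector there restricts to a covector on
  each factor. With these restrictions the product bivector is the one with
  \<open>P(\<alpha>\<^sup>h, \<beta>\<^sup>h) = P\<^sub>B(\<alpha>, \<beta>)\<^sup>h\<close>, \<open>P(\<alpha>\<^sup>h, \<beta>\<^sup>v) = 0\<close> and \<open>P(\<alpha>\<^sup>v, \<beta>\<^sup>v) = P\<^sub>F(\<alpha>, \<beta>)\<^sup>v\<close>.\<close>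

definition restrict_fst ::
    "('e::euclidean_space \<times> 'k::euclidean_space) covector \<Rightarrow> 'e covector" where
  "restrict_fst a = Blinfun (\<lambda>v. blinfun_apply a (v, 0))"

definition restrict_snd ::
    "('e::euclidean_space \<times> 'k::euclidean_space) covector \<Rightarrow> 'k covector" where
  "restrict_snd a = Blinfun (\<lambda>w. blinfun_apply a (0, w))"

definition prod_bivector ::
    "('b, 'e::euclidean_space) bivector \<Rightarrow> ('f, 'k::euclidean_space) bivector \<Rightarrow>
     ('b \<times> 'f, 'e \<times> 'k) bivector" where
  "prod_bivector PB PF = (\<lambda>(x, y) a b.
     PB x (restrict_fst a) (restrict_fst b) + PF y (restrict_snd a) (restrict_snd b))"

definition warped_metric ::
    "('b \<Rightarrow> real) \<Rightarrow> ('b, 'e) metric \<Rightarrow> ('f, 'k) metric \<Rightarrow> ('b \<times> 'f, 'e \<times> 'k) metric" where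
  "warped_metric f hB hF = (\<lambda>(x, y) (v, w) (v', w'). hB x v v' + (f x)\<^sup>2 * hF y w w')"

end

theory Submission
  imports Defs
begin

text \<open>Since \<open>f\<close> is Casimir, every anchor annihilates the factor \<open>f\<^sup>-\<^sup>2\<close> of the vertical cometric, so
  the Koszul formula, evaluated on pullbacks of forms from the two factors, shows that the
  contravariant Levi-Civita connection of the warped product is the direct product of \<open>DB\<close> and
  \<open>DF\<close>. Hence its curvature tensor is the direct sum of the curvature tensors of the factors. The
  rescaling \<open>\<eta> \<mapsto> f \<eta>\<close> that makes a vertical coframe orthonormal cancels the factor \<open>f\<^sup>-\<^sup>2\<close>, so
  \<open>Ric = Ric\<^sub>B + Ric\<^sub>F\<close>, while \<open>g = g\<^sub>B + f\<^sup>-\<^sup>2 g\<^sub>F\<close>. Comparing the two blocks gives the theorem;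
  \<open>\<lambda> / f\<^sup>2\<close> is constant because \<open>Ric\<^sub>F\<close> does not depend on the point of the base and \<open>g\<^sub>F \<noteq> 0\<close>.

  All reductions to pointwise statements rest on one fact: an additive functional of 1-forms that is
  homogeneous over smooth functions depends only on the value of the form at the point. That the
  curvature has this property in its last argument is a consequence of the Jacobi identity.\<close>

section \<open>Smooth maps on open sets\<close>

text \<open>The connections are specified on global 1-forms only, whereas coordinates and
  orthonormal coframes exist locally. Every local object is therefore cut off by a bump function,
  and the file has to start with the calculus that produces bumps. The Ricci curvature is a trace
  over a coframe picked by \<open>SOME\<close>. So a smooth orthonormal coframe has to exist even
  for an indefinite metric, where plain Gram-Schmidt may run into a null vector, and the trace must
  not depend on the choice. A form on the product is not a pullback in general. The connection is
  computed on pullbacks only; this suffices because each covector of the product is a sum of a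
  horizontal and a vertical one and the curvature is pointwise. Brackets are never expanded for
  general forms either: for functions linear in a chart, [du,dv] = d{u,v} near at hand replaces the
  Lie derivatives, and tensoriality carries identities to all forms. In a classical warped product
  the mixed terms contain derivatives of \<open>f\<close> in horizontal directions. Here the only
  directions that occur are those in the image of the anchor, and a Casimir function is constant
  along them.\<close>

lemma frechet_derivative_cong_open:
  assumes "open S" "x \<in> S" "\<And>y. y \<in> S \<Longrightarrow> f y = g y"
  shows "frechet_derivative f (at x) = frechet_derivative g (at x)"
proof -
  have "(f has_derivative f') (at x) \<longleftrightarrow> (g has_derivative f') (at x)" for f'
    using assms by (metis has_derivative_transform_within_open)
  then show ?thesis unfolding frechet_derivative_def by simp
qed

lemma differentiable_cong_open:
  assumes "open S" "x \<in> S" "\<And>y. y \<in> S \<Longrightarrow> f y = g y"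
  shows "f differentiable (at x) \<longleftrightarrow> g differentiable (at x)"
  unfolding differentiable_def using assms by (metis has_derivative_transform_within_open)

lemma tcd_cong:
  assumes "open S" "\<And>y. y \<in> S \<Longrightarrow> f y = g y" "times_cont_diff_on n f S"
  shows "times_cont_diff_on n g S"
  using assms(2,3)
proof (induction n arbitrary: f g)
  case 0
  then show ?case by (auto cong: continuous_on_cong)
next
  case (Suc n)
  have "frechet_derivative f (at x) = frechet_derivative g (at x)" if "x \<in> S" for x
    using frechet_derivative_cong_open[OF assms(1) that] Suc.prems(1) by blast
  moreover have "g differentiable at x" if "x \<in> S" for x
    using differentiable_cong_open[OF assms(1) that] Suc.prems that
    by (metis times_cont_diff_on.simps(2))
  moreover have "times_cont_diff_on n (\<lambda>x. frechet_derivative g (at x) v) S" for v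
    using Suc.IH[of "\<lambda>x. frechet_derivative f (at x) v" "\<lambda>x. frechet_derivative g (at x) v"]
      Suc.prems(2) calculation(1) by simp
  ultimately show ?case by simp
qed

lemma tcd_mono: "times_cont_diff_on n f S \<Longrightarrow> T \<subseteq> S \<Longrightarrow> times_cont_diff_on n f T"
  by (induction n arbitrary: f) (auto intro: continuous_on_subset)

lemma tcd_local:
  assumes "\<And>x. x \<in> S \<Longrightarrow> \<exists>U. open U \<and> x \<in> U \<and> times_cont_diff_on n f U"
  shows "times_cont_diff_on n f S"
  using assms
proof (induction n arbitrary: f)
  case 0
  then show ?case
    by (auto intro!: continuous_at_imp_continuous_on simp: continuous_on_eq_continuous_at) 
       (metis continuous_on_eq_continuous_at)
next
  case (Suc n)
  have "f differentiable at x" if "x \<in> S" for x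
    using Suc.prems[OF that] by auto
  moreover have "times_cont_diff_on n (\<lambda>x. frechet_derivative f (at x) v) S" for v
    by (rule Suc.IH) (metis Suc.prems times_cont_diff_on.simps(2))
  ultimately show ?case by simp
qed

lemma tcd_Suc: "times_cont_diff_on (Suc n) f S \<Longrightarrow> times_cont_diff_on n f S"
proof (induction n arbitrary: f)
  case 0
  then show ?case
    by (auto intro!: continuous_at_imp_continuous_on differentiable_imp_continuous_within)
next
  case (Suc n)
  then show ?case by (metis times_cont_diff_on.simps(2))
qed

lemma tcd_const: "times_cont_diff_on n (\<lambda>x. c) S"
  by (induction n arbitrary: c) simp_all

lemma tcd_add:
  assumes "open S" "times_cont_diff_on n f S" "times_cont_diff_on n g S"
  shows "times_cont_diff_on n (\<lambda>x. f x + g x) S"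
  using assms(2,3)
proof (induction n arbitrary: f g)
  case 0
  then show ?case by (auto intro: continuous_on_add)
next
  case (Suc n)
  have D: "((\<lambda>x. f x + g x) has_derivative
      (\<lambda>v. frechet_derivative f (at x) v + frechet_derivative g (at x) v)) (at x)" if "x \<in> S" for x
    using Suc.prems that by (intro has_derivative_add) (auto simp: frechet_derivative_works[symmetric])
  have "times_cont_diff_on n (\<lambda>x. frechet_derivative f (at x) v + frechet_derivative g (at x) v) S" for v
    by (rule Suc.IH) (use Suc.prems in auto)
  then have "times_cont_diff_on n (\<lambda>x. frechet_derivative (\<lambda>x. f x + g x) (at x) v) S" for v
    by (rule tcd_cong[OF assms(1), rotated]) (simp add: D[THEN frechet_derivative_at, symmetric])
  then show ?case using D unfolding times_cont_diff_on.simps differentiable_def by blast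
qed

text \<open>One induction serves scalar multiples, products and inner products: the product rule
  gives two terms of the same form, and \<open>tcd_Suc\<close> lowers the order of the factor that
  was not differentiated.\<close>

lemma tcd_bilinear:
  assumes "bounded_bilinear pr" "open S" "times_cont_diff_on n f S" "times_cont_diff_on n g S"
  shows "times_cont_diff_on n (\<lambda>x. pr (f x) (g x)) S"
  using assms(3,4)
proof (induction n arbitrary: f g)
  case 0
  then show ?case using bounded_bilinear.continuous_on[OF assms(1)] by auto
next
  case (Suc n)
  have D: "((\<lambda>x. pr (f x) (g x)) has_derivative
      (\<lambda>v. pr (f x) (frechet_derivative g (at x) v) + pr (frechet_derivative f (at x) v) (g x))) (at x)"
    if "x \<in> S" for x
    using Suc.prems that
    by (intro bounded_bilinear.FDERIV[OF assms(1)]) (auto simp: frechet_derivative_works[symmetric])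
  have "times_cont_diff_on n (\<lambda>x. pr (f x) (frechet_derivative g (at x) v) + pr (frechet_derivative f (at x) v) (g x)) S" for v
    using Suc.prems by (intro tcd_add assms(2) Suc.IH tcd_Suc[OF Suc.prems(1)] tcd_Suc[OF Suc.prems(2)]) auto
  then have "times_cont_diff_on n (\<lambda>x. frechet_derivative (\<lambda>x. pr (f x) (g x)) (at x) v) S" for v
    by (rule tcd_cong[OF assms(2), rotated]) (simp add: D[THEN frechet_derivative_at, symmetric])
  then show ?case using D unfolding times_cont_diff_on.simps differentiable_def by blast
qed

lemma tcd_sum:
  assumes "open S" "\<And>i. i \<in> I \<Longrightarrow> times_cont_diff_on n (f i) S"
  shows "times_cont_diff_on n (\<lambda>x. \<Sum>i\<in>I. f i x) S"
proof (cases "finite I")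
  case True
  then show ?thesis using assms(2)
    by (induction I) (auto intro!: tcd_add[OF assms(1)] tcd_const)
qed (simp add: tcd_const)

text \<open>The chain rule differentiates \<open>g\<close> in a direction that moves with the point.
  Expanding this direction in a basis leaves derivatives of \<open>g\<close> in fixed directions,
  composed with \<open>f\<close>, to which the induction hypothesis applies.\<close>

lemma tcd_compose:
  fixes f :: "'a::real_normed_vector \<Rightarrow> 'b::euclidean_space"
  assumes "open S" "open T" "f ` S \<subseteq> T" "times_cont_diff_on n f S" "times_cont_diff_on n g T"
  shows "times_cont_diff_on n (g \<circ> f) S"
  using assms(4,5)
proof (induction n arbitrary: g)
  case 0
  then show ?case using assms(3) by (metis continuous_on_compose continuous_on_subset times_cont_diff_on.simps(1))
next
  case (Suc n)
  let ?f' = "\<lambda>x. frechet_derivative f (at x)"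
  have D: "(g \<circ> f has_derivative (\<lambda>v. frechet_derivative g (at (f x)) (?f' x v))) (at x)" if "x \<in> S" for x
  proof -
    have "f x \<in> T" using assms(3) that by auto
    then show ?thesis using Suc.prems that
      diff_chain_at[of f "?f' x" x g "frechet_derivative g (at (f x))"]
      by (auto simp: frechet_derivative_works[symmetric] o_def)
  qed
  have E: "frechet_derivative g (at (f x)) (?f' x v) =
      (\<Sum>b\<in>Basis. (?f' x v \<bullet> b) *\<^sub>R ((\<lambda>y. frechet_derivative g (at y) b) \<circ> f) x)" if "x \<in> S" for x v
  proof -
    have "linear (frechet_derivative g (at (f x)))"
      using Suc.prems(2) assms(3) that by (auto intro!: linear_frechet_derivative)
    then have "frechet_derivative g (at (f x)) (\<Sum>b\<in>Basis. (?f' x v \<bullet> b) *\<^sub>R b) =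
      (\<Sum>b\<in>Basis. (?f' x v \<bullet> b) *\<^sub>R frechet_derivative g (at (f x)) b)"
      by (simp add: linear_sum linear_scale)
    then show ?thesis by (simp add: euclidean_representation)
  qed
  have "times_cont_diff_on n (\<lambda>x. \<Sum>b\<in>Basis. (?f' x v \<bullet> b) *\<^sub>R ((\<lambda>y. frechet_derivative g (at y) b) \<circ> f) x) S" for v
  proof (intro tcd_sum[OF assms(1)] tcd_bilinear[OF bounded_bilinear_scaleR assms(1)])
    fix b :: 'b
    show "times_cont_diff_on n (\<lambda>x. ?f' x v \<bullet> b) S"
      using Suc.prems(1) by (intro tcd_bilinear[OF bounded_bilinear_inner assms(1)] tcd_const) auto
    show "times_cont_diff_on n ((\<lambda>y. frechet_derivative g (at y) b) \<circ> f) S"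
      using Suc.prems by (intro Suc.IH tcd_Suc[OF Suc.prems(1)]) auto
  qed
  then have "times_cont_diff_on n (\<lambda>x. frechet_derivative (g \<circ> f) (at x) v) S" for v
    by (rule tcd_cong[OF assms(1), rotated]) (simp add: D[THEN frechet_derivative_at, symmetric] E)
  then show ?case using D unfolding times_cont_diff_on.simps differentiable_def by blast
qed

section \<open>Closure properties of smooth maps\<close>

lemma smooth_on_cong:
  "open S \<Longrightarrow> (\<And>y. y \<in> S \<Longrightarrow> f y = g y) \<Longrightarrow> smooth_on S f \<longleftrightarrow> smooth_on S g"
  unfolding smooth_on_def by (metis tcd_cong)

lemma smooth_on_subset: "smooth_on S f \<Longrightarrow> T \<subseteq> S \<Longrightarrow> smooth_on T f"
  unfolding smooth_on_def using tcd_mono by blast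

lemma smooth_on_local:
  assumes "\<And>x. x \<in> S \<Longrightarrow> \<exists>U. open U \<and> x \<in> U \<and> smooth_on U f"
  shows "smooth_on S f"
  unfolding smooth_on_def using assms by (auto intro!: tcd_local simp: smooth_on_def)

lemma smooth_on_const [intro, simp]: "smooth_on S (\<lambda>x. c)"
  by (simp add: smooth_on_def tcd_const)

lemma smooth_on_add [intro]: "open S \<Longrightarrow> smooth_on S f \<Longrightarrow> smooth_on S g \<Longrightarrow> smooth_on S (\<lambda>x. f x + g x)"
  by (simp add: smooth_on_def tcd_add)

lemma smooth_on_scaleR [intro]: "open S \<Longrightarrow> smooth_on S f \<Longrightarrow> smooth_on S g \<Longrightarrow> smooth_on S (\<lambda>x. f x *\<^sub>R g x)"
  by (simp add: smooth_on_def tcd_bilinear[OF bounded_bilinear_scaleR])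

lemma smooth_on_mult [intro]:
  fixes f g :: "_ \<Rightarrow> real"
  shows "open S \<Longrightarrow> smooth_on S f \<Longrightarrow> smooth_on S g \<Longrightarrow> smooth_on S (\<lambda>x. f x * g x)"
  by (simp add: smooth_on_def tcd_bilinear[OF bounded_bilinear_mult])

lemma smooth_on_inner [intro]: "open S \<Longrightarrow> smooth_on S f \<Longrightarrow> smooth_on S g \<Longrightarrow> smooth_on S (\<lambda>x. f x \<bullet> g x)"
  by (simp add: smooth_on_def tcd_bilinear[OF bounded_bilinear_inner])

lemma smooth_on_sum [intro]: "open S \<Longrightarrow> (\<And>i. i \<in> I \<Longrightarrow> smooth_on S (f i)) \<Longrightarrow> smooth_on S (\<lambda>x. \<Sum>i\<in>I. f i x)"
  by (simp add: smooth_on_def tcd_sum)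

lemma smooth_on_diff [intro]:
  fixes f g :: "_ \<Rightarrow> _::real_normed_vector"
  assumes "open S" "smooth_on S f" "smooth_on S g" shows "smooth_on S (\<lambda>x. f x - g x)"
  using smooth_on_add[OF assms(1,2) smooth_on_scaleR[OF assms(1) smooth_on_const[of S "-1"] assms(3)]] by simp

lemma smooth_on_compose:
  fixes f :: "'a::real_normed_vector \<Rightarrow> 'b::euclidean_space"
  assumes "open S" "open T" "f ` S \<subseteq> T" "smooth_on S f" "smooth_on T g"
  shows "smooth_on S (g \<circ> f)"
  using assms by (simp add: smooth_on_def tcd_compose[OF assms(1-3)])

lemma smooth_on_imp_differentiable: "smooth_on S f \<Longrightarrow> x \<in> S \<Longrightarrow> f differentiable (at x)"
  unfolding smooth_on_def by (metis times_cont_diff_on.simps(2))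

lemma smooth_on_imp_continuous_on: "smooth_on S f \<Longrightarrow> continuous_on S f"
  unfolding smooth_on_def by (metis times_cont_diff_on.simps(1))

lemma smooth_on_frechet_derivative:
  "smooth_on S f \<Longrightarrow> smooth_on S (\<lambda>x. frechet_derivative f (at x) v)"
  unfolding smooth_on_def by (metis times_cont_diff_on.simps(2))

lemma smooth_on_bounded_linear:
  assumes "bounded_linear f" shows "smooth_on S f"
  unfolding smooth_on_def
proof
  fix n
  have "frechet_derivative f (at x) = f" for x
    using bounded_linear_imp_has_derivative[OF assms] frechet_derivative_at by metis
  then show "times_cont_diff_on n f S"
    using assms by (cases n) (auto simp: tcd_const bounded_linear_imp_differentiable linear_continuous_on)
qed

text \<open>Real powers are closed under differentiation up to constants, so the induction runs over
  all exponents at once. The exponents needed later are -1 for a quotient and -1/2 for normalizing a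
  vector.\<close>

lemma smooth_on_powr: "smooth_on {0<..} (\<lambda>x::real. x powr r)"
  unfolding smooth_on_def
proof
  fix n show "times_cont_diff_on n (\<lambda>x::real. x powr r) {0<..}"
  proof (induction n arbitrary: r)
    case 0
    then show ?case by (auto intro!: continuous_intros)
  next
    case (Suc n)
    have D: "((\<lambda>x. x powr r) has_derivative (\<lambda>v. v * (r * x powr (r - 1)))) (at x)" if "x > 0" for x :: real
      by (rule has_derivative_eq_rhs[OF has_real_derivative_powr[OF that, unfolded has_field_derivative_def]])
         (rule ext, rule mult.commute)
    have T: "times_cont_diff_on n (\<lambda>x. v * (r * x powr (r - 1))) {0<..}" for v
      by (intro tcd_bilinear[OF bounded_bilinear_mult] tcd_const Suc.IH open_greaterThan)
    have "times_cont_diff_on n (\<lambda>x. frechet_derivative (\<lambda>x. x powr r) (at x) v) {0<..}" for v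
      by (rule tcd_cong[OF open_greaterThan _ T[of v]]) (simp add: D[THEN frechet_derivative_at, symmetric])
    then show ?case using D unfolding times_cont_diff_on.simps differentiable_def by blast
  qed
qed

section \<open>Bump functions\<close>

text \<open>The factor \<open>inverse x ^ k\<close> makes the family closed under differentiation:
  the derivative of a member is a combination of the next two. For \<open>k = 0\<close> this is the
  standard flat function exp(-1/x).\<close>

definition flat_exp :: "nat \<Rightarrow> real \<Rightarrow> real" where
  "flat_exp k x = (if x > 0 then inverse x ^ k * exp (- inverse x) else 0)"

text \<open>In the variable 1/x, the exponential dominates every power.\<close>

lemma flat_exp_tendsto_0: "(flat_exp k \<longlongrightarrow> 0) (at 0)"
proof (rule filterlim_split_at)
  show "(flat_exp k \<longlongrightarrow> 0) (at_left 0)"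
    by (rule tendsto_eventually) (auto simp: eventually_at_filter flat_exp_def)
  have "((\<lambda>x. inverse x ^ k / exp (inverse x)) \<longlongrightarrow> (0::real)) (at_right 0)"
    by (rule filterlim_compose[OF tendsto_power_div_exp_0 filterlim_inverse_at_top_right])
  then show "(flat_exp k \<longlongrightarrow> 0) (at_right 0)"
    by (rule Lim_transform_eventually)
       (auto simp: eventually_at_filter flat_exp_def exp_minus divide_inverse)
qed

lemma flat_exp_has_real_derivative:
  "(flat_exp k has_real_derivative - real k * flat_exp (Suc k) x + flat_exp (Suc (Suc k)) x) (at x)"
proof (cases x "0::real" rule: linorder_cases)
  case less
  have "(flat_exp k has_real_derivative 0) (at x)"
    by (rule has_field_derivative_transform_within_open[OF DERIV_const open_lessThan[of 0]])
       (use less in \<open>auto simp: flat_exp_def\<close>)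
  then show ?thesis using less by (simp add: flat_exp_def)
next
  case equal
  \<comment> \<open>The difference quotient at 0 is \<open>flat_exp (Suc k)\<close>, whose limit is
    already known.\<close>
  have "((\<lambda>h. (flat_exp k (0 + h) - flat_exp k 0) / h) \<longlongrightarrow> 0) (at 0)"
    by (rule Lim_transform_eventually[OF flat_exp_tendsto_0[of "Suc k"]])
       (auto simp: eventually_at_filter flat_exp_def divide_inverse)
  then show ?thesis using equal by (simp add: DERIV_def flat_exp_def)
next
  case greater
  have "((\<lambda>x. inverse x ^ k * exp (- inverse x)) has_real_derivative
      - real k * flat_exp (Suc k) x + flat_exp (Suc (Suc k)) x) (at x)"
    using greater
    by (auto intro!: derivative_eq_intros simp: flat_exp_def)
       (cases k; simp add: field_simps power2_eq_square)
  then show ?thesis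
    by (rule has_field_derivative_transform_within_open[OF _ open_greaterThan[of 0]])
       (use greater in \<open>auto simp: flat_exp_def\<close>)
qed

lemma smooth_on_flat_exp: "smooth_on UNIV (flat_exp k)"
  unfolding smooth_on_def
proof
  fix n show "times_cont_diff_on n (flat_exp k) UNIV"
  proof (induction n arbitrary: k)
    case 0
    then show ?case
      by (auto intro!: continuous_at_imp_continuous_on DERIV_isCont flat_exp_has_real_derivative)
  next
    case (Suc n)
    have D: "(flat_exp k has_derivative (\<lambda>v. v * (- real k * flat_exp (Suc k) x + flat_exp (Suc (Suc k)) x))) (at x)" for x
      by (rule has_derivative_eq_rhs[OF flat_exp_has_real_derivative[unfolded has_field_derivative_def]])
         (rule ext, rule mult.commute)
    have T: "times_cont_diff_on n (\<lambda>x. v * (- real k * flat_exp (Suc k) x + flat_exp (Suc (Suc k)) x)) UNIV" for v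
      by (intro tcd_bilinear[OF bounded_bilinear_mult] tcd_add tcd_const Suc.IH open_UNIV)
    have "times_cont_diff_on n (\<lambda>x. frechet_derivative (flat_exp k) (at x) v) UNIV" for v
      by (rule tcd_cong[OF open_UNIV _ T[of v]]) (simp add: D[THEN frechet_derivative_at, symmetric])
    then show ?case using D unfolding times_cont_diff_on.simps differentiable_def by blast
  qed
qed

text \<open>The step is the quotient of e(t) by e(t) + e(1 - t). The denominator is positive because
  t and 1 - t cannot both be nonpositive; its reciprocal is written as a real power so that
  \<open>smooth_on_powr\<close> applies.\<close>

lemma smooth_step_exists:
  "\<exists>s::real \<Rightarrow> real. smooth_on UNIV s \<and> (\<forall>t\<le>0. s t = 0) \<and> (\<forall>t\<ge>1. s t = 1)"
proof (intro exI conjI allI impI)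
  let ?e = "flat_exp 0"
  let ?d = "\<lambda>t. ?e t + ?e (1 - t)"
  let ?s = "\<lambda>t. ?e t * ?d t powr (-1)"
  have "smooth_on UNIV (?e \<circ> (\<lambda>t. 1 - t))"
    by (rule smooth_on_compose[OF open_UNIV open_UNIV _ _ smooth_on_flat_exp])
       (auto intro!: smooth_on_diff smooth_on_bounded_linear[OF bounded_linear_ident])
  then have d: "smooth_on UNIV ?d"
    by (intro smooth_on_add smooth_on_flat_exp) (auto simp: o_def)
  have pos: "?d t > 0" for t
    by (auto simp: flat_exp_def add_pos_pos)
  have "smooth_on UNIV ((\<lambda>x. x powr (-1)) \<circ> ?d)"
    by (rule smooth_on_compose[OF open_UNIV open_greaterThan _ d smooth_on_powr]) (use pos in auto)
  then show "smooth_on UNIV ?s"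
    by (intro smooth_on_mult smooth_on_flat_exp) (auto simp: o_def)
  show "?s t = 0" if "t \<le> 0" for t using that by (simp add: flat_exp_def)
  show "?s t = 1" if "t \<ge> 1" for t
    using that by (simp add: flat_exp_def powr_minus_divide)
qed

text \<open>A step function is composed with an affine function of the squared distance, which is
  smooth at the centre too. It is normalized to be 1 at distance \<open>r\<close> and 0 at distance
  \<open>R\<close>.\<close>

lemma euclidean_bump_exists:
  fixes x0 :: "'e::euclidean_space"
  assumes "0 < r" "r < R"
  shows "\<exists>\<beta>::'e \<Rightarrow> real. smooth_on UNIV \<beta> \<and> (\<forall>x\<in>cball x0 r. \<beta> x = 1) \<and> (\<forall>x. x \<notin> ball x0 R \<longrightarrow> \<beta> x = 0)"
proof -
  obtain s :: "real \<Rightarrow> real" where s: "smooth_on UNIV s" "\<And>t. t \<le> 0 \<Longrightarrow> s t = 0" "\<And>t. t \<ge> 1 \<Longrightarrow> s t = 1"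
    using smooth_step_exists by blast
  define c where "c = R\<^sup>2 - r\<^sup>2"
  have c: "c > 0" using assms by (simp add: c_def power_strict_mono)
  let ?q = "\<lambda>x. inverse c * (R\<^sup>2 - (x - x0) \<bullet> (x - x0))"
  have "smooth_on UNIV ?q"
    by (intro smooth_on_mult smooth_on_diff smooth_on_inner smooth_on_const open_UNIV
        smooth_on_bounded_linear[OF bounded_linear_ident])
  then have "smooth_on UNIV (s \<circ> ?q)"
    by (intro smooth_on_compose[OF open_UNIV open_UNIV _ _ s(1)]) auto
  moreover have "(s \<circ> ?q) x = 1" if "x \<in> cball x0 r" for x
  proof -
    have "(x - x0) \<bullet> (x - x0) \<le> r\<^sup>2"
      using that assms by (auto simp: dist_norm norm_minus_commute power_mono dot_square_norm)
    then have "?q x \<ge> 1" using c by (simp add: field_simps c_def)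
    then show ?thesis using s(3) by simp
  qed
  moreover have "(s \<circ> ?q) x = 0" if "x \<notin> ball x0 R" for x
  proof -
    have "(x - x0) \<bullet> (x - x0) \<ge> R\<^sup>2"
      using that assms by (auto simp: dist_norm norm_minus_commute power_mono dot_square_norm)
    then have "?q x \<le> 0" using c by (simp add: field_simps)
    then show ?thesis using s(2) by simp
  qed
  ultimately show ?thesis by blast
qed

section \<open>Functions and 1-forms on a manifold\<close>

locale smooth_mfd =
  fixes A :: "('m::t2_space, 'e::euclidean_space) atlas"
  assumes smooth_manifold: "smooth_manifold A"
begin

abbreviation "dm \<equiv> chart_dom A"
abbreviation "\<phi> \<equiv> chart_map A"
abbreviation "\<psi> \<equiv> chart_inv A"

lemma in_chart_dom [simp, intro]: "p \<in> dm p"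
  and open_chart_dom [simp, intro]: "open (dm p)"
  and open_chart_image [simp, intro]: "open (\<phi> p ` dm p)"
  and chart_homeomorphism: "homeomorphism (dm p) (\<phi> p ` dm p) (\<phi> p) (\<psi> p)"
  and smooth_transition: "smooth_on (\<phi> p ` (dm p \<inter> dm q)) (\<phi> q \<circ> \<psi> p)"
  using smooth_manifold by (simp_all add: smooth_manifold_def)

lemma chart_inv_map [simp]: "q \<in> dm p \<Longrightarrow> \<psi> p (\<phi> p q) = q"
  using chart_homeomorphism[of p] by (simp add: homeomorphism_def)

lemma chart_map_inv [simp]: "x \<in> \<phi> p ` dm p \<Longrightarrow> \<phi> p (\<psi> p x) = x"
  by auto

lemma chart_inv_in_dom [simp]: "x \<in> \<phi> p ` dm p \<Longrightarrow> \<psi> p x \<in> dm p"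
  by auto

lemma open_chart_map_image: "open U \<Longrightarrow> U \<subseteq> dm p \<Longrightarrow> open (\<phi> p ` U)"
  using homeomorphism_imp_open_map[OF chart_homeomorphism[of p], of U]
  by (simp add: openin_open_eq)

lemma smooth_on_change_chart:
  assumes "open U" "U \<subseteq> dm p" "U \<subseteq> dm r" "smooth_on (\<phi> p ` U) (u \<circ> \<psi> p)"
  shows "smooth_on (\<phi> r ` U) (u \<circ> \<psi> r)"
proof -
  have "smooth_on (\<phi> r ` U) (\<phi> p \<circ> \<psi> r)"
    by (rule smooth_on_subset[OF smooth_transition[of r p]]) (use assms in auto)
  then have "smooth_on (\<phi> r ` U) ((u \<circ> \<psi> p) \<circ> (\<phi> p \<circ> \<psi> r))"
    by (rule smooth_on_compose[rotated 3])
       (use assms open_chart_map_image in \<open>auto simp: subset_iff\<close>)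
  then show ?thesis
    by (subst (asm) smooth_on_cong[where g = "u \<circ> \<psi> r"])
       (use assms open_chart_map_image in \<open>auto simp: subset_iff\<close>)
qed

text \<open>Transitions are smooth, so smoothness near a point may be tested in whichever chart is
  convenient there.\<close>

lemma smooth_in_chart_local:
  assumes "\<And>q. q \<in> dm r \<Longrightarrow> \<exists>p U. open U \<and> q \<in> U \<and> U \<subseteq> dm p \<and> smooth_on (\<phi> p ` U) (u \<circ> \<psi> p)"
  shows "smooth_in_chart A r u"
  unfolding smooth_in_chart_def
proof (rule smooth_on_local)
  fix x assume "x \<in> \<phi> r ` dm r"
  then obtain q where q: "q \<in> dm r" "x = \<phi> r q" by blast
  obtain p U where U: "open U" "q \<in> U" "U \<subseteq> dm p" "smooth_on (\<phi> p ` U) (u \<circ> \<psi> p)"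
    using assms[OF q(1)] by blast
  have "smooth_on (\<phi> r ` (U \<inter> dm r)) (u \<circ> \<psi> r)"
    by (rule smooth_on_change_chart[of _ p]) (use U in \<open>auto intro: smooth_on_subset\<close>)
  moreover have "open (\<phi> r ` (U \<inter> dm r))"
    by (rule open_chart_map_image) (use U in auto)
  ultimately show "\<exists>V. open V \<and> x \<in> V \<and> smooth_on V (u \<circ> \<psi> r)"
    using q U(2) by blast
qed

lemma smooth_in_chart_cong:
  "(\<And>q. q \<in> dm p \<Longrightarrow> u q = w q) \<Longrightarrow> smooth_in_chart A p u \<longleftrightarrow> smooth_in_chart A p w"
  unfolding smooth_in_chart_def by (rule smooth_on_cong) auto

lemma smooth_in_chart_const [simp, intro]: "smooth_in_chart A p (\<lambda>q. c)"
  by (simp add: smooth_in_chart_def o_def)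

lemma smooth_in_chart_add [intro]:
  "smooth_in_chart A p u \<Longrightarrow> smooth_in_chart A p w \<Longrightarrow> smooth_in_chart A p (\<lambda>q. u q + w q)"
  using smooth_on_add[OF open_chart_image] by (simp add: smooth_in_chart_def o_def)

lemma smooth_in_chart_mult [intro]:
  fixes u w :: "'m \<Rightarrow> real"
  shows "smooth_in_chart A p u \<Longrightarrow> smooth_in_chart A p w \<Longrightarrow> smooth_in_chart A p (\<lambda>q. u q * w q)"
  using smooth_on_mult[OF open_chart_image] by (simp add: smooth_in_chart_def o_def)

lemma smooth_fun_const [simp, intro]: "smooth_fun A (\<lambda>q. c)"
  by (simp add: smooth_fun_def)

lemma smooth_fun_add [intro]: "smooth_fun A u \<Longrightarrow> smooth_fun A w \<Longrightarrow> smooth_fun A (\<lambda>q. u q + w q)"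
  by (simp add: smooth_fun_def smooth_in_chart_add)

lemma smooth_fun_mult [intro]: "smooth_fun A u \<Longrightarrow> smooth_fun A w \<Longrightarrow> smooth_fun A (\<lambda>q. u q * w q)"
  by (simp add: smooth_fun_def smooth_in_chart_mult)

lemma smooth_fun_localI:
  assumes "\<And>q. \<exists>p U. open U \<and> q \<in> U \<and> U \<subseteq> dm p \<and> smooth_on (\<phi> p ` U) (u \<circ> \<psi> p)"
  shows "smooth_fun A u"
  unfolding smooth_fun_def using assms smooth_in_chart_local by blast

section \<open>Extension by zero and cutoffs\<close>

lemma smooth_fun_vanishing_outside:
  assumes "closed K" "K \<subseteq> dm p" "\<And>q. q \<notin> K \<Longrightarrow> u q = 0" "smooth_in_chart A p u"
  shows "smooth_fun A u"
proof (rule smooth_fun_localI)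
  fix q
  show "\<exists>p U. open U \<and> q \<in> U \<and> U \<subseteq> dm p \<and> smooth_on (\<phi> p ` U) (u \<circ> \<psi> p)"
  proof (cases "q \<in> dm p")
    case True
    then show ?thesis using assms(4) by (auto simp: smooth_in_chart_def)
  next
    case False
    \<comment> \<open>The complement of \<open>K\<close> is open and \<open>u\<close> vanishes on
      it; together with \<open>dm p\<close> it covers the manifold.\<close>
    let ?U = "dm q \<inter> - K"
    have o: "open (\<phi> q ` ?U)" by (rule open_chart_map_image) (use assms(1) in auto)
    have "smooth_on (\<phi> q ` ?U) (u \<circ> \<psi> q)"
      by (subst smooth_on_cong[OF o, of _ "\<lambda>_. 0"]) (use assms(3) in auto)
    then show ?thesis using False assms(1,2) by (intro exI[of _ q] exI[of _ ?U]) auto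
  qed
qed

text \<open>Vanishing outside a closed subset of the chart domain permits extension by zero. Being 1
  on a whole neighbourhood \<open>V\<close>, and not just at \<open>p\<close>, keeps germs and hence
  derivatives at \<open>p\<close> unchanged.\<close>

lemma bump_exists:
  assumes "open U" "p \<in> U"
  obtains b K V where "smooth_fun A b" "closed K" "K \<subseteq> U \<inter> dm p" "\<And>q. q \<notin> K \<Longrightarrow> b q = 0"
    "open V" "p \<in> V" "V \<subseteq> U \<inter> dm p" "\<And>q. q \<in> V \<Longrightarrow> b q = 1"
proof -
  have "open (\<phi> p ` (U \<inter> dm p))" by (rule open_chart_map_image) (use assms in auto)
  moreover have "\<phi> p p \<in> \<phi> p ` (U \<inter> dm p)" using assms by simp
  ultimately obtain R where R: "R > 0" "cball (\<phi> p p) R \<subseteq> \<phi> p ` (U \<inter> dm p)"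
    unfolding open_contains_cball by blast
  obtain \<beta> where \<beta>: "smooth_on UNIV \<beta>" "\<And>x. x \<in> cball (\<phi> p p) (R/2) \<Longrightarrow> \<beta> x = (1::real)"
    "\<And>x. x \<notin> ball (\<phi> p p) R \<Longrightarrow> \<beta> x = 0"
    using euclidean_bump_exists[of "R/2" R "\<phi> p p"] R by auto
  define K where "K = \<psi> p ` cball (\<phi> p p) R"
  define b where "b q = (if q \<in> dm p then \<beta> (\<phi> p q) else 0)" for q
  have sub: "cball (\<phi> p p) R \<subseteq> \<phi> p ` dm p" using R(2) by auto
  have "continuous_on (\<phi> p ` dm p) (\<psi> p)" "continuous_on (dm p) (\<phi> p)"
    using chart_homeomorphism[of p] by (auto simp: homeomorphism_def)
  note cont = this
  \<comment> \<open>The Hausdorff axiom enters here: \<open>K\<close> is compact as the image of a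
    closed ball, and only in a Hausdorff space does this make it closed.\<close>
  have K: "closed K" unfolding K_def
    by (intro compact_imp_closed compact_continuous_image continuous_on_subset[OF cont(1) sub] compact_cball)
  have KU: "K \<subseteq> U \<inter> dm p"
  proof
    fix q assume "q \<in> K"
    then obtain x where x: "x \<in> cball (\<phi> p p) R" "q = \<psi> p x" by (auto simp: K_def)
    then obtain q' where "q' \<in> U \<inter> dm p" "x = \<phi> p q'" using R(2) by blast
    then show "q \<in> U \<inter> dm p" using x(2) by simp
  qed
  have out: "b q = 0" if "q \<notin> K" for q
  proof (cases "q \<in> dm p")
    case True
    have "\<phi> p q \<notin> cball (\<phi> p p) R" using that True unfolding K_def by (metis chart_inv_map imageI)
    then show ?thesis using \<beta>(3) by (simp add: b_def)
  qed (simp add: b_def)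
  have "smooth_on (\<phi> p ` dm p) \<beta>" using \<beta>(1) by (rule smooth_on_subset) simp
  then have "smooth_in_chart A p b"
    unfolding smooth_in_chart_def by (subst smooth_on_cong[OF open_chart_image]) (auto simp: b_def)
  then have "smooth_fun A b" using smooth_fun_vanishing_outside[of K p b] K KU out by blast
  moreover define V where "V = dm p \<inter> \<phi> p -` ball (\<phi> p p) (R/2)"
  have "open V" unfolding V_def by (rule continuous_open_preimage[OF cont(2)]) auto
  moreover have VU: "V \<subseteq> U \<inter> dm p"
  proof
    fix q assume q: "q \<in> V"
    then have "q \<in> dm p" "\<phi> p q \<in> cball (\<phi> p p) R" using R(1) by (auto simp: V_def)
    then have "q \<in> K" unfolding K_def by (metis chart_inv_map imageI)
    then show "q \<in> U \<inter> dm p" using KU by blast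
  qed
  moreover have "b q = 1" if "q \<in> V" for q using that \<beta>(2) by (simp add: V_def b_def)
  moreover have "p \<in> V" using R(1) by (simp add: V_def)
  ultimately show ?thesis using K KU out by (intro that[of b K V])
qed

lemma smooth_fun_bump_mult:
  assumes "smooth_fun A b" "closed K" "K \<subseteq> dm p" "\<And>q. q \<notin> K \<Longrightarrow> b q = 0" "smooth_in_chart A p u"
  shows "smooth_fun A (\<lambda>q. b q * u q)"
  using assms by (intro smooth_fun_vanishing_outside[of K p]) (auto simp: smooth_fun_def)

section \<open>Differentials and changes of charts\<close>

lemma smooth_fun_differentiable:
  "smooth_fun A u \<Longrightarrow> q \<in> dm p \<Longrightarrow> (u \<circ> \<psi> p) differentiable (at (\<phi> p q))"
  unfolding smooth_fun_def smooth_in_chart_def by (rule smooth_on_imp_differentiable) auto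

lemma has_derivative_differential:
  assumes "smooth_fun A u"
  shows "(u \<circ> \<psi> p has_derivative blinfun_apply (differential A u p)) (at (\<phi> p p))"
proof -
  have "(u \<circ> \<psi> p has_derivative frechet_derivative (u \<circ> \<psi> p) (at (\<phi> p p))) (at (\<phi> p p))"
    using smooth_fun_differentiable[OF assms in_chart_dom] by (simp add: frechet_derivative_works)
  then show ?thesis
    unfolding differential_def by (simp add: bounded_linear_Blinfun_apply has_derivative_bounded_linear)
qed

lemma differential_eqI:
  assumes "smooth_fun A u" "(u \<circ> \<psi> p has_derivative blinfun_apply a) (at (\<phi> p p))"
  shows "differential A u p = a"
  using has_derivative_unique[OF has_derivative_differential[OF assms(1)] assms(2)]
  by (simp add: blinfun_apply_inject)

lemma open_chart_nbhd:
  assumes "open V" "q \<in> V" "q \<in> dm p"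
  shows "open (\<phi> p ` (V \<inter> dm p))" "\<phi> p q \<in> \<phi> p ` (V \<inter> dm p)"
    "\<And>x. x \<in> \<phi> p ` (V \<inter> dm p) \<Longrightarrow> \<psi> p x \<in> V \<inter> dm p"
  using assms by (auto intro!: open_chart_map_image)

lemma differential_const [simp]: "differential A (\<lambda>q. c) p = 0"
  by (rule differential_eqI) (auto simp: o_def zero_blinfun.rep_eq)

lemma differential_add:
  assumes "smooth_fun A u" "smooth_fun A w"
  shows "differential A (\<lambda>q. u q + w q) p = differential A u p + differential A w p"
  by (rule differential_eqI)
     (use assms has_derivative_add[OF assms[THEN has_derivative_differential], of p] in
       \<open>auto simp: o_def plus_blinfun.rep_eq\<close>)

lemma differential_mult:
  assumes "smooth_fun A u" "smooth_fun A w"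
  shows "differential A (\<lambda>q. u q * w q) p = u p *\<^sub>R differential A w p + w p *\<^sub>R differential A u p"
  by (rule differential_eqI)
     (use assms has_derivative_mult[OF assms[THEN has_derivative_differential], of p] in
       \<open>auto simp: o_def plus_blinfun.rep_eq scaleR_blinfun.rep_eq mult.commute\<close>)

lemma has_derivative_chart_change:
  assumes "q \<in> dm p" "q \<in> dm r"
  shows "(\<phi> r \<circ> \<psi> p has_derivative chart_change A p r q) (at (\<phi> p q))"
  unfolding chart_change_def
  using smooth_on_imp_differentiable[OF smooth_transition[of p r], of "\<phi> p q"] assms
  by (simp add: frechet_derivative_works)

lemma linear_chart_change: "q \<in> dm p \<Longrightarrow> q \<in> dm r \<Longrightarrow> linear (chart_change A p r q)"
  using has_derivative_chart_change has_derivative_linear by blast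

lemma chart_change_inverse:
  assumes "q \<in> dm p" "q \<in> dm r"
  shows "chart_change A p r q (chart_change A r p q v) = v"
proof -
  have "((\<phi> r \<circ> \<psi> p) \<circ> (\<phi> p \<circ> \<psi> r) has_derivative chart_change A p r q \<circ> chart_change A r p q) (at (\<phi> r q))"
    by (rule diff_chain_at) (use assms has_derivative_chart_change in auto)
  then have "((\<lambda>x. x) has_derivative chart_change A p r q \<circ> chart_change A r p q) (at (\<phi> r q))"
    by (rule has_derivative_transform_within_open[OF _ open_chart_nbhd(1,2)[of "dm p" q r]])
       (use assms in auto)
  then have "chart_change A p r q \<circ> chart_change A r p q = (\<lambda>v. v)"
    using has_derivative_unique has_derivative_ident by blast
  then show ?thesis by (metis comp_apply)
qed

lemma chart_change_self [simp]: "chart_change A p p p v = v"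
proof -
  have "((\<lambda>x. x) has_derivative chart_change A p p p) (at (\<phi> p p))"
    by (rule has_derivative_transform_within_open[OF has_derivative_chart_change open_chart_nbhd(1,2)[of "dm p" p p]])
       auto
  then show ?thesis using has_derivative_unique has_derivative_ident by metis
qed

text \<open>Chain rule. The covector at \<open>q\<close> refers to the chart of \<open>q\<close>,
  while \<open>v\<close> is a fixed direction in the chart of \<open>p\<close>; after the conversion
  only an ordinary partial derivative in one chart remains.\<close>

lemma differential_chart_change:
  assumes "smooth_fun A u" "q \<in> dm p"
  shows "blinfun_apply (differential A u q) (chart_change A p q q v) =
    frechet_derivative (u \<circ> \<psi> p) (at (\<phi> p q)) v"
proof -
  have "((u \<circ> \<psi> q) \<circ> (\<phi> q \<circ> \<psi> p) has_derivative blinfun_apply (differential A u q) \<circ> chart_change A p q q) (at (\<phi> p q))"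
    by (rule diff_chain_at) (use assms has_derivative_chart_change has_derivative_differential in auto)
  then have "(u \<circ> \<psi> p has_derivative blinfun_apply (differential A u q) \<circ> chart_change A p q q) (at (\<phi> p q))"
    by (rule has_derivative_transform_within_open[OF _ open_chart_nbhd(1,2)[of "dm q" q p]])
       (use assms in auto)
  then show ?thesis using frechet_derivative_at by (metis comp_apply)
qed

section \<open>Smooth 1-forms and coordinate differentials\<close>

lemma one_forms_smooth:
  "\<alpha> \<in> one_forms A \<Longrightarrow> smooth_in_chart A p (\<lambda>q. blinfun_apply (\<alpha> q) (chart_change A p q q v))"
  by (simp add: one_forms_def)

lemma one_forms_differential [intro]:
  assumes "smooth_fun A u" shows "differential A u \<in> one_forms A"
  unfolding one_forms_def
proof (intro CollectI allI)
  fix p v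
  have "smooth_on (\<phi> p ` dm p) (\<lambda>x. frechet_derivative (u \<circ> \<psi> p) (at x) v)"
    using assms by (intro smooth_on_frechet_derivative) (auto simp: smooth_fun_def smooth_in_chart_def)
  then show "smooth_in_chart A p (\<lambda>q. blinfun_apply (differential A u q) (chart_change A p q q v))"
    unfolding smooth_in_chart_def
    by (subst smooth_on_cong[OF open_chart_image]) (auto simp: differential_chart_change[OF assms])
qed

lemma one_forms_add [intro]:
  "\<alpha> \<in> one_forms A \<Longrightarrow> \<beta> \<in> one_forms A \<Longrightarrow> (\<lambda>p. \<alpha> p + \<beta> p) \<in> one_forms A"
  by (auto simp: one_forms_def plus_blinfun.rep_eq)

lemma one_forms_scale [intro]:
  "smooth_fun A u \<Longrightarrow> \<alpha> \<in> one_forms A \<Longrightarrow> (\<lambda>p. u p *\<^sub>R \<alpha> p) \<in> one_forms A"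
  by (auto simp: one_forms_def scaleR_blinfun.rep_eq smooth_fun_def)

lemma one_forms_zero [intro, simp]: "(\<lambda>p. 0) \<in> one_forms A"
  by (simp add: one_forms_def zero_blinfun.rep_eq)

lemma one_forms_diff [intro]:
  assumes "\<alpha> \<in> one_forms A" "\<beta> \<in> one_forms A" shows "(\<lambda>p. \<alpha> p - \<beta> p) \<in> one_forms A"
  using one_forms_add[OF assms(1) one_forms_scale[OF smooth_fun_const[of "-1"] assms(2)]] by simp

lemma one_forms_sum [intro]:
  "(\<And>i. i \<in> I \<Longrightarrow> \<alpha> i \<in> one_forms A) \<Longrightarrow> (\<lambda>p. \<Sum>i\<in>I. \<alpha> i p) \<in> one_forms A"
  by (induction I rule: infinite_finite_induct) auto

text \<open>The differential of a function that is linear in the chart at \<open>p\<close> has constant components near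
  \<open>p\<close>, so that no second derivatives appear in the Koszul bracket of two such differentials.\<close>

definition linear_near :: "'m \<Rightarrow> ('m \<Rightarrow> real) \<Rightarrow> 'e covector \<Rightarrow> bool" where
  "linear_near p u l \<longleftrightarrow> smooth_fun A u \<and>
     (\<exists>V. open V \<and> p \<in> V \<and> V \<subseteq> dm p \<and> (\<forall>q\<in>V. u q = blinfun_apply l (\<phi> p q)))"

lemma linear_near_exists: "\<exists>u. linear_near p u l"
proof -
  obtain b K V where b: "smooth_fun A b" "closed K" "K \<subseteq> dm p" "\<And>q. q \<notin> K \<Longrightarrow> b q = 0"
    "open V" "p \<in> V" "V \<subseteq> dm p" "\<And>q. q \<in> V \<Longrightarrow> b q = 1"
    using bump_exists[of UNIV p] by auto
  have "smooth_in_chart A p (\<lambda>q. blinfun_apply l (\<phi> p q))"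
    unfolding smooth_in_chart_def
    by (subst smooth_on_cong[OF open_chart_image, of _ _ "blinfun_apply l"])
       (auto intro: smooth_on_bounded_linear simp: blinfun.bounded_linear_right)
  then have "smooth_fun A (\<lambda>q. b q * blinfun_apply l (\<phi> p q))"
    using b(1-4) by (intro smooth_fun_bump_mult[of b K p])
  then show ?thesis unfolding linear_near_def using b(5-8)
    by (intro exI[of _ "\<lambda>q. b q * blinfun_apply l (\<phi> p q)"]) auto
qed

lemma linear_near_differential:
  assumes "linear_near p u l"
  obtains V where "open V" "p \<in> V" "V \<subseteq> dm p"
    "\<And>q v. q \<in> V \<Longrightarrow> blinfun_apply (differential A u q) (chart_change A p q q v) = blinfun_apply l v"
proof -
  obtain V where V: "smooth_fun A u" "open V" "p \<in> V" "V \<subseteq> dm p" "\<And>q. q \<in> V \<Longrightarrow> u q = blinfun_apply l (\<phi> p q)"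
    using assms unfolding linear_near_def by blast
  have "blinfun_apply (differential A u q) (chart_change A p q q v) = blinfun_apply l v" if "q \<in> V" for q v
  proof -
    have q: "q \<in> dm p" using that V by auto
    have "frechet_derivative (u \<circ> \<psi> p) (at (\<phi> p q)) = frechet_derivative (blinfun_apply l) (at (\<phi> p q))"
      by (rule frechet_derivative_cong_open[OF open_chart_nbhd(1,2)[OF V(2) that q]])
         (use V in auto)
    also have "\<dots> = blinfun_apply l"
      using bounded_linear_imp_has_derivative[OF blinfun.bounded_linear_right] frechet_derivative_at by metis
    finally show ?thesis using differential_chart_change[OF V(1) q] by simp
  qed
  then show ?thesis using that V by blast
qed

lemma differential_linear_near: "linear_near p u l \<Longrightarrow> differential A u p = l"
  by (erule linear_near_differential) (metis blinfun_eqI chart_change_self)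

text \<open>A globally smooth function with the germ at \<open>p\<close> of the chart coordinate
  belonging to \<open>b\<close>. Being global, its differential is an admissible argument of the
  connection and the bracket.\<close>

definition coord :: "'m \<Rightarrow> 'e \<Rightarrow> 'm \<Rightarrow> real" where
  "coord p b = (SOME u. linear_near p u (blinfun_inner_left b))"

lemma linear_near_coord: "linear_near p (coord p b) (blinfun_inner_left b)"
  unfolding coord_def by (rule someI_ex[OF linear_near_exists])

lemma smooth_fun_coord [simp, intro]: "smooth_fun A (coord p b)"
  using linear_near_coord[of p b] by (simp add: linear_near_def)

lemma differential_coord: "blinfun_apply (differential A (coord p b) p) v = v \<bullet> b"
  using differential_linear_near[OF linear_near_coord[of p b]] by (simp add: inner_commute)

lemma covector_expansion: "a = (\<Sum>b\<in>Basis. blinfun_apply a b *\<^sub>R differential A (coord p b) p)"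
proof (rule blinfun_eqI)
  fix v
  have "blinfun_apply a (\<Sum>b\<in>Basis. (v \<bullet> b) *\<^sub>R b) = (\<Sum>b\<in>Basis. (v \<bullet> b) * blinfun_apply a b)"
    by (simp add: blinfun.sum_right blinfun.scaleR_right)
  then show "blinfun_apply a v = blinfun_apply (\<Sum>b\<in>Basis. blinfun_apply a b *\<^sub>R differential A (coord p b) p) v"
    by (simp add: euclidean_representation blinfun.sum_left blinfun.scaleR_left differential_coord mult.commute)
qed

lemma one_form_through: "\<exists>\<alpha>\<in>one_forms A. \<alpha> p = a"
  by (rule bexI[of _ "\<lambda>q. \<Sum>b\<in>Basis. blinfun_apply a b *\<^sub>R differential A (coord p b) q"])
     (auto simp: covector_expansion[of a p, symmetric]
       intro!: one_forms_sum one_forms_scale[OF smooth_fun_const] one_forms_differential)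

text \<open>The cutoff \<open>w\<close> is supported where all the \<open>coord p b\<close> coincide
  with the chart coordinates. There their differentials form a coframe, and the factor
  \<open>w\<close> makes the coefficients of \<open>w \<alpha>\<close> smooth on the whole manifold.
  The same \<open>w\<close> serves all forms.\<close>

lemma one_form_local_expansion:
  obtains w where "smooth_fun A w" "w p = 1"
    "\<And>\<alpha>. \<alpha> \<in> one_forms A \<Longrightarrow> \<exists>c. (\<forall>b\<in>Basis. smooth_fun A (c b) \<and> c b p = blinfun_apply (\<alpha> p) b) \<and>
       (\<lambda>q. w q *\<^sub>R \<alpha> q) = (\<lambda>q. \<Sum>b\<in>Basis. c b q *\<^sub>R differential A (coord p b) q)"
proof -
  have "\<exists>V. open V \<and> p \<in> V \<and> (\<forall>q\<in>V. \<forall>v. blinfun_apply (differential A (coord p b) q) (chart_change A p q q v) = v \<bullet> b)"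
    for b
    using linear_near_differential[OF linear_near_coord[of p b]] by (metis blinfun_inner_left.rep_eq inner_commute)
  then obtain V where V: "\<And>b. open (V b)" "\<And>b. p \<in> V b"
    "\<And>b q v. q \<in> V b \<Longrightarrow> blinfun_apply (differential A (coord p b) q) (chart_change A p q q v) = v \<bullet> b"
    by metis
  obtain w K W where w: "smooth_fun A w" "closed K" "K \<subseteq> (\<Inter>b\<in>Basis. V b) \<inter> dm p" "\<And>q. q \<notin> K \<Longrightarrow> w q = 0"
    "open W" "p \<in> W" "W \<subseteq> (\<Inter>b\<in>Basis. V b) \<inter> dm p" "\<And>q. q \<in> W \<Longrightarrow> w q = 1"
    by (rule bump_exists[of "\<Inter>b\<in>Basis. V b" p]) (use V in auto)
  show ?thesis
  proof (rule that[of w])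
    show "smooth_fun A w" by fact
    show "w p = 1" using w by simp
    fix \<alpha> assume \<alpha>: "\<alpha> \<in> one_forms A"
    define c where "c b q = w q * blinfun_apply (\<alpha> q) (chart_change A p q q b)" for b q
    have "smooth_fun A (c b)" for b
      unfolding c_def by (rule smooth_fun_bump_mult[of _ K p]) (use w \<alpha> one_forms_smooth in auto)
    moreover have "c b p = blinfun_apply (\<alpha> p) b" for b using \<open>w p = 1\<close> by (simp add: c_def)
    \<comment> \<open>Outside \<open>K\<close> both sides vanish. On \<open>K\<close> they are
      compared on a vector expanded in the coordinate frame of the chart at
      \<open>p\<close>.\<close>
    moreover have "w q *\<^sub>R \<alpha> q = (\<Sum>b\<in>Basis. c b q *\<^sub>R differential A (coord p b) q)" for q
    proof (cases "q \<in> K")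
      case True
      then have q: "q \<in> dm p" "\<And>b. b \<in> Basis \<Longrightarrow> q \<in> V b" using w(3) by auto
      show ?thesis
      proof (rule blinfun_eqI)
        fix y
        define v where "v = chart_change A q p q y"
        have y: "y = chart_change A p q q v" by (simp add: v_def chart_change_inverse q)
        interpret linear "chart_change A p q q" by (rule linear_chart_change) (use q in auto)
        have ys: "y = (\<Sum>b\<in>Basis. (v \<bullet> b) *\<^sub>R chart_change A p q q b)"
          by (subst y, subst (1) euclidean_representation[of v, symmetric]) (simp only: sum scale)
        have "blinfun_apply (\<alpha> q) y = (\<Sum>b\<in>Basis. (v \<bullet> b) * blinfun_apply (\<alpha> q) (chart_change A p q q b))"
          by (subst ys) (simp add: blinfun.scaleR_right blinfun.sum_right)
        moreover have "blinfun_apply (differential A (coord p b) q) y = v \<bullet> b" if "b \<in> Basis" for b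
          unfolding y by (rule V(3)) (use q that in auto)
        ultimately show "blinfun_apply (w q *\<^sub>R \<alpha> q) y = blinfun_apply (\<Sum>b\<in>Basis. c b q *\<^sub>R differential A (coord p b) q) y"
          by (simp add: blinfun.sum_left blinfun.scaleR_left c_def sum_distrib_left algebra_simps)
      qed
    qed (simp add: c_def w(4))
    ultimately show "\<exists>c. (\<forall>b\<in>Basis. smooth_fun A (c b) \<and> c b p = blinfun_apply (\<alpha> p) b) \<and>
       (\<lambda>q. w q *\<^sub>R \<alpha> q) = (\<lambda>q. \<Sum>b\<in>Basis. c b q *\<^sub>R differential A (coord p b) q)"
      by blast
  qed
qed

section \<open>Functionals that depend only on the value at a point\<close>

definition tensorial_at :: "'m \<Rightarrow> (('m, 'e) form \<Rightarrow> 'c::real_vector) \<Rightarrow> bool" where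
  "tensorial_at p T \<longleftrightarrow>
     (\<forall>\<alpha>\<in>one_forms A. \<forall>\<beta>\<in>one_forms A. T (\<lambda>q. \<alpha> q + \<beta> q) = T \<alpha> + T \<beta>) \<and>
     (\<forall>u. \<forall>\<alpha>\<in>one_forms A. smooth_fun A u \<longrightarrow> T (\<lambda>q. u q *\<^sub>R \<alpha> q) = u p *\<^sub>R T \<alpha>)"

text \<open>Since \<open>w p = 1\<close>, multiplication by the cutoff does not change the value of
  \<open>T\<close>; afterwards the form is a global combination of coordinate differentials and
  linearity applies. The right side involves \<alpha> only through
  \<open>\<alpha> p\<close>.\<close>

lemma tensorial_at_expansion:
  assumes "tensorial_at p T" "\<alpha> \<in> one_forms A"
  shows "T \<alpha> = (\<Sum>b\<in>Basis. blinfun_apply (\<alpha> p) b *\<^sub>R T (differential A (coord p b)))"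
proof -
  have add: "T (\<lambda>q. \<beta> q + \<gamma> q) = T \<beta> + T \<gamma>" if "\<beta> \<in> one_forms A" "\<gamma> \<in> one_forms A" for \<beta> \<gamma>
    using assms that by (simp add: tensorial_at_def)
  have scale: "T (\<lambda>q. u q *\<^sub>R \<beta> q) = u p *\<^sub>R T \<beta>" if "smooth_fun A u" "\<beta> \<in> one_forms A" for u \<beta>
    using assms that by (simp add: tensorial_at_def)
  have zero: "T (\<lambda>q. 0) = 0" using scale[of "\<lambda>_. 0" "\<lambda>_. 0"] by auto
  have sum: "T (\<lambda>q. \<Sum>i\<in>I. \<beta> i q) = (\<Sum>i\<in>I. T (\<beta> i))" if "finite I" "\<And>i. i \<in> I \<Longrightarrow> \<beta> i \<in> one_forms A"
    for I :: "'e set" and \<beta>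
    using that
  proof (induction I)
    case (insert i I)
    then show ?case using add[of "\<beta> i" "\<lambda>q. \<Sum>i\<in>I. \<beta> i q"] one_forms_sum[of I \<beta>] by simp
  qed (simp add: zero)
  obtain w where w: "smooth_fun A w" "w p = 1" and
    "\<exists>c. (\<forall>b\<in>Basis. smooth_fun A (c b) \<and> c b p = blinfun_apply (\<alpha> p) b) \<and>
       (\<lambda>q. w q *\<^sub>R \<alpha> q) = (\<lambda>q. \<Sum>b\<in>Basis. c b q *\<^sub>R differential A (coord p b) q)"
    by (rule one_form_local_expansion[of p]) (rule that, assumption, assumption, use assms(2) in simp)
  then obtain c where c: "\<And>b. b \<in> Basis \<Longrightarrow> smooth_fun A (c b)"
    "\<And>b. b \<in> Basis \<Longrightarrow> c b p = blinfun_apply (\<alpha> p) b"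
    "(\<lambda>q. w q *\<^sub>R \<alpha> q) = (\<lambda>q. \<Sum>b\<in>Basis. c b q *\<^sub>R differential A (coord p b) q)"
    by blast
  have "T \<alpha> = T (\<lambda>q. w q *\<^sub>R \<alpha> q)" using scale[OF w(1) assms(2)] w(2) by simp
  also have "\<dots> = (\<Sum>b\<in>Basis. T (\<lambda>q. c b q *\<^sub>R differential A (coord p b) q))"
    unfolding c(3) by (rule sum) (auto intro: c)
  also have "\<dots> = (\<Sum>b\<in>Basis. blinfun_apply (\<alpha> p) b *\<^sub>R T (differential A (coord p b)))"
    using c by (intro sum.cong) (auto simp: scale one_forms_differential)
  finally show ?thesis .
qed

end

section \<open>Poisson manifolds\<close>

locale poisson_mfd = smooth_mfd A
  for A :: "('m::t2_space, 'e::euclidean_space) atlas" +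
  fixes P :: "('m, 'e) bivector"
  assumes poisson_manifold: "poisson_manifold A P"
begin

lemma bilinear_P: "bilinear (P p)"
  and P_antisym: "P p a b = - P p b a"
  and smooth_fun_P [intro]: "\<alpha> \<in> one_forms A \<Longrightarrow> \<beta> \<in> one_forms A \<Longrightarrow> smooth_fun A (\<lambda>p. P p (\<alpha> p) (\<beta> p))"
  and jacobi: "smooth_fun A u \<Longrightarrow> smooth_fun A v \<Longrightarrow> smooth_fun A w \<Longrightarrow>
    poisson_bracket A P u (poisson_bracket A P v w) p + poisson_bracket A P v (poisson_bracket A P w u) p
    + poisson_bracket A P w (poisson_bracket A P u v) p = 0"
  using poisson_manifold unfolding poisson_manifold_def by blast+

lemmas P_simps = bilinear_ladd[OF bilinear_P] bilinear_radd[OF bilinear_P]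
  bilinear_lmul[OF bilinear_P] bilinear_rmul[OF bilinear_P]
  bilinear_lsub[OF bilinear_P] bilinear_rsub[OF bilinear_P]
  bilinear_lneg[OF bilinear_P] bilinear_rneg[OF bilinear_P]
  bilinear_lzero[OF bilinear_P] bilinear_rzero[OF bilinear_P]

text \<open>Biduality in finite dimension: a linear functional on covectors is evaluation at the
  vector whose components are its values on the coordinate covectors. This makes the description in
  \<open>sharp\<close> well defined.\<close>

lemma blinfun_apply_sharp: "blinfun_apply b (sharp P \<alpha> p) = P p (\<alpha> p) b"
proof -
  let ?X = "\<Sum>i\<in>Basis. P p (\<alpha> p) (blinfun_inner_left i) *\<^sub>R i"
  have "blinfun_apply b ?X = P p (\<alpha> p) b" for b :: "'e covector"
  proof -
    have "b = (\<Sum>i\<in>Basis. blinfun_apply b i *\<^sub>R blinfun_inner_left i)"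
    proof (rule blinfun_eqI)
      fix v
      have "blinfun_apply b (\<Sum>i\<in>Basis. (v \<bullet> i) *\<^sub>R i) = (\<Sum>i\<in>Basis. (v \<bullet> i) * blinfun_apply b i)"
        by (simp add: blinfun.sum_right blinfun.scaleR_right)
      then have "blinfun_apply b v = (\<Sum>i\<in>Basis. (v \<bullet> i) * blinfun_apply b i)"
        by (simp add: euclidean_representation)
      then show "blinfun_apply b v = blinfun_apply (\<Sum>i\<in>Basis. blinfun_apply b i *\<^sub>R blinfun_inner_left i) v"
        by (simp add: blinfun.sum_left blinfun.scaleR_left inner_commute mult.commute)
    qed
    then have "P p (\<alpha> p) b = P p (\<alpha> p) (\<Sum>i\<in>Basis. blinfun_apply b i *\<^sub>R blinfun_inner_left i)" by simp
    also have "\<dots> = (\<Sum>i\<in>Basis. blinfun_apply b i * P p (\<alpha> p) (blinfun_inner_left i))"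
      using bilinear_P[of p] by (simp add: bilinear_def linear_sum linear_scale)
    finally show ?thesis by (simp add: blinfun.sum_right blinfun.scaleR_right mult.commute)
  qed
  moreover have "X = Y" if "\<And>b :: 'e covector. blinfun_apply b X = blinfun_apply b Y" for X Y :: 'e
    by (rule euclidean_eqI) (use that[of "blinfun_inner_left b" for b] in \<open>simp add: inner_commute\<close>)
  ultimately have "sharp P \<alpha> p = ?X" unfolding sharp_def by (intro the_equality) auto
  with \<open>\<And>b. blinfun_apply b ?X = P p (\<alpha> p) b\<close> show ?thesis by simp
qed

lemma anchor_deriv_eq: "anchor_deriv A P \<alpha> u p = P p (\<alpha> p) (differential A u p)"
  by (simp add: anchor_deriv_def blinfun_apply_sharp)

lemma smooth_fun_anchor_deriv [intro]:
  "\<alpha> \<in> one_forms A \<Longrightarrow> smooth_fun A u \<Longrightarrow> smooth_fun A (anchor_deriv A P \<alpha> u)"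
  by (simp add: anchor_deriv_eq[abs_def] one_forms_differential smooth_fun_P)

text \<open>Cartan's formula in the one case that is needed. The components of \<open>dv\<close> are
  constant near \<open>p\<close>, so the term differentiating them drops out; the other term
  differentiates \<open>m\<close> applied to the vector field, which is the function
  \<open>P(\<alpha>, dv)\<close>.\<close>

lemma lie_derivative_linear_near:
  assumes \<alpha>: "\<alpha> \<in> one_forms A" and v: "linear_near p v m"
  shows "lie_derivative A (sharp P \<alpha>) (differential A v) p =
    differential A (\<lambda>q. P q (\<alpha> q) (differential A v q)) p"
proof -
  \<comment> \<open>The vector field \<open>sharp P \<alpha>\<close>, written in the coordinates of
    the chart at \<open>p\<close>.\<close>
  define Y where "Y = (\<lambda>r. chart_change A r p r (sharp P \<alpha> r)) \<circ> \<psi> p"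
  have pair: "\<exists>V. open V \<and> p \<in> V \<and> V \<subseteq> dm p \<and> (\<forall>r\<in>V. blinfun_apply l (chart_change A r p r (sharp P \<alpha> r)) = P r (\<alpha> r) (differential A u r))"
    if lin: "linear_near p u l" for u l
  proof -
    obtain V where V: "open V" "p \<in> V" "V \<subseteq> dm p"
      "\<And>q v. q \<in> V \<Longrightarrow> blinfun_apply (differential A u q) (chart_change A p q q v) = blinfun_apply l v"
      using linear_near_differential[OF lin] by blast
    have "blinfun_apply l (chart_change A r p r (sharp P \<alpha> r)) = P r (\<alpha> r) (differential A u r)" if "r \<in> V" for r
    proof -
      have "r \<in> dm p" using that V by auto
      then show ?thesis using V(4)[OF that, of "chart_change A r p r (sharp P \<alpha> r)", symmetric]
        by (simp add: chart_change_inverse blinfun_apply_sharp)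
    qed
    then show ?thesis using V by blast
  qed
  have Yl: "(blinfun_apply l \<circ> Y has_derivative blinfun_apply (differential A (\<lambda>q. P q (\<alpha> q) (differential A u q)) p)) (at (\<phi> p p))"
    if lin: "linear_near p u l" for u l
  proof -
    have sm: "smooth_fun A (\<lambda>q. P q (\<alpha> q) (differential A u q))"
      using \<alpha> lin by (auto simp: linear_near_def)
    obtain V where V: "open V" "p \<in> V" "V \<subseteq> dm p"
      "\<And>r. r \<in> V \<Longrightarrow> blinfun_apply l (chart_change A r p r (sharp P \<alpha> r)) = P r (\<alpha> r) (differential A u r)"
      using pair[OF lin] by blast
    show ?thesis
      by (rule has_derivative_transform_within_open[OF has_derivative_differential[OF sm] open_chart_nbhd(1,2)[OF V(1,2) in_chart_dom]])
         (use V in \<open>auto simp: Y_def\<close>)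
  qed
  \<comment> \<open>Nothing is known about the smoothness of \<open>sharp P \<alpha>\<close> itself.
    Its components, however, are the functions \<open>P(\<alpha>, dx)\<close> for the coordinates x,
    and these are smooth.\<close>
  have "Y differentiable (at (\<phi> p p))"
  proof (subst differentiable_componentwise_within, intro ballI)
    fix b :: 'e assume "b \<in> Basis"
    show "(\<lambda>x. Y x \<bullet> b) differentiable (at (\<phi> p p))"
      using Yl[OF linear_near_coord[of p b]]
      by (auto simp: differentiable_def o_def inner_commute)
  qed
  then have Y': "(Y has_derivative frechet_derivative Y (at (\<phi> p p))) (at (\<phi> p p))"
    by (simp add: frechet_derivative_works)
  have "(blinfun_apply m \<circ> Y has_derivative blinfun_apply m \<circ> frechet_derivative Y (at (\<phi> p p))) (at (\<phi> p p))"
    by (rule diff_chain_at[OF Y' bounded_linear_imp_has_derivative[OF blinfun.bounded_linear_right]])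
  then have snd: "blinfun_apply m (frechet_derivative Y (at (\<phi> p p)) w) =
      blinfun_apply (differential A (\<lambda>q. P q (\<alpha> q) (differential A v q)) p) w" for w
    using has_derivative_unique[OF _ Yl[OF v]] by (metis comp_apply)
  obtain V where V: "open V" "p \<in> V" "V \<subseteq> dm p"
      "\<And>q w. q \<in> V \<Longrightarrow> blinfun_apply (differential A v q) (chart_change A p q q w) = blinfun_apply m w"
    using linear_near_differential[OF v] by blast
  have fst: "frechet_derivative ((\<lambda>r. blinfun_apply (differential A v r) (chart_change A p r r w)) \<circ> \<psi> p) (at (\<phi> p p)) = (\<lambda>_. 0)" for w
    by (subst frechet_derivative_cong_open[OF open_chart_nbhd(1,2)[OF V(1,2) in_chart_dom], of _ "\<lambda>_. blinfun_apply m w"])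
       (use V in auto)
  show ?thesis
    unfolding lie_derivative_def fst Y_def[symmetric] differential_linear_near[OF v] snd
    by (simp add: blinfun_apply_inverse)
qed

text \<open>After the two Lie derivatives are evaluated, the first cancels against the term
  d(P(du,dv)), and by antisymmetry of \<open>P\<close> the second is d{u,v}.\<close>

lemma koszul_bracket_linear_near:
  assumes "linear_near p u l" "linear_near p v m"
  shows "koszul_bracket A P (differential A u) (differential A v) p = differential A (poisson_bracket A P u v) p"
proof -
  have s: "smooth_fun A u" "smooth_fun A v" using assms by (auto simp: linear_near_def)
  have "differential A (\<lambda>q. P q (differential A u q) (differential A v q) + P q (differential A v q) (differential A u q)) p
      = differential A (\<lambda>q. 0) p"
    by (subst P_antisym) simp
  then have "differential A (\<lambda>q. P q (differential A u q) (differential A v q)) p +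
      differential A (\<lambda>q. P q (differential A v q) (differential A u q)) p = 0"
    using s by (subst (asm) differential_add) auto
  then show ?thesis
    using s assms unfolding koszul_bracket_def poisson_bracket_def[abs_def]
    by (simp add: lie_derivative_linear_near one_forms_differential algebra_simps eq_neg_iff_add_eq_0)
qed

end

section \<open>Contravariant connections and their curvature\<close>

locale contravariant_lc = poisson_mfd A P
  for A :: "('m::t2_space, 'e::euclidean_space) atlas" and P +
  fixes g :: "('m, 'e) cometric" and D :: "('m, 'e) connection"
  assumes contravariant_levi_civita: "contravariant_levi_civita A P g D"
begin

abbreviation "kb \<equiv> koszul_bracket A P"
abbreviation "anch \<equiv> anchor_deriv A P"

lemma D_closed [intro]: "\<alpha> \<in> one_forms A \<Longrightarrow> \<beta> \<in> one_forms A \<Longrightarrow> D \<alpha> \<beta> \<in> one_forms A"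
  and D_add_left: "\<alpha> \<in> one_forms A \<Longrightarrow> \<beta> \<in> one_forms A \<Longrightarrow> \<gamma> \<in> one_forms A \<Longrightarrow>
    D (\<lambda>p. \<alpha> p + \<beta> p) \<gamma> = (\<lambda>p. D \<alpha> \<gamma> p + D \<beta> \<gamma> p)"
  and D_add_right: "\<alpha> \<in> one_forms A \<Longrightarrow> \<beta> \<in> one_forms A \<Longrightarrow> \<gamma> \<in> one_forms A \<Longrightarrow>
    D \<gamma> (\<lambda>p. \<alpha> p + \<beta> p) = (\<lambda>p. D \<gamma> \<alpha> p + D \<gamma> \<beta> p)"
  and D_scale_left: "smooth_fun A u \<Longrightarrow> \<alpha> \<in> one_forms A \<Longrightarrow> \<beta> \<in> one_forms A \<Longrightarrow>
    D (\<lambda>p. u p *\<^sub>R \<alpha> p) \<beta> = (\<lambda>p. u p *\<^sub>R D \<alpha> \<beta> p)"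
  and D_scale_right: "smooth_fun A u \<Longrightarrow> \<alpha> \<in> one_forms A \<Longrightarrow> \<beta> \<in> one_forms A \<Longrightarrow>
    D \<alpha> (\<lambda>p. u p *\<^sub>R \<beta> p) = (\<lambda>p. u p *\<^sub>R D \<alpha> \<beta> p + anch \<alpha> u p *\<^sub>R \<beta> p)"
  and koszul_bracket_eq: "\<alpha> \<in> one_forms A \<Longrightarrow> \<beta> \<in> one_forms A \<Longrightarrow> kb \<alpha> \<beta> = (\<lambda>p. D \<alpha> \<beta> p - D \<beta> \<alpha> p)"
  and metric_compat: "\<alpha> \<in> one_forms A \<Longrightarrow> \<beta> \<in> one_forms A \<Longrightarrow> \<gamma> \<in> one_forms A \<Longrightarrow>
    anch \<alpha> (\<lambda>q. g q (\<beta> q) (\<gamma> q)) p = g p (D \<alpha> \<beta> p) (\<gamma> p) + g p (\<beta> p) (D \<alpha> \<gamma> p)"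
  using contravariant_levi_civita unfolding contravariant_levi_civita_def by (simp_all (no_asm_simp))

text \<open>Torsion-freeness expresses the bracket through \<open>D\<close>. The algebraic
  properties of the bracket, here and in the next lemmas, are thus inherited from \<open>D\<close>
  without differentiating a general form.\<close>

lemma kb_closed [intro]: "\<alpha> \<in> one_forms A \<Longrightarrow> \<beta> \<in> one_forms A \<Longrightarrow> kb \<alpha> \<beta> \<in> one_forms A"
  by (simp add: koszul_bracket_eq D_closed one_forms_diff)

lemma kb_antisym: "\<alpha> \<in> one_forms A \<Longrightarrow> \<beta> \<in> one_forms A \<Longrightarrow> kb \<alpha> \<beta> p = - kb \<beta> \<alpha> p"
  by (simp add: koszul_bracket_eq)

lemma kb_add_left: "\<alpha> \<in> one_forms A \<Longrightarrow> \<beta> \<in> one_forms A \<Longrightarrow> \<gamma> \<in> one_forms A \<Longrightarrow>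
    kb (\<lambda>p. \<alpha> p + \<beta> p) \<gamma> = (\<lambda>p. kb \<alpha> \<gamma> p + kb \<beta> \<gamma> p)"
  by (simp add: koszul_bracket_eq D_add_left D_add_right one_forms_add algebra_simps)

lemma kb_scale_left: "smooth_fun A u \<Longrightarrow> \<alpha> \<in> one_forms A \<Longrightarrow> \<beta> \<in> one_forms A \<Longrightarrow>
    kb (\<lambda>p. u p *\<^sub>R \<alpha> p) \<beta> = (\<lambda>p. u p *\<^sub>R kb \<alpha> \<beta> p + (- anch \<beta> u p) *\<^sub>R \<alpha> p)"
  by (simp add: koszul_bracket_eq D_scale_left D_scale_right one_forms_scale algebra_simps)

text \<open>The two sides differ by a tensor in \<open>\<alpha>\<close> and \<open>\<beta>\<close>, so it suffices to compare them on
  differentials, where the claim is the Jacobi identity.\<close>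

lemma anchor_koszul_bracket:
  assumes \<alpha>: "\<alpha> \<in> one_forms A" and \<beta>: "\<beta> \<in> one_forms A" and u: "smooth_fun A u"
  shows "anch (kb \<alpha> \<beta>) u p = anch \<alpha> (anch \<beta> u) p - anch \<beta> (anch \<alpha> u) p"
proof -
  define F where "F \<alpha> \<beta> = anch (kb \<alpha> \<beta>) u p - (anch \<alpha> (anch \<beta> u) p - anch \<beta> (anch \<alpha> u) p)" for \<alpha> \<beta>
  have anti: "F \<alpha> \<beta> = - F \<beta> \<alpha>" if "\<alpha> \<in> one_forms A" "\<beta> \<in> one_forms A" for \<alpha> \<beta>
    using kb_antisym[OF that] by (simp add: F_def anchor_deriv_eq P_simps)
  have tens: "tensorial_at p (\<lambda>\<alpha>. F \<alpha> \<beta>)" if \<beta>: "\<beta> \<in> one_forms A" for \<beta>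
    unfolding tensorial_at_def
  proof (intro conjI ballI allI impI)
    fix \<alpha> \<gamma> assume a: "\<alpha> \<in> one_forms A" "\<gamma> \<in> one_forms A"
    have "anch (\<lambda>q. \<alpha> q + \<gamma> q) u = (\<lambda>q. anch \<alpha> u q + anch \<gamma> u q)"
      by (simp add: anchor_deriv_eq P_simps fun_eq_iff)
    then show "F (\<lambda>q. \<alpha> q + \<gamma> q) \<beta> = F \<alpha> \<beta> + F \<gamma> \<beta>"
      using a \<beta> u
      by (simp add: F_def kb_add_left anchor_deriv_eq[of _ "\<lambda>q. anch \<alpha> u q + anch \<gamma> u q"] differential_add smooth_fun_anchor_deriv P_simps)
         (simp add: anchor_deriv_eq P_simps)
  next
    fix w \<alpha> assume a: "\<alpha> \<in> one_forms A" "smooth_fun A w"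
    have "anch (\<lambda>q. w q *\<^sub>R \<alpha> q) u = (\<lambda>q. w q * anch \<alpha> u q)"
      by (simp add: anchor_deriv_eq P_simps fun_eq_iff)
    then show "F (\<lambda>q. w q *\<^sub>R \<alpha> q) \<beta> = w p *\<^sub>R F \<alpha> \<beta>"
      using a \<beta> u
      by (simp add: F_def kb_scale_left anchor_deriv_eq[of _ "\<lambda>q. w q * anch \<alpha> u q"] differential_mult smooth_fun_anchor_deriv P_simps)
         (simp add: anchor_deriv_eq P_simps algebra_simps)
  qed
  have exact: "F (differential A (coord p b)) (differential A (coord p c)) = 0" for b c
  proof -
    have "koszul_bracket A P (differential A (coord p b)) (differential A (coord p c)) p
        = differential A (poisson_bracket A P (coord p b) (coord p c)) p"
      by (rule koszul_bracket_linear_near[OF linear_near_coord linear_near_coord])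
    moreover have "anch (differential A w) u = poisson_bracket A P w u" for w
      by (simp add: anchor_deriv_eq poisson_bracket_def fun_eq_iff)
    \<comment> \<open>The Jacobi identity comes in cyclic form; this and the next fact reorder its
      brackets to match the anchors in \<open>F\<close>.\<close>
    moreover have "poisson_bracket A P (coord p c) (poisson_bracket A P u (coord p b)) p =
        - poisson_bracket A P (coord p c) (poisson_bracket A P (coord p b) u) p"
    proof -
      have "poisson_bracket A P u (coord p b) = (\<lambda>q. (-1) * poisson_bracket A P (coord p b) u q)"
        by (rule ext) (simp add: poisson_bracket_def P_antisym[of _ "differential A u _"])
      moreover have "smooth_fun A (poisson_bracket A P (coord p b) u)"
        unfolding poisson_bracket_def[abs_def] using u by auto
      ultimately have "differential A (poisson_bracket A P u (coord p b)) p = - differential A (poisson_bracket A P (coord p b) u) p"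
        using differential_mult[OF smooth_fun_const[of "-1"], of "poisson_bracket A P (coord p b) u" p] by simp
      then show ?thesis by (simp add: poisson_bracket_def[of A P "coord p c"] P_simps)
    qed
    moreover have "P p (differential A (poisson_bracket A P (coord p b) (coord p c)) p) (differential A u p) =
        - poisson_bracket A P u (poisson_bracket A P (coord p b) (coord p c)) p"
      by (simp add: poisson_bracket_def[of A P u] P_antisym[of p "differential A u p"])
    ultimately show ?thesis
      using jacobi[OF smooth_fun_coord[of p b] smooth_fun_coord[of p c] u, of p]
      by (simp add: F_def anchor_deriv_eq[of "kb _ _"] anchor_deriv_eq[of "differential A _" "poisson_bracket A P _ _"]
          poisson_bracket_def[of A P "coord p _" "poisson_bracket A P _ _"])
  qed
  \<comment> \<open>The expansion works in the first argument only; antisymmetry moves the second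
    argument there.\<close>
  have "F \<alpha> (differential A (coord p c)) = 0" for c
    by (subst tensorial_at_expansion[OF tens \<alpha>]) (auto simp: exact)
  then have "F \<beta> \<alpha> = 0"
    by (subst tensorial_at_expansion[OF tens[OF \<alpha>] \<beta>]) (simp add: anti[OF _ \<alpha>] one_forms_differential)
  then show ?thesis using anti[OF \<alpha> \<beta>] by (simp add: F_def)
qed

section \<open>Curvature as a pointwise tensor\<close>

abbreviation "curv \<equiv> curvature A P D"

lemma curvature_antisym:
  assumes "\<alpha> \<in> one_forms A" "\<beta> \<in> one_forms A" "\<gamma> \<in> one_forms A"
  shows "curv \<alpha> \<beta> \<gamma> p = - curv \<beta> \<alpha> \<gamma> p"
proof -
  have "D (\<lambda>p. (-1) *\<^sub>R kb \<beta> \<alpha> p) \<gamma> = (\<lambda>p. (-1) *\<^sub>R D (kb \<beta> \<alpha>) \<gamma> p)"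
    using assms by (intro D_scale_left) auto
  moreover have "kb \<alpha> \<beta> = (\<lambda>p. (-1) *\<^sub>R kb \<beta> \<alpha> p)" using kb_antisym[OF assms(1,2)] by (simp add: fun_eq_iff)
  ultimately show ?thesis by (simp add: curvature_def)
qed

text \<open>The derivative of \<open>u\<close> appears twice: when \<open>D \<beta>\<close> meets
  \<open>u D \<alpha> \<gamma>\<close>, and in the bracket of \<open>u \<alpha>\<close> with
  \<beta>. The two contributions are opposite.\<close>

lemma curvature_tensorial_left:
  assumes \<beta>: "\<beta> \<in> one_forms A" and \<gamma>: "\<gamma> \<in> one_forms A"
  shows "tensorial_at p (\<lambda>\<alpha>. curv \<alpha> \<beta> \<gamma> p)"
  unfolding tensorial_at_def
proof (intro conjI ballI allI impI)
  fix \<alpha> \<alpha>' assume a: "\<alpha> \<in> one_forms A" "\<alpha>' \<in> one_forms A"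
  show "curv (\<lambda>q. \<alpha> q + \<alpha>' q) \<beta> \<gamma> p = curv \<alpha> \<beta> \<gamma> p + curv \<alpha>' \<beta> \<gamma> p"
    using assms a by (simp add: curvature_def D_add_left D_add_right kb_add_left D_closed kb_closed)
next
  fix u \<alpha> assume a: "\<alpha> \<in> one_forms A" and u: "smooth_fun A u"
  have "smooth_fun A (\<lambda>q. - anch \<beta> u q)"
    using smooth_fun_mult[OF smooth_fun_const[of "-1"] smooth_fun_anchor_deriv[OF \<beta> u]] by simp
  then have "D (kb (\<lambda>q. u q *\<^sub>R \<alpha> q) \<beta>) \<gamma> = (\<lambda>p. u p *\<^sub>R D (kb \<alpha> \<beta>) \<gamma> p + (- anch \<beta> u p) *\<^sub>R D \<alpha> \<gamma> p)"
    using a u assms by (simp only: kb_scale_left D_add_left D_scale_left one_forms_scale kb_closed)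
  then show "curv (\<lambda>q. u q *\<^sub>R \<alpha> q) \<beta> \<gamma> p = u p *\<^sub>R curv \<alpha> \<beta> \<gamma> p"
    using assms a u by (simp add: curvature_def D_scale_left D_scale_right D_closed algebra_simps)
qed

text \<open>The terms with one derivative of \<open>u\<close> are symmetric in \<alpha> and \<beta>
  and cancel. The terms with two derivatives form the commutator of the anchors, which
  \<open>anchor_koszul_bracket\<close> matches with the contribution of the bracket.\<close>

lemma curvature_tensorial_right:
  assumes \<alpha>: "\<alpha> \<in> one_forms A" and \<beta>: "\<beta> \<in> one_forms A"
  shows "tensorial_at p (\<lambda>\<gamma>. curv \<alpha> \<beta> \<gamma> p)"
  unfolding tensorial_at_def
proof (intro conjI ballI allI impI)
  fix \<gamma> \<gamma>' assume a: "\<gamma> \<in> one_forms A" "\<gamma>' \<in> one_forms A"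
  show "curv \<alpha> \<beta> (\<lambda>q. \<gamma> q + \<gamma>' q) p = curv \<alpha> \<beta> \<gamma> p + curv \<alpha> \<beta> \<gamma>' p"
    using assms a by (simp add: curvature_def D_add_right D_closed kb_closed)
next
  fix u \<gamma> assume a: "\<gamma> \<in> one_forms A" and u: "smooth_fun A u"
  have second: "D \<alpha> (D \<beta> (\<lambda>q. u q *\<^sub>R \<gamma> q)) p =
      u p *\<^sub>R D \<alpha> (D \<beta> \<gamma>) p + anch \<alpha> u p *\<^sub>R D \<beta> \<gamma> p + anch \<beta> u p *\<^sub>R D \<alpha> \<gamma> p + anch \<alpha> (anch \<beta> u) p *\<^sub>R \<gamma> p"
    if "\<alpha> \<in> one_forms A" "\<beta> \<in> one_forms A" for \<alpha> \<beta>
    using that a u by (simp add: D_scale_right D_add_right D_closed one_forms_scale smooth_fun_anchor_deriv)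
  show "curv \<alpha> \<beta> (\<lambda>q. u q *\<^sub>R \<gamma> q) p = u p *\<^sub>R curv \<alpha> \<beta> \<gamma> p"
    using assms a u unfolding curvature_def second[OF \<alpha> \<beta>] second[OF \<beta> \<alpha>]
    by (simp add: D_scale_right kb_closed anchor_koszul_bracket algebra_simps)
qed

text \<open>The curvature as a trilinear map of covectors, assembled from its components in the
  coordinate coframe at \<open>p\<close>. Unlike \<open>curv\<close> it can be evaluated on
  covectors without choosing forms through them.\<close>

definition curvature_tensor :: "'m \<Rightarrow> 'e covector \<Rightarrow> 'e covector \<Rightarrow> 'e covector \<Rightarrow> 'e covector" where
  "curvature_tensor p a b c = (\<Sum>i\<in>Basis. \<Sum>j\<in>Basis. \<Sum>k\<in>Basis.
     (blinfun_apply a i * blinfun_apply b j * blinfun_apply c k) *\<^sub>R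
     curv (differential A (coord p i)) (differential A (coord p j)) (differential A (coord p k)) p)"

lemma curvature_eq_tensor:
  assumes \<alpha>: "\<alpha> \<in> one_forms A" and \<beta>: "\<beta> \<in> one_forms A" and \<gamma>: "\<gamma> \<in> one_forms A"
  shows "curv \<alpha> \<beta> \<gamma> p = curvature_tensor p (\<alpha> p) (\<beta> p) (\<gamma> p)"
proof -
  let ?x = "\<lambda>b. differential A (coord p b)"
  have 1: "curv \<alpha> \<beta> \<gamma> p = (\<Sum>i\<in>Basis. blinfun_apply (\<alpha> p) i *\<^sub>R curv (?x i) \<beta> \<gamma> p)"
    by (rule tensorial_at_expansion[OF curvature_tensorial_left[OF \<beta> \<gamma>] \<alpha>])
  \<comment> \<open>Tensoriality in the middle argument is borrowed from the first one by
    antisymmetry.\<close>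
  have 2: "curv (?x i) \<beta> \<gamma> p = (\<Sum>j\<in>Basis. blinfun_apply (\<beta> p) j *\<^sub>R curv (?x i) (?x j) \<gamma> p)" for i
    using tensorial_at_expansion[OF curvature_tensorial_left[of "?x i" \<gamma> p] \<beta>] \<beta> \<gamma>
    by (simp add: one_forms_differential curvature_antisym[of "?x i"] sum_negf)
  have 3: "curv (?x i) (?x j) \<gamma> p = (\<Sum>k\<in>Basis. blinfun_apply (\<gamma> p) k *\<^sub>R curv (?x i) (?x j) (?x k) p)" for i j
    by (rule tensorial_at_expansion[OF curvature_tensorial_right \<gamma>]) auto
  show ?thesis
    unfolding 1 2 3 curvature_tensor_def by (simp add: scaleR_sum_right mult.assoc)
qed

lemma curvature_tensor_add:
  "curvature_tensor p (a + a') b c = curvature_tensor p a b c + curvature_tensor p a' b c"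
  "curvature_tensor p a (b + b') c = curvature_tensor p a b c + curvature_tensor p a b' c"
  "curvature_tensor p a b (c + c') = curvature_tensor p a b c + curvature_tensor p a b c'"
  by (simp_all add: curvature_tensor_def blinfun.add_left algebra_simps sum.distrib)

lemma curvature_tensor_scale:
  "curvature_tensor p (s *\<^sub>R a) b c = s *\<^sub>R curvature_tensor p a b c"
  "curvature_tensor p a (s *\<^sub>R b) c = s *\<^sub>R curvature_tensor p a b c"
  "curvature_tensor p a b (s *\<^sub>R c) = s *\<^sub>R curvature_tensor p a b c"
  by (simp_all add: curvature_tensor_def blinfun.scaleR_left scaleR_sum_right mult_ac)

end

section \<open>Orthonormal frames for indefinite metrics\<close>

text \<open>Only indices below \<open>n\<close> are constrained, so an incomplete family is extended
  by a function update.\<close>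

definition orthonormal_upto :: "nat \<Rightarrow> ('v \<Rightarrow> 'v \<Rightarrow> real) \<Rightarrow> (nat \<Rightarrow> 'v) \<Rightarrow> bool" where
  "orthonormal_upto n H E \<longleftrightarrow>
     (\<forall>i<n. H (E i) (E i) \<in> {1, -1}) \<and> (\<forall>i<n. \<forall>j<n. i \<noteq> j \<longrightarrow> H (E i) (E j) = 0)"

lemma orthonormal_upto_iff:
  "orthonormal_upto n H E \<longleftrightarrow>
     (\<forall>i<n. \<forall>j<n. if i = j then H (E i) (E j) \<in> {1, -1} else H (E i) (E j) = 0)"
  unfolding orthonormal_upto_def by (auto split: if_splits)

lemma orthonormal_upto_square: "orthonormal_upto n H E \<Longrightarrow> i < n \<Longrightarrow> H (E i) (E i) * H (E i) (E i) = 1"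
  by (auto simp: orthonormal_upto_def)

lemma orthonormal_upto_ne: "orthonormal_upto n H E \<Longrightarrow> i < n \<Longrightarrow> j < n \<Longrightarrow> i \<noteq> j \<Longrightarrow> H (E i) (E j) = 0"
  by (auto simp: orthonormal_upto_def)

locale scalar_product_space =
  fixes H :: "'v::real_vector \<Rightarrow> 'v \<Rightarrow> real"
  assumes bilinear: "bilinear H" and sym: "H v w = H w v"
    and nondegenerate: "(\<And>w. H v w = 0) \<Longrightarrow> v = 0"
begin

lemmas simps = bilinear_ladd[OF bilinear] bilinear_radd[OF bilinear]
  bilinear_lmul[OF bilinear] bilinear_rmul[OF bilinear]
  bilinear_lsub[OF bilinear] bilinear_rsub[OF bilinear]
  bilinear_lzero[OF bilinear] bilinear_rzero[OF bilinear]

lemma linear_left: "linear (\<lambda>v. H v w)" and linear_right: "linear (H v)"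
  using bilinear by (auto simp: bilinear_def)

lemma sum_left: "H (\<Sum>i\<in>I. f i) w = (\<Sum>i\<in>I. H (f i) w)"
  using linear_sum[OF linear_left] .

lemma sum_right: "H w (\<Sum>i\<in>I. f i) = (\<Sum>i\<in>I. H w (f i))"
  using linear_sum[OF linear_right] .

text \<open>The Gram-Schmidt remainder. The factor \<open>H (E j) (E j)\<close> is the sign of
  \<open>E j\<close>; a sign is its own inverse, so no division occurs.\<close>

definition residual :: "nat \<Rightarrow> (nat \<Rightarrow> 'v) \<Rightarrow> 'v \<Rightarrow> 'v" where
  "residual k E w = w - (\<Sum>j<k. (H (E j) (E j) * H w (E j)) *\<^sub>R E j)"

lemma residual_orthogonal:
  assumes "orthonormal_upto k H E" "i < k"
  shows "H (residual k E w) (E i) = 0"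
proof -
  have "(\<Sum>j<k. H (E j) (E j) * H w (E j) * H (E j) (E i)) = (\<Sum>j\<in>{i}. H (E j) (E j) * H w (E j) * H (E j) (E i))"
    by (rule sum.mono_neutral_right) (use assms in \<open>auto simp: orthonormal_upto_ne\<close>)
  also have "\<dots> = H w (E i)"
    using orthonormal_upto_square[OF assms] by (simp add: algebra_simps)
  finally show ?thesis by (simp add: residual_def simps sum_left)
qed

lemma orthonormal_upto_Suc:
  assumes E: "orthonormal_upto k H E" and c: "c * c * H (residual k E w) (residual k E w) \<in> {1, -1}"
  shows "orthonormal_upto (Suc k) H (E(k := c *\<^sub>R residual k E w))"
proof -
  have "H (residual k E w) (E i) = 0" "H (E i) (residual k E w) = 0" if "i < k" for i
    using residual_orthogonal[OF E that] sym[of "E i"] by simp_all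
  then show ?thesis
    using E c by (auto simp: orthonormal_upto_def less_Suc_eq simps mult.assoc)
qed

text \<open>If every residual were isotropic, then by polarization all residuals would vanish.\<close>

lemma nonisotropic_residual:
  assumes E: "orthonormal_upto k H E" and "w \<notin> span (E ` {..<k})"
  shows "\<exists>w. H (residual k E w) (residual k E w) \<noteq> 0"
proof (rule ccontr)
  assume "\<not> ?thesis"
  then have iso: "H (residual k E w) (residual k E w) = 0" for w by blast
  have add: "residual k E (v + w) = residual k E v + residual k E w" for v w
    by (simp add: residual_def simps algebra_simps sum.distrib)
  have pol: "H (residual k E v) (residual k E w) = 0" for v w
    using iso[of "v + w"] iso[of v] iso[of w] sym[of "residual k E w" "residual k E v"] by (simp add: add simps)
  have "residual k E w = 0"
  proof (rule nondegenerate)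
    fix v
    have "v = residual k E v + (\<Sum>j<k. (H (E j) (E j) * H v (E j)) *\<^sub>R E j)" by (simp add: residual_def)
    then have "H (residual k E w) v = H (residual k E w) (residual k E v + (\<Sum>j<k. (H (E j) (E j) * H v (E j)) *\<^sub>R E j))"
      by metis
    also have "\<dots> = 0"
      by (simp add: simps sum_right pol residual_orthogonal[OF E])
    finally show "H (residual k E w) v = 0" .
  qed
  then have "w = (\<Sum>j<k. (H (E j) (E j) * H w (E j)) *\<^sub>R E j)" by (simp add: residual_def)
  moreover have "(\<Sum>j<k. (H (E j) (E j) * H w (E j)) *\<^sub>R E j) \<in> span (E ` {..<k})"
    by (intro span_sum span_scale span_base) auto
  ultimately show False using assms(2) by metis
qed

text \<open>Each \<open>e' j\<close> is expanded in the other basis in both arguments of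
  \<open>T\<close>. Summing over \<open>j\<close> first, the completeness relation of
  \<open>e'\<close> turns the coefficients into \<open>H (e i) (e k)\<close>, and orthogonality
  leaves the diagonal.\<close>

lemma trace_eq:
  assumes T: "bilinear T" and e: "orthonormal_upto n H e" and e': "orthonormal_upto m H e'"
    and ex: "\<And>a. a = (\<Sum>i<n. (H (e i) (e i) * H a (e i)) *\<^sub>R e i)"
    and ex': "\<And>a. a = (\<Sum>i<m. (H (e' i) (e' i) * H a (e' i)) *\<^sub>R e' i)"
  shows "(\<Sum>i<n. H (e i) (e i) * T (e i) (e i)) = (\<Sum>i<m. H (e' i) (e' i) * T (e' i) (e' i))"
proof -
  let ?n = "\<lambda>i. H (e i) (e i)" and ?m = "\<lambda>i. H (e' i) (e' i)"
  have lin: "linear (\<lambda>a. T a b)" "linear (T b)" for b using T by (auto simp: bilinear_def)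
  have ge: "H a b = (\<Sum>j<m. ?m j * H a (e' j) * H b (e' j))" for a b
    by (subst ex'[of a]) (simp add: simps sum_left sym[of "e' _" b] mult.assoc)
  have Te: "T (e' j) (e' j) = (\<Sum>i<n. \<Sum>k<n. ?n i * ?n k * H (e' j) (e i) * H (e' j) (e k) * T (e i) (e k))" for j
  proof -
    have 1: "T (e' j) (e' j) = (\<Sum>i<n. ?n i * H (e' j) (e i) * T (e i) (e' j))"
      by (subst (1) ex[of "e' j"]) (simp add: linear_sum[OF lin(1)] linear_scale[OF lin(1)])
    have 2: "T (e i) (e' j) = (\<Sum>k<n. ?n k * H (e' j) (e k) * T (e i) (e k))" for i
      by (subst ex[of "e' j"]) (simp add: linear_sum[OF lin(2)] linear_scale[OF lin(2)])
    show ?thesis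
      by (subst 1, subst 2) (simp only: sum_distrib_left mult_ac)
  qed
  have "(\<Sum>j<m. ?m j * T (e' j) (e' j)) =
      (\<Sum>j<m. \<Sum>i<n. \<Sum>k<n. ?n i * ?n k * T (e i) (e k) * (?m j * H (e i) (e' j) * H (e k) (e' j)))"
    unfolding Te by (simp add: sum_distrib_left sym[of "e' _" "e _"] mult_ac)
  also have "\<dots> = (\<Sum>i<n. \<Sum>k<n. ?n i * ?n k * T (e i) (e k) * H (e i) (e k))"
    by (rule trans[OF sum.swap], rule sum.cong[OF refl], rule trans[OF sum.swap], rule sum.cong[OF refl])
       (simp only: ge[of "e _" "e _"] sum_distrib_left)
  also have "\<dots> = (\<Sum>i<n. ?n i * T (e i) (e i))"
  proof (intro sum.cong refl)
    fix i assume i: "i \<in> {..<n}"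
    have "(\<Sum>k<n. ?n i * ?n k * T (e i) (e k) * H (e i) (e k)) = (\<Sum>k\<in>{i}. ?n i * ?n k * T (e i) (e k) * H (e i) (e k))"
      by (rule sum.mono_neutral_right) (use i e in \<open>auto simp: orthonormal_upto_ne\<close>)
    then show "(\<Sum>k<n. ?n i * ?n k * T (e i) (e k) * H (e i) (e k)) = ?n i * T (e i) (e i)"
      using orthonormal_upto_square[OF e, of i] i by (simp add: algebra_simps)
  qed
  finally show ?thesis by simp
qed

end

section \<open>Nondegenerate forms in finite dimension\<close>

locale euclidean_scalar_product = scalar_product_space H for H :: "'e::euclidean_space \<Rightarrow> 'e \<Rightarrow> real"
begin

text \<open>Orthonormal vectors are independent even for an indefinite form, because their squares
  are nonzero. As many as the dimension span the space, and a vector orthogonal to everything is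
  zero.\<close>

lemma residual_eq_0:
  assumes E: "orthonormal_upto DIM('e) H E"
  shows "residual DIM('e) E w = 0"
proof -
  let ?n = "DIM('e)"
  have ne: "H (E i) (E i) \<noteq> 0" if "i < ?n" for i using orthonormal_upto_square[OF E that] by auto
  have inj: "inj_on E {..<?n}"
    by (rule inj_onI) (metis E lessThan_iff ne orthonormal_upto_ne)
  have "independent (E ` {..<?n})"
  proof (rule independent_if_scalars_zero)
    fix f x assume s: "(\<Sum>x\<in>E ` {..<?n}. f x *\<^sub>R x) = 0" and "x \<in> E ` {..<?n}"
    then obtain j where j: "j < ?n" "x = E j" by auto
    have "0 = H (\<Sum>i<?n. f (E i) *\<^sub>R E i) (E j)"
      using s by (simp add: sum.reindex[OF inj] simps)
    also have "\<dots> = (\<Sum>i<?n. f (E i) * H (E i) (E j))" by (simp add: sum_left simps)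
    also have "\<dots> = (\<Sum>i\<in>{j}. f (E i) * H (E i) (E j))"
      by (rule sum.mono_neutral_right) (use j E in \<open>auto simp: orthonormal_upto_ne\<close>)
    finally show "f x = 0" using ne[OF j(1)] j by simp
  qed simp
  then have "UNIV \<subseteq> span (E ` {..<?n})"
    by (intro card_ge_dim_independent) (simp_all add: card_image[OF inj])
  moreover have "H (residual ?n E w) v = 0" if "v \<in> span (E ` {..<?n})" for v
    using linear_eq_0_on_span[OF linear_right _ that] residual_orthogonal[OF E] by blast
  ultimately show ?thesis using nondegenerate by blast
qed

lemma orthonormal_expansion:
  "orthonormal_upto DIM('e) H E \<Longrightarrow> w = (\<Sum>j<DIM('e). (H (E j) (E j) * H w (E j)) *\<^sub>R E j)"
  using residual_eq_0[of E w] by (simp add: residual_def)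

text \<open>The auxiliary map \<open>L\<close> is the Gram matrix of \<open>H\<close>: nondegeneracy
  makes it injective, and equality of dimensions makes it surjective.\<close>

lemma represents: "\<exists>X. \<forall>Y. H X Y = blinfun_apply a Y"
proof -
  define L where "L X = (\<Sum>b\<in>Basis. H X b *\<^sub>R b)" for X
  have rep: "H X Y = L X \<bullet> Y" for X Y
  proof -
    have "H X Y = H X (\<Sum>b\<in>Basis. (Y \<bullet> b) *\<^sub>R b)" by (simp add: euclidean_representation)
    also have "\<dots> = (\<Sum>b\<in>Basis. (Y \<bullet> b) * H X b)" by (simp add: sum_right simps)
    finally show ?thesis by (simp add: L_def inner_sum_left) (simp add: inner_commute mult.commute)
  qed
  have "linear L"
    by (rule linearI) (simp_all add: L_def simps sum.distrib algebra_simps scaleR_sum_right)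
  moreover have "inj L"
    unfolding linear_injective_0[OF \<open>linear L\<close>] using nondegenerate rep by (metis inner_zero_left)
  ultimately have "surj L" by (rule linear_injective_imp_surjective) simp
  then obtain X where X: "L X = (\<Sum>b\<in>Basis. blinfun_apply a b *\<^sub>R b)" by (metis surjD)
  have "H X Y = blinfun_apply a Y" for Y
  proof -
    have "blinfun_apply a (\<Sum>b\<in>Basis. (Y \<bullet> b) *\<^sub>R b) = (\<Sum>b\<in>Basis. (Y \<bullet> b) * blinfun_apply a b)"
      by (simp add: blinfun.sum_right blinfun.scaleR_right)
    then have "blinfun_apply a Y = (\<Sum>b\<in>Basis. (Y \<bullet> b) * blinfun_apply a b)"
      by (simp add: euclidean_representation)
    then show ?thesis by (simp add: rep X inner_sum_left) (simp add: inner_commute mult.commute)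
  qed
  then show ?thesis by blast
qed

end

section \<open>Smooth orthonormal frames near a point\<close>

lemma smooth_on_bilinear_field:
  fixes H :: "'e::euclidean_space \<Rightarrow> 'e \<Rightarrow> 'e \<Rightarrow> real"
  assumes "open U" "\<And>x. x \<in> U \<Longrightarrow> bilinear (H x)" "\<And>v w. smooth_on U (\<lambda>x. H x v w)"
    "smooth_on U X" "smooth_on U Y"
  shows "smooth_on U (\<lambda>x. H x (X x) (Y x))"
proof -
  have "smooth_on U (\<lambda>x. \<Sum>i\<in>Basis. \<Sum>j\<in>Basis. (X x \<bullet> i) * ((Y x \<bullet> j) * H x i j))"
    using assms by (intro smooth_on_sum smooth_on_mult smooth_on_inner) auto
  moreover have "(\<Sum>i\<in>Basis. \<Sum>j\<in>Basis. (X x \<bullet> i) * ((Y x \<bullet> j) * H x i j)) = H x (X x) (Y x)" if "x \<in> U" for x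
  proof -
    have l: "linear (\<lambda>v. H x v w)" "linear (H x w)" for w using assms(2)[OF that] by (auto simp: bilinear_def)
    have 1: "H x (X x) w = (\<Sum>i\<in>Basis. (X x \<bullet> i) * H x i w)" for w
      using linear_sum[OF l(1), of "\<lambda>i. (X x \<bullet> i) *\<^sub>R i" Basis w] by (simp add: euclidean_representation linear_scale[OF l(1)])
    have 2: "H x v (Y x) = (\<Sum>j\<in>Basis. (Y x \<bullet> j) * H x v j)" for v
      using linear_sum[OF l(2), of v "\<lambda>i. (Y x \<bullet> i) *\<^sub>R i" Basis] by (simp add: euclidean_representation linear_scale[OF l(2)])
    show ?thesis by (subst 1, subst 2) (simp add: sum_distrib_left)
  qed
  ultimately show ?thesis by (subst smooth_on_cong[OF assms(1)]) auto
qed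

text \<open>Gram-Schmidt with a choice at each step. A fixed basis could produce a null residual, so
  the next constant vector \<open>w\<close> is selected to have a non-null residual at
  \<open>x0\<close>; by continuity it stays non-null nearby, at the price of a smaller
  neighbourhood.\<close>

lemma smooth_orthonormal_frame_exists:
  fixes H :: "'e::euclidean_space \<Rightarrow> 'e \<Rightarrow> 'e \<Rightarrow> real"
  assumes "open S" "x0 \<in> S" and form: "\<And>x. x \<in> S \<Longrightarrow> euclidean_scalar_product (H x)"
    and smooth: "\<And>v w. smooth_on S (\<lambda>x. H x v w)" and "k \<le> DIM('e)"
  shows "\<exists>E U. open U \<and> x0 \<in> U \<and> U \<subseteq> S \<and> (\<forall>i<k. smooth_on U (E i)) \<and>
     (\<forall>x\<in>U. orthonormal_upto k (H x) (\<lambda>i. E i x))"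
  using assms(5)
proof (induction k)
  case 0
  then show ?case using assms(1,2) by (auto simp: orthonormal_upto_def)
next
  case (Suc k)
  then obtain E U where U: "open U" "x0 \<in> U" "U \<subseteq> S" and "\<forall>i<k. smooth_on U (E i)"
    and "\<forall>x\<in>U. orthonormal_upto k (H x) (\<lambda>i. E i x)"
    using Suc_leD by blast
  then have sm: "\<And>i. i < k \<Longrightarrow> smooth_on U (E i)"
    and on: "\<And>x. x \<in> U \<Longrightarrow> orthonormal_upto k (H x) (\<lambda>i. E i x)"
    by auto
  have bil: "bilinear (H x)" if "x \<in> U" for x
    using form[of x] that U by (auto simp: euclidean_scalar_product_def scalar_product_space_def)
  have smU: "smooth_on U (\<lambda>x. H x v w)" for v w using smooth_on_subset[OF smooth U(3)] .
  note smH = smooth_on_bilinear_field[OF U(1) bil smU]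
  let ?R = "\<lambda>w x. scalar_product_space.residual (H x) k (\<lambda>i. E i x) w"
  interpret x0: euclidean_scalar_product "H x0" using form U by auto
  \<comment> \<open>Fewer vectors than the dimension cannot span, which gives
    \<open>nonisotropic_residual\<close> a vector to start from.\<close>
  have "dim (span ((\<lambda>i. E i x0) ` {..<k})) \<le> card {..<k}"
    by (metis card_image_le dim_span dim_le_card' finite_imageI finite_lessThan le_trans)
  then have "span ((\<lambda>i. E i x0) ` {..<k}) \<noteq> UNIV" using Suc.prems by (metis Suc_le_lessD card_lessThan dim_UNIV not_le)
  then obtain w where "H x0 (?R w x0) (?R w x0) \<noteq> 0"
    using x0.nonisotropic_residual[OF on[OF U(2)]] by blast
  define N where "N x = H x (?R w x) (?R w x)" for x
  \<comment> \<open>The causal character of the new vector. On \<open>V\<close> the sign of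
    \<open>N\<close> agrees with \<open>s\<close>, so \<open>s * N\<close> is positive and its power
    -1/2 is smooth.\<close>
  define s where "s = sgn (N x0)"
  have s: "s * N x0 > 0" "s \<in> {1, -1}"
    using \<open>H x0 _ _ \<noteq> 0\<close> by (auto simp: s_def N_def sgn_if)
  have smR: "smooth_on U (?R w)"
  proof (subst smooth_on_cong[OF U(1)])
    show "?R w x = w - (\<Sum>j<k. (H x (E j x) (E j x) * H x w (E j x)) *\<^sub>R E j x)" if "x \<in> U" for x
      using form[of x] U(3) that by (auto simp: euclidean_scalar_product_def scalar_product_space.residual_def)
    show "smooth_on U (\<lambda>x. w - (\<Sum>j<k. (H x (E j x) (E j x) * H x w (E j x)) *\<^sub>R E j x))"
      by (intro smooth_on_diff smooth_on_sum smooth_on_scaleR smooth_on_mult smH U smooth_on_const sm) auto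
  qed
  have smN: "smooth_on U N" unfolding N_def by (intro smH smR)
  define V where "V = U \<inter> (\<lambda>x. s * N x) -` {0<..}"
  have cN: "continuous_on U (\<lambda>x. s * N x)" by (intro continuous_intros smooth_on_imp_continuous_on[OF smN])
  have "open V"
    unfolding V_def by (rule continuous_open_preimage[OF cN U(1) open_greaterThan])
  moreover have "x0 \<in> V" "V \<subseteq> U" using s(1) U by (auto simp: V_def)
  ultimately have V: "open V" "x0 \<in> V" "V \<subseteq> U" by blast+
  define F where "F = E(k := (\<lambda>x. (s * N x) powr (-1/2) *\<^sub>R ?R w x))"
  have "smooth_on V (\<lambda>x. s * N x)"
    by (intro smooth_on_mult V smooth_on_const smooth_on_subset[OF smN])
  then have "smooth_on V ((\<lambda>x. x powr (-1/2)) \<circ> (\<lambda>x. s * N x))"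
    by (intro smooth_on_compose[OF V(1) open_greaterThan[of 0] _ _ smooth_on_powr]) (auto simp: V_def)
  then have "smooth_on V (\<lambda>x. (s * N x) powr (-1/2) *\<^sub>R ?R w x)"
    by (intro smooth_on_scaleR V smooth_on_subset[OF smR]) (simp add: o_def)
  then have "smooth_on V (F i)" if "i < Suc k" for i
    using that sm smooth_on_subset[OF _ V(3)] by (auto simp: F_def less_Suc_eq)
  moreover have "orthonormal_upto (Suc k) (H x) (\<lambda>i. F i x)" if x: "x \<in> V" for x
  proof -
    interpret x: euclidean_scalar_product "H x" using form U V x by auto
    have pos: "s * N x > 0" using x by (simp add: V_def)
    \<comment> \<open>The square of the normalized vector is N/(s N), which equals \<open>s\<close>
      since \<open>s\<close> is 1 or -1.\<close>
    have "(s * N x) powr (-1/2) * (s * N x) powr (-1/2) = inverse (s * N x)"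
      unfolding powr_add[symmetric] using pos by (simp add: powr_minus)
    then have "(s * N x) powr (-1/2) * (s * N x) powr (-1/2) * N x = s"
      using pos s(2) by (auto simp: field_simps)
    moreover have "(\<lambda>i. F i x) = (\<lambda>i. E i x)(k := (s * N x) powr (-1/2) *\<^sub>R ?R w x)"
      by (auto simp: F_def)
    ultimately show ?thesis
      using x.orthonormal_upto_Suc[OF on[of x], of "(s * N x) powr (-1/2)" w] s(2) V(3) x
      by (auto simp: N_def)
  qed
  ultimately show ?case using V U by (intro exI[of _ F] exI[of _ V]) auto
qed

section \<open>Cometric and orthonormal coframes on a manifold\<close>

locale pseudo_riemannian_mfd = smooth_mfd A
  for A :: "('m::t2_space, 'e::euclidean_space) atlas" +
  fixes h :: "('m, 'e) metric"
  assumes pseudo_riemannian: "pseudo_riemannian_manifold A h"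
begin

abbreviation "g \<equiv> cometric_of h"

sublocale h: euclidean_scalar_product "h p" for p
  by unfold_locales (use pseudo_riemannian[unfolded pseudo_riemannian_manifold_def] in blast)+

lemma smooth_metric: "smooth_in_chart A p (\<lambda>q. h q (chart_change A p q q v) (chart_change A p q q w))"
  using pseudo_riemannian by (simp add: pseudo_riemannian_manifold_def)

lemma raise_unique: "(\<And>Y. h p X Y = blinfun_apply a Y) \<Longrightarrow> raise h p a = X"
  unfolding raise_def
proof (rule the_equality)
  fix Z assume "\<And>Y. h p X Y = blinfun_apply a Y" "\<forall>Y. h p Z Y = blinfun_apply a Y"
  then have "Z - X = 0" by (intro h.nondegenerate[of p]) (simp add: h.simps)
  then show "Z = X" by simp
qed simp

lemma metric_raise: "h p (raise h p a) Y = blinfun_apply a Y"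
proof -
  obtain X where "\<forall>Y. h p X Y = blinfun_apply a Y" using h.represents[of p a] by blast
  then show ?thesis using raise_unique by metis
qed

lemma cometric_eq: "g p a b = blinfun_apply a (raise h p b)"
  by (simp add: cometric_of_def metric_raise)

lemma raise_add: "raise h p (a + b) = raise h p a + raise h p b"
  by (rule raise_unique) (simp add: h.simps metric_raise blinfun.add_left)

lemma raise_scale: "raise h p (c *\<^sub>R a) = c *\<^sub>R raise h p a"
  by (rule raise_unique) (simp add: h.simps metric_raise blinfun.scaleR_left)

lemma raise_inject: "raise h p a = raise h p b \<Longrightarrow> a = b"
  by (rule blinfun_eqI) (metis metric_raise)

lemma linear_raise: "linear (raise h p)"
  by (rule linearI) (auto simp: raise_add raise_scale)

text \<open>The inverse of \<open>raise\<close>; it provides the test covectors that make the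
  cometric nondegenerate.\<close>

definition lower :: "'m \<Rightarrow> 'e \<Rightarrow> 'e covector" where
  "lower p X = Blinfun (h p X)"

lemma lower_apply: "blinfun_apply (lower p X) Y = h p X Y"
  using linear_conv_bounded_linear[of "h p X"] h.linear_right[of p X]
  by (simp add: lower_def bounded_linear_Blinfun_apply)

lemma raise_lower: "raise h p (lower p X) = X"
  by (rule raise_unique) (simp add: lower_apply)

sublocale g: scalar_product_space "g p" for p
proof
  show "bilinear (g p)"
    unfolding bilinear_def cometric_eq
    by (auto intro!: linearI simp: raise_add raise_scale blinfun.bilinear_simps)
  show "g p a b = g p b a" for a b by (simp add: cometric_of_def h.sym[of p "raise h p a"])
  show "a = 0" if "\<And>b. g p a b = 0" for a
    by (rule blinfun_eqI) (use that[of "lower p _"] in \<open>simp add: cometric_eq raise_lower\<close>)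
qed

lemma orthonormal_raise: "orthonormal_upto n (g p) e \<longleftrightarrow> orthonormal_upto n (h p) (\<lambda>i. raise h p (e i))"
  by (simp add: orthonormal_upto_def cometric_of_def)

text \<open>Transported from tangent vectors: \<open>raise\<close> is linear, injective, and carries
  the cometric to the metric.\<close>

lemma covector_orthonormal_expansion:
  assumes "orthonormal_upto DIM('e) (g p) e"
  shows "a = (\<Sum>i<DIM('e). (g p (e i) (e i) * g p a (e i)) *\<^sub>R e i)"
proof (rule raise_inject)
  show "raise h p a = raise h p (\<Sum>i<DIM('e). (g p (e i) (e i) * g p a (e i)) *\<^sub>R e i)"
    using h.orthonormal_expansion[OF assms[unfolded orthonormal_raise], of "raise h p a"]
    by (simp add: linear_sum[OF linear_raise] raise_scale cometric_of_def)
qed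

text \<open>Expresses the cometric without \<open>raise\<close>. Smoothness of g(\<alpha>, \<beta>)
  then follows from that of a frame, and the inverse of the Gram matrix never has to be
  differentiated.\<close>

lemma cometric_frame:
  assumes "orthonormal_upto DIM('e) (h p) E"
  shows "g p a b = (\<Sum>i<DIM('e). h p (E i) (E i) * blinfun_apply a (E i) * blinfun_apply b (E i))"
proof -
  have "g p b a = blinfun_apply b (\<Sum>i<DIM('e). (h p (E i) (E i) * h p (raise h p a) (E i)) *\<^sub>R E i)"
    using h.orthonormal_expansion[OF assms, of "raise h p a"] by (simp add: cometric_eq)
  then show ?thesis
    by (simp add: g.sym[of p a b] metric_raise blinfun.sum_right blinfun.scaleR_right)
qed

text \<open>The metric at a nearby point in the components of the chart at \<open>p\<close>. All
  these forms live on one fixed vector space, as Gram-Schmidt with a parameter requires; they are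
  nondegenerate because chart changes are invertible.\<close>

lemma chart_scalar_product:
  assumes "x \<in> \<phi> p ` dm p"
  shows "euclidean_scalar_product (\<lambda>v w. h (\<psi> p x) (chart_change A p (\<psi> p x) (\<psi> p x) v) (chart_change A p (\<psi> p x) (\<psi> p x) w))"
proof -
  let ?q = "\<psi> p x"
  have q: "?q \<in> dm p" using assms by simp
  interpret c: linear "chart_change A p ?q ?q" by (rule linear_chart_change) (use q in auto)
  show ?thesis
  proof
    show "bilinear (\<lambda>v w. h ?q (chart_change A p ?q ?q v) (chart_change A p ?q ?q w))"
      unfolding bilinear_def by (auto intro!: linearI simp: c.add c.scale h.simps)
    show "h ?q (chart_change A p ?q ?q v) (chart_change A p ?q ?q w) = h ?q (chart_change A p ?q ?q w) (chart_change A p ?q ?q v)" for v w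
      by (rule h.sym)
    show "v = 0" if "\<And>w. h ?q (chart_change A p ?q ?q v) (chart_change A p ?q ?q w) = 0" for v
    proof -
      have "h ?q (chart_change A p ?q ?q v) y = 0" for y
        using that[of "chart_change A ?q p ?q y"] q by (simp add: chart_change_inverse)
      then have "chart_change A p ?q ?q v = 0" by (rule h.nondegenerate)
      then have "chart_change A ?q p ?q (chart_change A p ?q ?q v) = 0"
        using linear_0[OF linear_chart_change[of ?q ?q p]] q by simp
      then show ?thesis using q by (simp add: chart_change_inverse)
    qed
  qed
qed

lemma local_orthonormal_frame:
  obtains E V where "open V" "p \<in> V" "V \<subseteq> dm p" "\<And>i. i < DIM('e) \<Longrightarrow> smooth_on (\<phi> p ` V) (E i)"
    "\<And>q. q \<in> V \<Longrightarrow> orthonormal_upto DIM('e) (h q) (\<lambda>i. chart_change A p q q (E i (\<phi> p q)))"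
proof -
  let ?H = "\<lambda>x v w. h (\<psi> p x) (chart_change A p (\<psi> p x) (\<psi> p x) v) (chart_change A p (\<psi> p x) (\<psi> p x) w)"
  have sm: "smooth_on (\<phi> p ` dm p) (\<lambda>x. ?H x v w)" for v w
    using smooth_metric[of p v w] by (simp add: smooth_in_chart_def o_def)
  have "\<exists>E U. open U \<and> \<phi> p p \<in> U \<and> U \<subseteq> \<phi> p ` dm p \<and> (\<forall>i<DIM('e). smooth_on U (E i)) \<and>
      (\<forall>x\<in>U. orthonormal_upto DIM('e) (?H x) (\<lambda>i. E i x))"
    by (rule smooth_orthonormal_frame_exists[OF open_chart_image _ chart_scalar_product sm]) auto
  then obtain E U where U: "open U" "\<phi> p p \<in> U" "U \<subseteq> \<phi> p ` dm p"
    "\<forall>i<DIM('e). smooth_on U (E i)" "\<forall>x\<in>U. orthonormal_upto DIM('e) (?H x) (\<lambda>i. E i x)"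
    by blast
  define V where "V = dm p \<inter> \<phi> p -` U"
  have "continuous_on (dm p) (\<phi> p)" using chart_homeomorphism[of p] by (auto simp: homeomorphism_def)
  then have "open V" unfolding V_def by (rule continuous_open_preimage[OF _ open_chart_dom U(1)])
  moreover have "smooth_on (\<phi> p ` V) (E i)" if "i < DIM('e)" for i
    by (rule smooth_on_subset[of U]) (use U that in \<open>auto simp: V_def\<close>)
  moreover have "orthonormal_upto DIM('e) (h q) (\<lambda>i. chart_change A p q q (E i (\<phi> p q)))" if "q \<in> V" for q
    using bspec[OF U(5), of "\<phi> p q"] that by (simp add: V_def orthonormal_upto_def)
  ultimately show ?thesis using that[of V E] U(2) by (auto simp: V_def)
qed

lemma smooth_on_components:
  assumes "\<alpha> \<in> one_forms A" "open V" "V \<subseteq> dm p" "smooth_on (\<phi> p ` V) X"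
  shows "smooth_on (\<phi> p ` V) ((\<lambda>q. blinfun_apply (\<alpha> q) (chart_change A p q q (X (\<phi> p q)))) \<circ> \<psi> p)"
proof -
  have o: "open (\<phi> p ` V)" by (rule open_chart_map_image) fact+
  have "smooth_on (\<phi> p ` V) ((\<lambda>q. blinfun_apply (\<alpha> q) (chart_change A p q q b)) \<circ> \<psi> p)" for b
    using one_forms_smooth[OF assms(1), of p b] assms(3)
    by (auto simp: smooth_in_chart_def intro: smooth_on_subset)
  then have "smooth_on (\<phi> p ` V) (\<lambda>x. \<Sum>b\<in>Basis. (X x \<bullet> b) * ((\<lambda>q. blinfun_apply (\<alpha> q) (chart_change A p q q b)) \<circ> \<psi> p) x)"
    by (intro smooth_on_sum smooth_on_mult smooth_on_inner o assms smooth_on_const)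
  moreover have "(\<Sum>b\<in>Basis. (X x \<bullet> b) * ((\<lambda>q. blinfun_apply (\<alpha> q) (chart_change A p q q b)) \<circ> \<psi> p) x) =
     ((\<lambda>q. blinfun_apply (\<alpha> q) (chart_change A p q q (X (\<phi> p q)))) \<circ> \<psi> p) x" if "x \<in> \<phi> p ` V" for x
  proof -
    let ?q = "\<psi> p x"
    have x: "x \<in> \<phi> p ` dm p" using that assms(3) by auto
    interpret c: linear "chart_change A p ?q ?q" by (rule linear_chart_change) (use x in auto)
    have "chart_change A p ?q ?q (X x) = chart_change A p ?q ?q (\<Sum>b\<in>Basis. (X x \<bullet> b) *\<^sub>R b)"
      by (simp add: euclidean_representation)
    also have "\<dots> = (\<Sum>b\<in>Basis. (X x \<bullet> b) *\<^sub>R chart_change A p ?q ?q b)"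
      by (simp only: c.sum c.scale)
    finally show ?thesis using x by (simp add: blinfun.sum_right blinfun.scaleR_right)
  qed
  ultimately show ?thesis by (subst smooth_on_cong[OF o]) auto
qed

lemma smooth_on_metric_components:
  assumes "open V" "V \<subseteq> dm p" "smooth_on (\<phi> p ` V) X" "smooth_on (\<phi> p ` V) Y"
  shows "smooth_on (\<phi> p ` V) ((\<lambda>q. h q (chart_change A p q q (X (\<phi> p q))) (chart_change A p q q (Y (\<phi> p q)))) \<circ> \<psi> p)"
proof -
  let ?H = "\<lambda>x v w. h (\<psi> p x) (chart_change A p (\<psi> p x) (\<psi> p x) v) (chart_change A p (\<psi> p x) (\<psi> p x) w)"
  have o: "open (\<phi> p ` V)" by (rule open_chart_map_image) fact+
  have "smooth_on (\<phi> p ` V) (\<lambda>x. ?H x (X x) (Y x))"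
  proof (rule smooth_on_bilinear_field[OF o, of ?H X Y])
    show "bilinear (?H x)" if "x \<in> \<phi> p ` V" for x
      using chart_scalar_product[of x p] that assms(2)
      by (auto simp: euclidean_scalar_product_def scalar_product_space_def)
    show "smooth_on (\<phi> p ` V) (\<lambda>x. ?H x v w)" for v w
      using smooth_metric[of p v w] assms(2) by (auto simp: smooth_in_chart_def o_def intro: smooth_on_subset)
  qed fact+
  then show ?thesis
    by (subst smooth_on_cong[OF o, of _ "\<lambda>x. ?H x (X x) (Y x)"]) (use assms(2) in \<open>auto simp: subset_iff\<close>)
qed

lemma smooth_fun_cometric [intro]:
  assumes "\<alpha> \<in> one_forms A" "\<beta> \<in> one_forms A"
  shows "smooth_fun A (\<lambda>q. g q (\<alpha> q) (\<beta> q))"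
proof (rule smooth_fun_localI)
  fix p
  obtain E V where V: "open V" "p \<in> V" "V \<subseteq> dm p" "\<And>i. i < DIM('e) \<Longrightarrow> smooth_on (\<phi> p ` V) (E i)"
    "\<And>q. q \<in> V \<Longrightarrow> orthonormal_upto DIM('e) (h q) (\<lambda>i. chart_change A p q q (E i (\<phi> p q)))"
    by (rule local_orthonormal_frame[of p]) (rule that; simp)
  let ?X = "\<lambda>i q. chart_change A p q q (E i (\<phi> p q))"
  have o: "open (\<phi> p ` V)" by (rule open_chart_map_image) fact+
  have "smooth_on (\<phi> p ` V) (\<lambda>x. \<Sum>i<DIM('e). ((\<lambda>q. h q (?X i q) (?X i q)) \<circ> \<psi> p) x *
      ((\<lambda>q. blinfun_apply (\<alpha> q) (?X i q)) \<circ> \<psi> p) x * ((\<lambda>q. blinfun_apply (\<beta> q) (?X i q)) \<circ> \<psi> p) x)"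
    by (intro smooth_on_sum smooth_on_mult smooth_on_components smooth_on_metric_components o V(1,3,4) assms) auto
  then have "smooth_on (\<phi> p ` V) ((\<lambda>q. g q (\<alpha> q) (\<beta> q)) \<circ> \<psi> p)"
    by (subst smooth_on_cong[OF o]) (use V(3) in \<open>auto simp: subset_iff cometric_frame[OF V(5)]\<close>)
  then show "\<exists>r U. open U \<and> p \<in> U \<and> U \<subseteq> dm r \<and> smooth_on (\<phi> r ` U) ((\<lambda>q. g q (\<alpha> q) (\<beta> q)) \<circ> \<psi> r)"
    using V by blast
qed

text \<open>Lower the indices of a local orthonormal frame and cut off. The resulting forms are
  global, and near \<open>p\<close> raising them returns the frame, so orthonormality carries
  over.\<close>

lemma local_orthonormal_coframe_exists: "\<exists>\<eta>. local_orthonormal_coframe A g p \<eta>"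
proof -
  obtain E V where V: "open V" "p \<in> V" "V \<subseteq> dm p" "\<And>i. i < DIM('e) \<Longrightarrow> smooth_on (\<phi> p ` V) (E i)"
    "\<And>q. q \<in> V \<Longrightarrow> orthonormal_upto DIM('e) (h q) (\<lambda>i. chart_change A p q q (E i (\<phi> p q)))"
    by (rule local_orthonormal_frame[of p]) (rule that; simp)
  let ?X = "\<lambda>i q. chart_change A p q q (E i (\<phi> p q))"
  obtain b K W where b: "smooth_fun A b" "closed K" "K \<subseteq> V \<inter> dm p" "\<And>q. q \<notin> K \<Longrightarrow> b q = 0"
    "open W" "p \<in> W" "W \<subseteq> V \<inter> dm p" "\<And>q. q \<in> W \<Longrightarrow> b q = 1"
    by (rule bump_exists[OF V(1,2)]) (rule that, assumption, assumption, assumption, simp, assumption, assumption, assumption, simp)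
  \<comment> \<open>The j-th component of the lowered frame vector, made global by the bump.\<close>
  define c where "c i j q = b q * h q (?X i q) (chart_change A p q q j)" for i j q
  have sm: "smooth_fun A (c i j)" if i: "i < DIM('e)" for i j
  proof (rule smooth_fun_localI)
    fix q
    show "\<exists>r U. open U \<and> q \<in> U \<and> U \<subseteq> dm r \<and> smooth_on (\<phi> r ` U) (c i j \<circ> \<psi> r)"
    proof (cases "q \<in> V")
      case True
      have o: "open (\<phi> p ` V)" by (rule open_chart_map_image) fact+
      have "smooth_on (\<phi> p ` V) (\<lambda>x. (b \<circ> \<psi> p) x * ((\<lambda>q. h q (?X i q) (chart_change A p q q ((\<lambda>_. j) (\<phi> p q)))) \<circ> \<psi> p) x)"
      proof (intro smooth_on_mult smooth_on_metric_components o V(1,3) V(4)[OF i] smooth_on_const)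
        show "smooth_on (\<phi> p ` V) (b \<circ> \<psi> p)"
          using b(1) V(3) by (auto simp: smooth_fun_def smooth_in_chart_def intro: smooth_on_subset)
      qed
      then show ?thesis using True V by (intro exI[of _ p] exI[of _ V]) (auto simp: c_def o_def)
    next
      case False
      let ?U = "dm q \<inter> - K"
      have o: "open (\<phi> q ` ?U)" by (rule open_chart_map_image) (use b(2) in auto)
      have "smooth_on (\<phi> q ` ?U) (c i j \<circ> \<psi> q)"
        by (subst smooth_on_cong[OF o, of _ "\<lambda>_. 0"]) (use b(4) in \<open>auto simp: c_def\<close>)
      then show ?thesis using False b by (intro exI[of _ q] exI[of _ ?U]) auto
    qed
  qed
  have "\<exists>V. open V \<and> p \<in> V \<and> (\<forall>q\<in>V. \<forall>v. blinfun_apply (differential A (coord p b) q) (chart_change A p q q v) = v \<bullet> b)"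
    for b
    using linear_near_differential[OF linear_near_coord[of p b]] by (metis blinfun_inner_left.rep_eq inner_commute)
  then obtain C where C: "\<And>b. open (C b)" "\<And>b. p \<in> C b"
    "\<And>b q v. q \<in> C b \<Longrightarrow> blinfun_apply (differential A (coord p b) q) (chart_change A p q q v) = v \<bullet> b"
    by metis
  define \<eta> where "\<eta> i q = (\<Sum>j\<in>Basis. c i j q *\<^sub>R differential A (coord p j) q)" for i q
  \<comment> \<open>Here the bump is 1 and the functions \<open>coord p j\<close> have the
    coordinate differentials, so \<open>\<eta> i\<close> is exactly the lowered frame
    vector.\<close>
  define U where "U = W \<inter> (\<Inter>b\<in>Basis. C b)"
  have U: "open U" "p \<in> U" unfolding U_def using b C by (auto intro!: open_Int open_INT)
  have raise: "raise h q (\<eta> i q) = ?X i q" if q: "q \<in> U" for q i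
  proof (rule raise_unique)
    fix Y
    define v where "v = chart_change A q p q Y"
    have qd: "q \<in> dm p" "q \<in> W" using q b by (auto simp: U_def)
    have Y: "Y = chart_change A p q q v" using qd by (simp add: v_def chart_change_inverse)
    interpret l: linear "chart_change A p q q" by (rule linear_chart_change) (use qd in auto)
    have "chart_change A p q q v = chart_change A p q q (\<Sum>j\<in>Basis. (v \<bullet> j) *\<^sub>R j)"
      by (simp add: euclidean_representation)
    also have "\<dots> = (\<Sum>j\<in>Basis. (v \<bullet> j) *\<^sub>R chart_change A p q q j)" by (simp only: l.sum l.scale)
    finally have "h q (?X i q) Y = (\<Sum>j\<in>Basis. (v \<bullet> j) * h q (?X i q) (chart_change A p q q j))"
      unfolding Y by (simp add: h.sum_right h.simps)
    also have "\<dots> = blinfun_apply (\<eta> i q) Y"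
      unfolding \<eta>_def Y using q qd b(8)
      by (simp add: blinfun.sum_left blinfun.scaleR_left C(3) U_def c_def mult.commute)
    finally show "h q (?X i q) Y = blinfun_apply (\<eta> i q) Y" .
  qed
  have "orthonormal_upto DIM('e) (g q) (\<lambda>i. \<eta> i q)" if "q \<in> U" for q
    using V(5)[of q] that b(7) by (auto simp: orthonormal_raise raise U_def)
  moreover have "\<eta> i \<in> one_forms A" if "i < DIM('e)" for i
    unfolding \<eta>_def by (intro one_forms_sum one_forms_scale sm that one_forms_differential smooth_fun_coord)
  ultimately show ?thesis using U unfolding local_orthonormal_coframe_def orthonormal_upto_iff by blast
qed

end

section \<open>Ricci curvature as a pointwise tensor\<close>

locale einstein_setting = pseudo_riemannian_mfd A h + contravariant_lc A P "cometric_of h" D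
  for A :: "('m::t2_space, 'e::euclidean_space) atlas" and h P D
begin

text \<open>Traces over orthonormal covectors at \<open>p\<close> only. No coframe on a
  neighbourhood is needed, since the curvature is already pointwise.\<close>

definition ricci_tensor :: "'m \<Rightarrow> 'e covector \<Rightarrow> 'e covector \<Rightarrow> real" where
  "ricci_tensor p a b = (let e = (SOME e. orthonormal_upto DIM('e) (g p) e) in
     \<Sum>i<DIM('e). g p (e i) (e i) * g p (curvature_tensor p a (e i) (e i)) b)"

lemma ricci_tensor_eq:
  assumes e: "orthonormal_upto DIM('e) (g p) e"
  shows "ricci_tensor p a b = (\<Sum>i<DIM('e). g p (e i) (e i) * g p (curvature_tensor p a (e i) (e i)) b)"
proof -
  define e' where "e' = (SOME e. orthonormal_upto DIM('e) (g p) e)"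
  have e': "orthonormal_upto DIM('e) (g p) e'" unfolding e'_def by (rule someI[of "orthonormal_upto DIM('e) (g p)", OF e])
  have "bilinear (\<lambda>x y. g p (curvature_tensor p a x y) b)"
    unfolding bilinear_def by (auto intro!: linearI simp: curvature_tensor_add curvature_tensor_scale g.simps)
  from g.trace_eq[OF this e' e covector_orthonormal_expansion[OF e'] covector_orthonormal_expansion[OF e]]
  show ?thesis by (simp add: ricci_tensor_def Let_def e'_def)
qed

lemma ricci_eq_tensor:
  assumes "\<alpha> \<in> one_forms A" "\<beta> \<in> one_forms A"
  shows "ricci A P g D \<alpha> \<beta> p = ricci_tensor p (\<alpha> p) (\<beta> p)"
proof -
  define \<eta> where "\<eta> = (SOME \<eta>. local_orthonormal_coframe A g p \<eta>)"
  have \<eta>: "local_orthonormal_coframe A g p \<eta>"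
    unfolding \<eta>_def by (rule someI_ex[OF local_orthonormal_coframe_exists])
  then have "orthonormal_upto DIM('e) (g p) (\<lambda>i. \<eta> i p)"
    unfolding local_orthonormal_coframe_def orthonormal_upto_iff by blast
  note r = ricci_tensor_eq[OF this, of "\<alpha> p" "\<beta> p"]
  show ?thesis
    unfolding ricci_def r \<eta>_def[symmetric] Let_def using \<eta> assms
    by (intro sum.cong) (auto simp: local_orthonormal_coframe_def curvature_eq_tensor)
qed

text \<open>Every covector is the value of a global form, so nothing is lost in passing to
  covectors. The comparison of the blocks becomes linear algebra at single points.\<close>

lemma einstein_iff: "einstein A P g D \<kappa> \<longleftrightarrow> (\<forall>p a b. ricci_tensor p a b = \<kappa> * g p a b)"
proof
  assume E: "einstein A P g D \<kappa>"
  show "\<forall>p a b. ricci_tensor p a b = \<kappa> * g p a b"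
  proof (intro allI)
    fix p a b
    obtain \<alpha> \<beta> where "\<alpha> \<in> one_forms A" "\<alpha> p = a" "\<beta> \<in> one_forms A" "\<beta> p = b"
      using one_form_through by metis
    then show "ricci_tensor p a b = \<kappa> * g p a b"
      using E ricci_eq_tensor unfolding einstein_def by metis
  qed
qed (simp add: einstein_def ricci_eq_tensor)

end

section \<open>Pulling back along a projection\<close>

definition pullback :: "('v::euclidean_space \<Rightarrow> 'w::euclidean_space) \<Rightarrow> 'w covector \<Rightarrow> 'v covector" where
  "pullback l a = Blinfun (\<lambda>v. blinfun_apply a (l v))"

lemma blinfun_apply_pullback:
  assumes "bounded_linear l"
  shows "blinfun_apply (pullback l a) v = blinfun_apply a (l v)"
  unfolding pullback_def
  using bounded_linear_compose[OF blinfun.bounded_linear_right[of a] assms]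
  by (simp add: bounded_linear_Blinfun_apply)

text \<open>In product charts a projection reads as one fixed linear map \<open>l\<close>, which is
  then also its derivative at every point. Both projections are treated at once, with
  \<open>fst\<close> or \<open>snd\<close> for \<open>l\<close>.\<close>

locale chart_projection = M: smooth_mfd A + N: smooth_mfd A'
  for A :: "('m::t2_space, 'e::euclidean_space) atlas"
    and A' :: "('n::t2_space, 'k::euclidean_space) atlas" +
  fixes proj :: "'m \<Rightarrow> 'n" and l :: "'e \<Rightarrow> 'k"
  assumes bounded_linear_l: "bounded_linear l"
    and proj_dom: "q \<in> chart_dom A p \<Longrightarrow> proj q \<in> chart_dom A' (proj p)"
    and proj_map: "q \<in> chart_dom A p \<Longrightarrow> chart_map A' (proj p) (proj q) = l (chart_map A p q)"
begin

abbreviation pull_form :: "('n, 'k) form \<Rightarrow> ('m, 'e) form" where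
  "pull_form \<alpha> \<equiv> \<lambda>p. pullback l (\<alpha> (proj p))"

lemmas pullback_apply = blinfun_apply_pullback[OF bounded_linear_l]

lemma pullback_add: "pullback l (a + b) = pullback l a + pullback l b"
  and pullback_diff: "pullback l (a - b) = pullback l a - pullback l b"
  and pullback_scale: "pullback l (c *\<^sub>R a) = c *\<^sub>R pullback l a"
  by (auto intro!: blinfun_eqI simp: pullback_apply blinfun.bilinear_simps)

lemma proj_chart_inv:
  assumes "x \<in> M.\<phi> p ` M.dm p"
  shows "l x \<in> N.\<phi> (proj p) ` N.dm (proj p)" "proj (M.\<psi> p x) = N.\<psi> (proj p) (l x)"
proof -
  obtain q where q: "q \<in> M.dm p" "x = M.\<phi> p q" using assms by blast
  show "l x \<in> N.\<phi> (proj p) ` N.dm (proj p)"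
    using proj_dom[OF q(1)] proj_map[OF q(1)] q(2) by (metis imageI)
  show "proj (M.\<psi> p x) = N.\<psi> (proj p) (l x)"
    using proj_dom[OF q(1)] proj_map[OF q(1), symmetric] q by simp
qed

lemma smooth_in_chart_pull:
  assumes "smooth_in_chart A' (proj p) u"
  shows "smooth_in_chart A p (\<lambda>q. u (proj q))"
proof -
  have "smooth_on (M.\<phi> p ` M.dm p) ((u \<circ> N.\<psi> (proj p)) \<circ> l)"
    by (rule smooth_on_compose[OF M.open_chart_image N.open_chart_image _ smooth_on_bounded_linear[OF bounded_linear_l]])
       (use assms proj_chart_inv(1) in \<open>auto simp: smooth_in_chart_def simp del: image_iff\<close>)
  then show ?thesis
    unfolding smooth_in_chart_def
    by (subst smooth_on_cong[OF M.open_chart_image, of _ _ "(u \<circ> N.\<psi> (proj p)) \<circ> l"])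
       (auto simp: proj_map[symmetric] proj_dom)
qed

lemma smooth_fun_pull: "smooth_fun A' u \<Longrightarrow> smooth_fun A (\<lambda>q. u (proj q))"
  by (simp add: smooth_fun_def smooth_in_chart_pull)

lemma differential_pull:
  assumes "smooth_fun A' u"
  shows "differential A (\<lambda>q. u (proj q)) p = pullback l (differential A' u (proj p))"
proof (rule M.differential_eqI[OF smooth_fun_pull[OF assms]])
  have "((u \<circ> N.\<psi> (proj p)) \<circ> l has_derivative blinfun_apply (differential A' u (proj p)) \<circ> l) (at (M.\<phi> p p))"
    by (rule diff_chain_at[OF bounded_linear_imp_has_derivative[OF bounded_linear_l]])
       (use N.has_derivative_differential[OF assms, of "proj p"] proj_map[of p p] in simp)
  then have "((\<lambda>q. u (proj q)) \<circ> M.\<psi> p has_derivative blinfun_apply (differential A' u (proj p)) \<circ> l) (at (M.\<phi> p p))"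
    by (rule has_derivative_transform_within_open[OF _ M.open_chart_image[of p]])
       (auto simp: proj_map[symmetric] proj_dom)
  then show "((\<lambda>q. u (proj q)) \<circ> M.\<psi> p has_derivative blinfun_apply (pullback l (differential A' u (proj p)))) (at (M.\<phi> p p))"
    by (simp add: pullback_apply[abs_def] o_def)
qed

text \<open>The transition maps above and below are intertwined by \<open>l\<close>; differentiate
  that identity.\<close>

lemma chart_change_proj:
  assumes "q \<in> M.dm p" "q \<in> M.dm r"
  shows "l (chart_change A p r q v) = chart_change A' (proj p) (proj r) (proj q) (l v)"
proof -
  have 1: "(l \<circ> (M.\<phi> r \<circ> M.\<psi> p) has_derivative l \<circ> chart_change A p r q) (at (M.\<phi> p q))"
    by (rule diff_chain_at[OF M.has_derivative_chart_change[OF assms] bounded_linear_imp_has_derivative[OF bounded_linear_l]])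
  have "((N.\<phi> (proj r) \<circ> N.\<psi> (proj p)) \<circ> l has_derivative chart_change A' (proj p) (proj r) (proj q) \<circ> l) (at (M.\<phi> p q))"
    by (rule diff_chain_at[OF bounded_linear_imp_has_derivative[OF bounded_linear_l]])
       (use N.has_derivative_chart_change[OF proj_dom[OF assms(1)] proj_dom[OF assms(2)]] proj_map[OF assms(1)] in simp)
  then have 2: "(l \<circ> (M.\<phi> r \<circ> M.\<psi> p) has_derivative chart_change A' (proj p) (proj r) (proj q) \<circ> l) (at (M.\<phi> p q))"
    by (rule has_derivative_transform_within_open[OF _ M.open_chart_nbhd(1,2)[OF M.open_chart_dom[of r] assms(2,1)]])
       (use assms(1) in \<open>auto simp: proj_map[symmetric] proj_dom\<close>)
  show ?thesis using has_derivative_unique[OF 1 2] by (metis comp_apply)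
qed

lemma one_forms_pull: "\<alpha> \<in> one_forms A' \<Longrightarrow> pull_form \<alpha> \<in> one_forms A"
  unfolding one_forms_def
proof (intro CollectI allI)
  fix p v assume "\<alpha> \<in> {\<alpha>. \<forall>p v. smooth_in_chart A' p (\<lambda>q. blinfun_apply (\<alpha> q) (chart_change A' p q q v))}"
  then have "smooth_in_chart A p (\<lambda>q. blinfun_apply (\<alpha> (proj q)) (chart_change A' (proj p) (proj q) (proj q) (l v)))"
    by (intro smooth_in_chart_pull[of _ "\<lambda>q. blinfun_apply (\<alpha> q) (chart_change A' (proj _) q q (l v))"]) blast
  then show "smooth_in_chart A p (\<lambda>q. blinfun_apply (pullback l (\<alpha> (proj q))) (chart_change A p q q v))"
    by (subst M.smooth_in_chart_cong) (auto simp: pullback_apply chart_change_proj)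
qed

text \<open>Makes [du,dv] = d{u,v} available for pulled back coordinates.\<close>

lemma linear_near_pull:
  assumes "N.linear_near (proj p) u a"
  shows "M.linear_near p (\<lambda>q. u (proj q)) (pullback l a)"
proof -
  obtain V where V: "open V" "proj p \<in> V" "\<And>q. q \<in> V \<Longrightarrow> u q = blinfun_apply a (N.\<phi> (proj p) q)"
    and u: "smooth_fun A' u"
    using assms unfolding N.linear_near_def by blast
  let ?W = "N.\<phi> (proj p) ` (V \<inter> N.dm (proj p))"
  have W: "open ?W" by (rule N.open_chart_map_image) (use V in auto)
  \<comment> \<open>The neighbourhood is described in coordinates because continuity of
    \<open>proj\<close> is available only through the charts; injectivity of the lower chart then
    puts \<open>proj q\<close> into \<open>V\<close>.\<close>
  define U where "U = M.dm p \<inter> (l \<circ> M.\<phi> p) -` ?W"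
  have "continuous_on (M.dm p) (M.\<phi> p)" using M.chart_homeomorphism[of p] by (auto simp: homeomorphism_def)
  then have c: "continuous_on (M.dm p) (l \<circ> M.\<phi> p)"
    by (rule continuous_on_compose) (rule linear_continuous_on[OF bounded_linear_l])
  have "open U" unfolding U_def by (rule continuous_open_preimage[OF c M.open_chart_dom W])
  moreover have "p \<in> U" using V(2) proj_map[of p p] by (auto simp: U_def intro!: image_eqI[of _ _ "proj p"])
  moreover have "u (proj q) = blinfun_apply (pullback l a) (M.\<phi> p q)" if qU: "q \<in> U" for q
  proof -
    have q: "q \<in> M.dm p" using qU by (simp add: U_def)
    obtain r where r: "r \<in> V" "r \<in> N.dm (proj p)" "l (M.\<phi> p q) = N.\<phi> (proj p) r"
      using qU by (auto simp: U_def)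
    then have "proj q = r" using proj_map[OF q] proj_dom[OF q] N.chart_inv_map by metis
    then show ?thesis using V(3)[OF r(1)] r(3) by (simp add: pullback_apply)
  qed
  ultimately show ?thesis
    unfolding M.linear_near_def using smooth_fun_pull[OF u] by (intro conjI exI[of _ U]) (auto simp: U_def)
qed

end

section \<open>Projections that preserve the Poisson structure\<close>

locale poisson_projection = chart_projection A A' proj l + M: contravariant_lc A P g D + N: contravariant_lc A' P' g' D'
  for A :: "('m::t2_space, 'e::euclidean_space) atlas" and P g D
    and A' :: "('n::t2_space, 'k::euclidean_space) atlas" and P' g' D' and proj l +
  assumes P_pullback: "P p (pullback l a) (pullback l b) = P' (proj p) a b"
begin

lemma anchor_deriv_pull:
  assumes "smooth_fun A' u"
  shows "anchor_deriv A P (pull_form \<alpha>) (\<lambda>q. u (proj q)) p = anchor_deriv A' P' \<alpha> u (proj p)"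
  by (simp add: M.anchor_deriv_eq N.anchor_deriv_eq differential_pull[OF assms] P_pullback)

text \<open>Both brackets obey the same Leibniz rule, with anchors matched by
  \<open>anchor_deriv_pull\<close>, so their difference is tensorial. On coordinate differentials
  both are the differential of the same Poisson bracket.\<close>

lemma koszul_bracket_pull:
  assumes \<alpha>: "\<alpha> \<in> one_forms A'" and \<beta>: "\<beta> \<in> one_forms A'"
  shows "koszul_bracket A P (pull_form \<alpha>) (pull_form \<beta>) p = pullback l (koszul_bracket A' P' \<alpha> \<beta> (proj p))"
proof -
  define F where "F \<alpha> \<beta> = koszul_bracket A P (pull_form \<alpha>) (pull_form \<beta>) p - pullback l (koszul_bracket A' P' \<alpha> \<beta> (proj p))" for \<alpha> \<beta>
  have anti: "F \<alpha> \<beta> = - F \<beta> \<alpha>" if "\<alpha> \<in> one_forms A'" "\<beta> \<in> one_forms A'" for \<alpha> \<beta>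
    using M.kb_antisym[OF one_forms_pull[OF that(1)] one_forms_pull[OF that(2)], of p] N.kb_antisym[OF that, of "proj p"]
      pullback_scale[of "-1"] by (simp add: F_def)
  have tens: "N.tensorial_at (proj p) (\<lambda>\<alpha>. F \<alpha> \<beta>)" if \<beta>: "\<beta> \<in> one_forms A'" for \<beta>
    unfolding N.tensorial_at_def
  proof (intro conjI ballI allI impI)
    fix \<alpha> \<gamma> assume "\<alpha> \<in> one_forms A'" "\<gamma> \<in> one_forms A'"
    then show "F (\<lambda>q. \<alpha> q + \<gamma> q) \<beta> = F \<alpha> \<beta> + F \<gamma> \<beta>"
      using \<beta> by (simp add: F_def pullback_add M.kb_add_left N.kb_add_left one_forms_pull)
  next
    fix u \<alpha> assume "\<alpha> \<in> one_forms A'" "smooth_fun A' u"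
    then show "F (\<lambda>q. u q *\<^sub>R \<alpha> q) \<beta> = u (proj p) *\<^sub>R F \<alpha> \<beta>"
      using \<beta> M.kb_scale_left[OF smooth_fun_pull one_forms_pull one_forms_pull, of u \<alpha> \<beta>]
      by (simp add: F_def pullback_diff pullback_scale N.kb_scale_left anchor_deriv_pull algebra_simps)
  qed
  have exact: "F (differential A' (N.coord (proj p) b)) (differential A' (N.coord (proj p) c)) = 0" for b c
  proof -
    let ?x = "N.coord (proj p) b" and ?y = "N.coord (proj p) c"
    have d: "pull_form (differential A' (N.coord (proj p) b)) = differential A (\<lambda>q. N.coord (proj p) b (proj q))" for b
      by (simp add: differential_pull fun_eq_iff)
    have "koszul_bracket A P (pull_form (differential A' ?x)) (pull_form (differential A' ?y)) p =
        differential A (poisson_bracket A P (\<lambda>q. ?x (proj q)) (\<lambda>q. ?y (proj q))) p"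
      unfolding d by (rule M.koszul_bracket_linear_near[OF linear_near_pull[OF N.linear_near_coord] linear_near_pull[OF N.linear_near_coord]])
    also have "poisson_bracket A P (\<lambda>q. ?x (proj q)) (\<lambda>q. ?y (proj q)) = (\<lambda>q. poisson_bracket A' P' ?x ?y (proj q))"
      by (simp add: poisson_bracket_def differential_pull P_pullback fun_eq_iff)
    also have "differential A \<dots> p = pullback l (differential A' (poisson_bracket A' P' ?x ?y) (proj p))"
      by (rule differential_pull) (auto simp: poisson_bracket_def[abs_def])
    also have "differential A' (poisson_bracket A' P' ?x ?y) (proj p) =
        koszul_bracket A' P' (differential A' ?x) (differential A' ?y) (proj p)"
      by (rule N.koszul_bracket_linear_near[OF N.linear_near_coord N.linear_near_coord, symmetric])
    finally show ?thesis by (simp add: F_def)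
  qed
  have "F \<alpha> (differential A' (N.coord (proj p) c)) = 0" for c
    by (subst N.tensorial_at_expansion[OF tens \<alpha>]) (auto simp: exact)
  then have "F \<beta> \<alpha> = 0"
    by (subst N.tensorial_at_expansion[OF tens[OF \<alpha>] \<beta>]) (simp add: anti[OF _ \<alpha>] N.one_forms_differential)
  then show ?thesis using anti[OF \<alpha> \<beta>] by (simp add: F_def)
qed

end

context einstein_setting
begin

text \<open>Recovers \<open>D\<close> from the cometric, the anchor and the bracket. All three are
  known on pullbacks, which identifies the connection of the product there.\<close>

lemma koszul_formula:
  assumes "\<alpha> \<in> one_forms A" "\<beta> \<in> one_forms A" "\<gamma> \<in> one_forms A"
  shows "2 * g p (D \<alpha> \<beta> p) (\<gamma> p) =
    anch \<alpha> (\<lambda>q. g q (\<beta> q) (\<gamma> q)) p + anch \<beta> (\<lambda>q. g q (\<alpha> q) (\<gamma> q)) p - anch \<gamma> (\<lambda>q. g q (\<alpha> q) (\<beta> q)) p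
    + g p (kb \<alpha> \<beta> p) (\<gamma> p) - g p (kb \<alpha> \<gamma> p) (\<beta> p) - g p (kb \<beta> \<gamma> p) (\<alpha> p)"
  using assms
  by (simp add: metric_compat koszul_bracket_eq g.simps g.sym[of p "\<beta> p"] g.sym[of p "\<alpha> p"])

lemma D_zero: "\<alpha> \<in> one_forms A \<Longrightarrow> D (\<lambda>p. 0) \<alpha> = (\<lambda>p. 0)" "\<alpha> \<in> one_forms A \<Longrightarrow> D \<alpha> (\<lambda>p. 0) = (\<lambda>p. 0)"
  using D_scale_left[OF smooth_fun_const[of 0] one_forms_zero] D_scale_right[OF smooth_fun_const[of 0] _ one_forms_zero]
  by auto

lemma orthonormal_coframe_exists: "\<exists>e. orthonormal_upto DIM('e) (g p) e"
proof -
  obtain \<eta> where "local_orthonormal_coframe A g p \<eta>" using local_orthonormal_coframe_exists by blast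
  then have "orthonormal_upto DIM('e) (g p) (\<lambda>i. \<eta> i p)"
    unfolding local_orthonormal_coframe_def orthonormal_upto_iff by blast
  then show ?thesis by blast
qed

lemma curvature_tensor_zero [simp]:
  "curvature_tensor p 0 b c = 0" "curvature_tensor p a 0 c = 0" "curvature_tensor p a b 0 = 0"
  by (simp_all add: curvature_tensor_def)

lemma ricci_tensor_zero [simp]: "ricci_tensor p 0 b = 0" "ricci_tensor p a 0 = 0"
  by (simp_all add: ricci_tensor_def g.simps)

end

section \<open>Warped products\<close>

lemma restrict_fst_apply: "blinfun_apply (restrict_fst a) v = blinfun_apply a (v, 0)"
  unfolding restrict_fst_def
  using bounded_linear_compose[OF blinfun.bounded_linear_right[of a] bounded_linear_Pair[OF bounded_linear_ident bounded_linear_zero]]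
  by (simp add: bounded_linear_Blinfun_apply)

lemma restrict_snd_apply: "blinfun_apply (restrict_snd a) w = blinfun_apply a (0, w)"
  unfolding restrict_snd_def
  using bounded_linear_compose[OF blinfun.bounded_linear_right[of a] bounded_linear_Pair[OF bounded_linear_zero bounded_linear_ident]]
  by (simp add: bounded_linear_Blinfun_apply)

lemmas pullback_fst_apply = blinfun_apply_pullback[OF bounded_linear_fst]
  and pullback_snd_apply = blinfun_apply_pullback[OF bounded_linear_snd]

lemma restrict_pullback [simp]:
  "restrict_fst (pullback fst a) = a" "restrict_snd (pullback snd b) = b"
  "restrict_fst (pullback snd b) = 0" "restrict_snd (pullback fst a) = 0"
  by (auto intro!: blinfun_eqI simp: restrict_fst_apply restrict_snd_apply pullback_fst_apply pullback_snd_apply)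

lemma restrict_linear [simp]:
  "restrict_fst (a + b) = restrict_fst a + restrict_fst b" "restrict_snd (a + b) = restrict_snd a + restrict_snd b"
  "restrict_fst (c *\<^sub>R a) = c *\<^sub>R restrict_fst a" "restrict_snd (c *\<^sub>R a) = c *\<^sub>R restrict_snd a"
  "restrict_fst 0 = 0" "restrict_snd 0 = 0"
  by (auto intro!: blinfun_eqI simp: restrict_fst_apply restrict_snd_apply blinfun.bilinear_simps)

lemma covector_prod_split: "a = pullback fst (restrict_fst a) + pullback snd (restrict_snd a)"
  by (rule blinfun_eqI)
     (simp add: pullback_fst_apply pullback_snd_apply restrict_fst_apply restrict_snd_apply
       blinfun.add_left blinfun.add_right[symmetric])

lemma sum_lessThan_add: "(\<Sum>i<m + n. u i) = (\<Sum>i<m. u i) + (\<Sum>j<n. u (m + j))"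
  for u :: "nat \<Rightarrow> 'a::comm_monoid_add"
  by (induction n) (simp_all add: add.assoc)

lemma chart_dom_prod: "chart_dom (prod_atlas A B) p = chart_dom A (fst p) \<times> chart_dom B (snd p)"
  by (simp add: chart_dom_def prod_atlas_def split: prod.split)

lemma chart_map_prod: "chart_map (prod_atlas A B) p q = (chart_map A (fst p) (fst q), chart_map B (snd p) (snd q))"
  by (simp add: chart_map_def prod_atlas_def split: prod.split)

locale warped_product =
  B: einstein_setting AB hB PB DB + F: einstein_setting AF hF PF DF +
  M: einstein_setting "prod_atlas AB AF" "warped_metric f hB hF" "prod_bivector PB PF" D
  for AB :: "('b::t2_space, 'e::euclidean_space) atlas" and hB PB DB
    and AF :: "('f::t2_space, 'k::euclidean_space) atlas" and hF PF DF
    and f :: "'b \<Rightarrow> real" and D +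
  assumes smooth_f: "smooth_fun AB f" and f_pos: "f x > 0" and casimir_f: "casimir AB PB f"
begin

sublocale H: poisson_projection "prod_atlas AB AF" "prod_bivector PB PF" M.g D AB PB B.g DB fst fst
proof
  fix p :: "'b \<times> 'f" and a b
  show "prod_bivector PB PF p (pullback fst a) (pullback fst b) = PB (fst p) a b"
    by (cases p) (simp add: prod_bivector_def F.P_simps)
qed (auto intro!: exI[of _ 1] norm_fst_le simp: chart_dom_prod chart_map_prod)

sublocale V: poisson_projection "prod_atlas AB AF" "prod_bivector PB PF" M.g D AF PF F.g DF snd snd
proof
  fix p :: "'b \<times> 'f" and a b
  show "prod_bivector PB PF p (pullback snd a) (pullback snd b) = PF (snd p) a b"
    by (cases p) (simp add: prod_bivector_def B.P_simps)
qed (auto intro!: exI[of _ 1] norm_snd_le simp: chart_dom_prod chart_map_prod)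

section \<open>Anchors and brackets of horizontal and vertical forms\<close>

lemma P_mixed: "prod_bivector PB PF p (pullback fst a) (pullback snd b) = 0"
  "prod_bivector PB PF p (pullback snd b) (pullback fst a) = 0"
  by (cases p; simp add: prod_bivector_def B.P_simps F.P_simps)+

lemma anchor_mixed:
  "smooth_fun AF w \<Longrightarrow> M.anch (H.pull_form \<alpha>) (\<lambda>q. w (snd q)) p = 0"
  "smooth_fun AB u \<Longrightarrow> M.anch (V.pull_form \<beta>) (\<lambda>q. u (fst q)) p = 0"
  by (simp_all add: M.anchor_deriv_eq H.differential_pull V.differential_pull P_mixed)

lemma anchor_zero: "M.anch \<gamma> (\<lambda>q. 0) p = 0"
  by (simp add: M.anchor_deriv_eq M.P_simps)

text \<open>The anchor of a form from one factor kills functions of the other factor, so the Leibniz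
  terms vanish and the bracket is tensorial in both arguments. For coordinates of different factors
  the Poisson bracket is zero.\<close>

lemma koszul_bracket_mixed:
  assumes \<alpha>: "\<alpha> \<in> one_forms AB" and \<beta>: "\<beta> \<in> one_forms AF"
  shows "M.kb (H.pull_form \<alpha>) (V.pull_form \<beta>) p = 0"
proof -
  define K where "K \<alpha> \<beta> = M.kb (H.pull_form \<alpha>) (V.pull_form \<beta>) p" for \<alpha> \<beta>
  have tens1: "B.tensorial_at (fst p) (\<lambda>\<alpha>. K \<alpha> \<beta>)" if \<beta>: "\<beta> \<in> one_forms AF" for \<beta>
    unfolding B.tensorial_at_def
  proof (intro conjI ballI allI impI)
    fix \<alpha> \<gamma> assume "\<alpha> \<in> one_forms AB" "\<gamma> \<in> one_forms AB"
    then show "K (\<lambda>q. \<alpha> q + \<gamma> q) \<beta> = K \<alpha> \<beta> + K \<gamma> \<beta>"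
      using \<beta> by (simp add: K_def H.pullback_add M.kb_add_left H.one_forms_pull V.one_forms_pull)
  next
    fix u \<alpha> assume "\<alpha> \<in> one_forms AB" "smooth_fun AB u"
    then show "K (\<lambda>q. u q *\<^sub>R \<alpha> q) \<beta> = u (fst p) *\<^sub>R K \<alpha> \<beta>"
      using \<beta> M.kb_scale_left[OF H.smooth_fun_pull H.one_forms_pull V.one_forms_pull, of u \<alpha> \<beta>]
      by (simp add: K_def H.pullback_scale anchor_mixed)
  qed
  have swap: "K \<alpha> \<beta> = - M.kb (V.pull_form \<beta>) (H.pull_form \<alpha>) p" if "\<alpha> \<in> one_forms AB" "\<beta> \<in> one_forms AF" for \<alpha> \<beta>
    unfolding K_def by (rule M.kb_antisym) (use that H.one_forms_pull V.one_forms_pull in auto)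
  have tens2: "F.tensorial_at (snd p) (\<lambda>\<beta>. K \<alpha> \<beta>)" if \<alpha>: "\<alpha> \<in> one_forms AB" for \<alpha>
    unfolding F.tensorial_at_def
  proof (intro conjI ballI allI impI)
    fix \<beta> \<gamma> assume "\<beta> \<in> one_forms AF" "\<gamma> \<in> one_forms AF"
    then show "K \<alpha> (\<lambda>q. \<beta> q + \<gamma> q) = K \<alpha> \<beta> + K \<alpha> \<gamma>"
      using \<alpha> by (simp add: swap V.pullback_add M.kb_add_left H.one_forms_pull V.one_forms_pull F.one_forms_add)
  next
    fix u \<beta> assume "\<beta> \<in> one_forms AF" "smooth_fun AF u"
    then show "K \<alpha> (\<lambda>q. u q *\<^sub>R \<beta> q) = u (snd p) *\<^sub>R K \<alpha> \<beta>"
      using \<alpha> M.kb_scale_left[OF V.smooth_fun_pull V.one_forms_pull H.one_forms_pull, of u \<beta> \<alpha>]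
      by (simp add: swap V.pullback_scale anchor_mixed F.one_forms_scale)
  qed
  have exact: "K (differential AB (B.coord (fst p) b)) (differential AF (F.coord (snd p) c)) = 0" for b c
  proof -
    let ?x = "\<lambda>q. B.coord (fst p) b (fst q)" and ?y = "\<lambda>q. F.coord (snd p) c (snd q)"
    have "H.pull_form (differential AB (B.coord (fst p) b)) = differential (prod_atlas AB AF) ?x"
      "V.pull_form (differential AF (F.coord (snd p) c)) = differential (prod_atlas AB AF) ?y"
      by (simp_all add: H.differential_pull V.differential_pull fun_eq_iff)
    then have "K (differential AB (B.coord (fst p) b)) (differential AF (F.coord (snd p) c)) =
        differential (prod_atlas AB AF) (poisson_bracket (prod_atlas AB AF) (prod_bivector PB PF) ?x ?y) p"
      unfolding K_def
      using M.koszul_bracket_linear_near[OF H.linear_near_pull[OF B.linear_near_coord] V.linear_near_pull[OF F.linear_near_coord]]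
      by simp
    also have "poisson_bracket (prod_atlas AB AF) (prod_bivector PB PF) ?x ?y = (\<lambda>q. 0)"
      by (simp add: poisson_bracket_def H.differential_pull V.differential_pull P_mixed fun_eq_iff)
    finally show ?thesis by simp
  qed
  have "K \<alpha> (differential AF (F.coord (snd p) c)) = 0" for c
    by (subst B.tensorial_at_expansion[OF tens1 \<alpha>]) (auto simp: exact)
  then have "K \<alpha> \<beta> = 0"
    by (subst F.tensorial_at_expansion[OF tens2[OF \<alpha>] \<beta>]) simp
  then show ?thesis by (simp add: K_def)
qed

lemma koszul_bracket_mixed':
  assumes "\<alpha> \<in> one_forms AB" "\<beta> \<in> one_forms AF"
  shows "M.kb (V.pull_form \<beta>) (H.pull_form \<alpha>) p = 0"
  using M.kb_antisym[OF V.one_forms_pull[OF assms(2)] H.one_forms_pull[OF assms(1)], of p] koszul_bracket_mixed[OF assms]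
  by simp

section \<open>The warped cometric and its derivatives\<close>

lemma raise_warped:
  "raise (warped_metric f hB hF) p a =
    (raise hB (fst p) (restrict_fst a), inverse ((f (fst p))\<^sup>2) *\<^sub>R raise hF (snd p) (restrict_snd a))"
proof (rule M.raise_unique)
  fix Y
  have "f (fst p) \<noteq> 0" using f_pos[of "fst p"] by simp
  moreover have "blinfun_apply a (fst Y, 0) + blinfun_apply a (0, snd Y) = blinfun_apply a Y"
    by (simp add: blinfun.add_right[symmetric])
  ultimately show "warped_metric f hB hF p (raise hB (fst p) (restrict_fst a),
      inverse ((f (fst p))\<^sup>2) *\<^sub>R raise hF (snd p) (restrict_snd a)) Y = blinfun_apply a Y"
    by (cases p; cases Y)
       (simp add: warped_metric_def F.h.simps B.metric_raise F.metric_raise restrict_fst_apply restrict_snd_apply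
         mult.assoc[symmetric])
qed

lemma warped_cometric:
  "M.g p a b = B.g (fst p) (restrict_fst a) (restrict_fst b)
    + F.g (snd p) (restrict_snd a) (restrict_snd b) / (f (fst p))\<^sup>2"
proof -
  have "blinfun_apply a (X, c *\<^sub>R Y) = blinfun_apply a (X, 0) + c * blinfun_apply a (0, Y)" for X Y c
    by (simp add: blinfun.add_right[symmetric] blinfun.scaleR_right[symmetric] flip: real_scaleR_def)
  then show ?thesis
    by (simp add: M.cometric_eq B.cometric_eq F.cometric_eq raise_warped restrict_fst_apply restrict_snd_apply divide_inverse)
qed

lemma f_nonzero [simp]: "f x \<noteq> 0"
  using f_pos[of x] by simp

text \<open>Adapted to the Koszul formula, which gives only the pairings of \<open>D\<close> with a
  third form; pullbacks through each covector suffice as third forms.\<close>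

lemma covector_eqI:
  assumes "\<And>\<gamma>. \<gamma> \<in> one_forms AB \<Longrightarrow> M.g p X (H.pull_form \<gamma> p) = M.g p Y (H.pull_form \<gamma> p)"
    "\<And>\<gamma>. \<gamma> \<in> one_forms AF \<Longrightarrow> M.g p X (V.pull_form \<gamma> p) = M.g p Y (V.pull_form \<gamma> p)"
  shows "X = Y"
proof -
  have "X - Y = 0"
  proof (rule M.g.nondegenerate)
    fix b :: "('e \<times> 'k) covector"
    obtain \<gamma> where \<gamma>: "\<gamma> \<in> one_forms AB" "\<gamma> (fst p) = restrict_fst b" using B.one_form_through by metis
    obtain \<delta> where \<delta>: "\<delta> \<in> one_forms AF" "\<delta> (snd p) = restrict_snd b" using F.one_form_through by metis
    have "M.g p X (pullback fst (restrict_fst b) + pullback snd (restrict_snd b)) =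
        M.g p Y (pullback fst (restrict_fst b) + pullback snd (restrict_snd b))"
      using assms(1)[OF \<gamma>(1)] assms(2)[OF \<delta>(1)] by (simp add: M.g.simps \<gamma>(2) \<delta>(2))
    then show "M.g p (X - Y) b = 0" by (simp add: M.g.simps flip: covector_prod_split)
  qed
  then show ?thesis by simp
qed

text \<open>This is where the Casimir hypothesis enters. It says that \<open>df\<close> pairs to
  zero with everything under \<open>PB\<close>, in either argument by antisymmetry.\<close>

lemma anchor_f_squared: "M.anch (H.pull_form \<gamma>) (\<lambda>q. f (fst q) * f (fst q)) p = 0"
proof -
  have "PB x (differential AB f x) b = 0" for x b
    using casimir_f B.blinfun_apply_sharp[of b "differential AB f" x] by (simp add: casimir_def)
  then have "PB x b (differential AB f x) = 0" for x b by (subst B.P_antisym) simp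
  then show ?thesis
    using smooth_f H.anchor_deriv_pull[of "\<lambda>x. f x * f x" \<gamma> p]
    by (simp add: B.smooth_fun_mult B.anchor_deriv_eq B.differential_mult B.P_simps)
qed

text \<open>No quotient is differentiated: the product rule is applied to \<open>?f2\<close> times
  \<open>?G\<close>, which is the pullback of a function on the fibre, and the result is solved for
  the derivative of \<open>?G\<close>.\<close>

lemma anchor_vertical_cometric:
  assumes \<alpha>: "\<alpha> \<in> one_forms AF" and \<beta>: "\<beta> \<in> one_forms AF"
  shows "M.anch (H.pull_form \<gamma>) (\<lambda>q. F.g (snd q) (\<alpha> (snd q)) (\<beta> (snd q)) / (f (fst q))\<^sup>2) p = 0"
    and "M.anch (V.pull_form \<delta>) (\<lambda>q. F.g (snd q) (\<alpha> (snd q)) (\<beta> (snd q)) / (f (fst q))\<^sup>2) p =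
      F.anch \<delta> (\<lambda>y. F.g y (\<alpha> y) (\<beta> y)) (snd p) / (f (fst p))\<^sup>2"
proof -
  let ?G = "\<lambda>q. F.g (snd q) (\<alpha> (snd q)) (\<beta> (snd q)) / (f (fst q))\<^sup>2"
  let ?f2 = "\<lambda>q :: 'b \<times> 'f. f (fst q) * f (fst q)"
  \<comment> \<open>Smoothness of the quotient comes from its meaning: it is the warped cometric on
    two vertical forms.\<close>
  have "?G = (\<lambda>q. M.g q (V.pull_form \<alpha> q) (V.pull_form \<beta> q))"
    by (simp add: warped_cometric B.g.simps fun_eq_iff)
  then have G: "smooth_fun (prod_atlas AB AF) ?G"
    using M.smooth_fun_cometric[OF V.one_forms_pull[OF \<alpha>] V.one_forms_pull[OF \<beta>]] by simp
  have f2: "smooth_fun (prod_atlas AB AF) ?f2"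
    by (rule H.smooth_fun_pull) (intro B.smooth_fun_mult smooth_f)
  have "(\<lambda>q. ?f2 q * ?G q) = (\<lambda>q. F.g (snd q) (\<alpha> (snd q)) (\<beta> (snd q)))"
    by (simp add: power2_eq_square fun_eq_iff)
  then have prod: "M.anch \<epsilon> (\<lambda>q. F.g (snd q) (\<alpha> (snd q)) (\<beta> (snd q))) p =
      ?f2 p * M.anch \<epsilon> ?G p + ?G p * M.anch \<epsilon> ?f2 p" for \<epsilon>
    using M.differential_mult[OF f2 G, of p] by (simp add: M.anchor_deriv_eq M.P_simps)
  have gF: "smooth_fun AF (\<lambda>y. F.g y (\<alpha> y) (\<beta> y))" using \<alpha> \<beta> by auto
  show "M.anch (H.pull_form \<gamma>) ?G p = 0"
    using prod[of "H.pull_form \<gamma>"] anchor_mixed(1)[OF gF, of \<gamma> p] by (simp add: anchor_f_squared)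
  show "M.anch (V.pull_form \<delta>) ?G p = F.anch \<delta> (\<lambda>y. F.g y (\<alpha> y) (\<beta> y)) (snd p) / (f (fst p))\<^sup>2"
    using prod[of "V.pull_form \<delta>"] V.anchor_deriv_pull[OF gF, of \<delta> p]
      anchor_mixed(2)[of "\<lambda>x. f x * f x" \<delta> p] smooth_f
    by (simp add: B.smooth_fun_mult power2_eq_square field_simps)
qed

lemma anchor_horizontal_cometric:
  assumes \<alpha>: "\<alpha> \<in> one_forms AB" and \<beta>: "\<beta> \<in> one_forms AB"
  shows "M.anch (H.pull_form \<gamma>) (\<lambda>q. B.g (fst q) (\<alpha> (fst q)) (\<beta> (fst q))) p =
      B.anch \<gamma> (\<lambda>x. B.g x (\<alpha> x) (\<beta> x)) (fst p)"
    and "M.anch (V.pull_form \<delta>) (\<lambda>q. B.g (fst q) (\<alpha> (fst q)) (\<beta> (fst q))) p = 0"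
  using H.anchor_deriv_pull[OF B.smooth_fun_cometric[OF assms], of \<gamma> p]
    anchor_mixed(2)[OF B.smooth_fun_cometric[OF assms], of \<delta> p] by simp_all

section \<open>The connection on pullbacks\<close>

lemma D_horizontal:
  assumes \<alpha>: "\<alpha> \<in> one_forms AB" and \<beta>: "\<beta> \<in> one_forms AB"
  shows "D (H.pull_form \<alpha>) (H.pull_form \<beta>) = H.pull_form (DB \<alpha> \<beta>)"
proof (rule ext, rule covector_eqI)
  note forms = H.one_forms_pull[OF \<alpha>] H.one_forms_pull[OF \<beta>]
  fix p \<gamma> \<delta>
  show "M.g p (D (H.pull_form \<alpha>) (H.pull_form \<beta>) p) (H.pull_form \<gamma> p) = M.g p (H.pull_form (DB \<alpha> \<beta>) p) (H.pull_form \<gamma> p)"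
    if \<gamma>: "\<gamma> \<in> one_forms AB"
    using M.koszul_formula[OF forms H.one_forms_pull[OF \<gamma>], of p] B.koszul_formula[OF \<alpha> \<beta> \<gamma>, of "fst p"]
    by (simp add: H.koszul_bracket_pull \<alpha> \<beta> \<gamma> warped_cometric F.g.simps anchor_horizontal_cometric)
  \<comment> \<open>All terms vanish: the vertical anchor kills the base cometric, and the remaining
    terms contain a mixed product or a mixed bracket.\<close>
  show "M.g p (D (H.pull_form \<alpha>) (H.pull_form \<beta>) p) (V.pull_form \<delta> p) = M.g p (H.pull_form (DB \<alpha> \<beta>) p) (V.pull_form \<delta> p)"
    if \<delta>: "\<delta> \<in> one_forms AF"
    using M.koszul_formula[OF forms V.one_forms_pull[OF \<delta>], of p]
    by (simp add: H.koszul_bracket_pull koszul_bracket_mixed \<alpha> \<beta> \<delta> warped_cometric F.g.simps B.g.simps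
        anchor_zero anchor_horizontal_cometric)
qed

text \<open>The critical term is the derivative of the vertical cometric along the horizontal
  anchor. For a general warping function it would yield the logarithmic derivative of
  \<open>f\<close>; for a Casimir function it is zero.\<close>

lemma D_mixed:
  assumes \<alpha>: "\<alpha> \<in> one_forms AB" and \<beta>: "\<beta> \<in> one_forms AF"
  shows "D (H.pull_form \<alpha>) (V.pull_form \<beta>) = (\<lambda>p. 0)"
    and "D (V.pull_form \<beta>) (H.pull_form \<alpha>) = (\<lambda>p. 0)"
proof -
  note forms = H.one_forms_pull[OF \<alpha>] V.one_forms_pull[OF \<beta>]
  show 1: "D (H.pull_form \<alpha>) (V.pull_form \<beta>) = (\<lambda>p. 0)"
  proof (rule ext, rule covector_eqI)
    fix p \<gamma> \<delta>
    show "M.g p (D (H.pull_form \<alpha>) (V.pull_form \<beta>) p) (H.pull_form \<gamma> p) = M.g p 0 (H.pull_form \<gamma> p)"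
      if \<gamma>: "\<gamma> \<in> one_forms AB"
      using M.koszul_formula[OF forms H.one_forms_pull[OF \<gamma>], of p]
      by (simp add: H.koszul_bracket_pull koszul_bracket_mixed koszul_bracket_mixed' \<alpha> \<beta> \<gamma> warped_cometric F.g.simps B.g.simps
        anchor_zero anchor_horizontal_cometric)
    show "M.g p (D (H.pull_form \<alpha>) (V.pull_form \<beta>) p) (V.pull_form \<delta> p) = M.g p 0 (V.pull_form \<delta> p)"
      if \<delta>: "\<delta> \<in> one_forms AF"
      using M.koszul_formula[OF forms V.one_forms_pull[OF \<delta>], of p]
      by (simp add: V.koszul_bracket_pull koszul_bracket_mixed \<alpha> \<beta> \<delta> warped_cometric F.g.simps B.g.simps
        anchor_zero anchor_vertical_cometric)
  qed
  show "D (V.pull_form \<beta>) (H.pull_form \<alpha>) = (\<lambda>p. 0)"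
    using M.koszul_bracket_eq[OF forms] 1 koszul_bracket_mixed[OF \<alpha> \<beta>] by (simp add: fun_eq_iff)
qed

text \<open>Against vertical forms, every term of the Koszul formula carries the same factor 1/f^2,
  which therefore drops out. The horizontal component, where the gradient of \<open>f\<close> would
  sit, vanishes by the Casimir condition.\<close>

lemma D_vertical:
  assumes \<alpha>: "\<alpha> \<in> one_forms AF" and \<beta>: "\<beta> \<in> one_forms AF"
  shows "D (V.pull_form \<alpha>) (V.pull_form \<beta>) = V.pull_form (DF \<alpha> \<beta>)"
proof (rule ext, rule covector_eqI)
  note forms = V.one_forms_pull[OF \<alpha>] V.one_forms_pull[OF \<beta>]
  fix p \<gamma> \<delta>
  show "M.g p (D (V.pull_form \<alpha>) (V.pull_form \<beta>) p) (V.pull_form \<gamma> p) = M.g p (V.pull_form (DF \<alpha> \<beta>) p) (V.pull_form \<gamma> p)"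
    if \<gamma>: "\<gamma> \<in> one_forms AF"
    using M.koszul_formula[OF forms V.one_forms_pull[OF \<gamma>], of p] F.koszul_formula[OF \<alpha> \<beta> \<gamma>, of "snd p"]
    by (simp add: V.koszul_bracket_pull \<alpha> \<beta> \<gamma> warped_cometric B.g.simps anchor_vertical_cometric
        flip: add_divide_distrib diff_divide_distrib)
  show "M.g p (D (V.pull_form \<alpha>) (V.pull_form \<beta>) p) (H.pull_form \<delta> p) = M.g p (V.pull_form (DF \<alpha> \<beta>) p) (H.pull_form \<delta> p)"
    if \<delta>: "\<delta> \<in> one_forms AB"
    using M.koszul_formula[OF forms H.one_forms_pull[OF \<delta>], of p]
    by (simp add: V.koszul_bracket_pull koszul_bracket_mixed' \<alpha> \<beta> \<delta> warped_cometric F.g.simps B.g.simps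
        anchor_zero anchor_vertical_cometric)
qed

section \<open>Curvature and Ricci curvature of the warped product\<close>

lemma kb_horizontal: "\<alpha> \<in> one_forms AB \<Longrightarrow> \<beta> \<in> one_forms AB \<Longrightarrow> M.kb (H.pull_form \<alpha>) (H.pull_form \<beta>) = H.pull_form (B.kb \<alpha> \<beta>)"
  and kb_vertical: "\<gamma> \<in> one_forms AF \<Longrightarrow> \<delta> \<in> one_forms AF \<Longrightarrow> M.kb (V.pull_form \<gamma>) (V.pull_form \<delta>) = V.pull_form (F.kb \<gamma> \<delta>)"
  and kb_mixed: "\<alpha> \<in> one_forms AB \<Longrightarrow> \<gamma> \<in> one_forms AF \<Longrightarrow> M.kb (H.pull_form \<alpha>) (V.pull_form \<gamma>) = (\<lambda>p. 0)"
    "\<alpha> \<in> one_forms AB \<Longrightarrow> \<gamma> \<in> one_forms AF \<Longrightarrow> M.kb (V.pull_form \<gamma>) (H.pull_form \<alpha>) = (\<lambda>p. 0)"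
  by (rule ext, simp add: H.koszul_bracket_pull V.koszul_bracket_pull koszul_bracket_mixed koszul_bracket_mixed')+

text \<open>Trilinearity leaves eight combinations of horizontal and vertical arguments. Choosing
  pullback forms through the given covectors makes each of them computable; in the six mixed ones
  each term contains \<open>D\<close> or a bracket of mixed type, hence zero.\<close>

lemma curvature_tensor_split:
  "M.curvature_tensor p a b c =
    pullback fst (B.curvature_tensor (fst p) (restrict_fst a) (restrict_fst b) (restrict_fst c)) +
    pullback snd (F.curvature_tensor (snd p) (restrict_snd a) (restrict_snd b) (restrict_snd c))"
proof -
  obtain \<alpha> \<beta> \<gamma> where h: "\<alpha> \<in> one_forms AB" "\<beta> \<in> one_forms AB" "\<gamma> \<in> one_forms AB"
    and hp: "\<alpha> (fst p) = restrict_fst a" "\<beta> (fst p) = restrict_fst b" "\<gamma> (fst p) = restrict_fst c"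
    using B.one_form_through by metis
  obtain \<alpha>' \<beta>' \<gamma>' where v: "\<alpha>' \<in> one_forms AF" "\<beta>' \<in> one_forms AF" "\<gamma>' \<in> one_forms AF"
    and vp: "\<alpha>' (snd p) = restrict_snd a" "\<beta>' (snd p) = restrict_snd b" "\<gamma>' (snd p) = restrict_snd c"
    using F.one_form_through by metis
  note forms = h[THEN H.one_forms_pull] v[THEN V.one_forms_pull]
  note D = D_horizontal D_vertical D_mixed kb_horizontal kb_vertical kb_mixed M.D_zero
    H.one_forms_pull V.one_forms_pull B.D_closed F.D_closed B.kb_closed F.kb_closed H.pullback_diff V.pullback_diff
  have "M.curv (H.pull_form \<alpha>) (H.pull_form \<beta>) (H.pull_form \<gamma>) p = pullback fst (B.curv \<alpha> \<beta> \<gamma> (fst p))"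
    "M.curv (V.pull_form \<alpha>') (V.pull_form \<beta>') (V.pull_form \<gamma>') p = pullback snd (F.curv \<alpha>' \<beta>' \<gamma>' (snd p))"
    "M.curv (H.pull_form \<alpha>) (H.pull_form \<beta>) (V.pull_form \<gamma>') p = 0"
    "M.curv (H.pull_form \<alpha>) (V.pull_form \<beta>') (H.pull_form \<gamma>) p = 0"
    "M.curv (H.pull_form \<alpha>) (V.pull_form \<beta>') (V.pull_form \<gamma>') p = 0"
    "M.curv (V.pull_form \<alpha>') (H.pull_form \<beta>) (H.pull_form \<gamma>) p = 0"
    "M.curv (V.pull_form \<alpha>') (H.pull_form \<beta>) (V.pull_form \<gamma>') p = 0"
    "M.curv (V.pull_form \<alpha>') (V.pull_form \<beta>') (H.pull_form \<gamma>) p = 0"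
    using h v by (simp_all add: curvature_def D)
  note this[unfolded M.curvature_eq_tensor[OF forms(1) forms(2) forms(3)] M.curvature_eq_tensor[OF forms(4) forms(5) forms(6)]
      M.curvature_eq_tensor[OF forms(1) forms(2) forms(6)] M.curvature_eq_tensor[OF forms(1) forms(5) forms(3)]
      M.curvature_eq_tensor[OF forms(1) forms(5) forms(6)] M.curvature_eq_tensor[OF forms(4) forms(2) forms(3)]
      M.curvature_eq_tensor[OF forms(4) forms(2) forms(6)] M.curvature_eq_tensor[OF forms(4) forms(5) forms(3)]
      B.curvature_eq_tensor[OF h] F.curvature_eq_tensor[OF v] hp vp]
  then show ?thesis
    by (subst covector_prod_split[of a], subst covector_prod_split[of b], subst covector_prod_split[of c])
       (simp add: M.curvature_tensor_add)
qed

lemma ricci_tensor_split: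
  "M.ricci_tensor p a b = B.ricci_tensor (fst p) (restrict_fst a) (restrict_fst b)
    + F.ricci_tensor (snd p) (restrict_snd a) (restrict_snd b)"
proof -
  let ?n = "DIM('e)" and ?m = "DIM('k)"
  obtain e where e: "orthonormal_upto ?n (B.g (fst p)) e" using B.orthonormal_coframe_exists by blast
  obtain e' where e': "orthonormal_upto ?m (F.g (snd p)) e'" using F.orthonormal_coframe_exists by blast
  \<comment> \<open>Indices below \<open>?n\<close> are horizontal, and the vertical ones are
    shifted by \<open>?n\<close>; \<open>DIM\<close> of the product type is the sum.\<close>
  define E where "E i = (if i < ?n then pullback fst (e i) else pullback snd (f (fst p) *\<^sub>R e' (i - ?n)))" for i
  have "orthonormal_upto (?n + ?m) (M.g p) E"
    unfolding orthonormal_upto_def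
  proof (intro conjI allI impI)
    fix i assume i: "i < ?n + ?m"
    show "M.g p (E i) (E i) \<in> {1, -1}"
    proof (cases "i < ?n")
      case True
      then show ?thesis using e by (simp add: E_def warped_cometric F.g.simps orthonormal_upto_def)
    next
      case False
      then have "i - ?n < ?m" using i by simp
      then show ?thesis using e' False
        by (simp add: E_def warped_cometric B.g.simps F.g.simps orthonormal_upto_def power2_eq_square)
    qed
    fix j assume "j < ?n + ?m" "i \<noteq> j"
    then have "\<not> i < ?n \<Longrightarrow> i - ?n < ?m" "\<not> j < ?n \<Longrightarrow> j - ?n < ?m" "\<not> i < ?n \<Longrightarrow> \<not> j < ?n \<Longrightarrow> i - ?n \<noteq> j - ?n"
      using i by auto
    then show "M.g p (E i) (E j) = 0"
      using \<open>i \<noteq> j\<close> orthonormal_upto_ne[OF e, of i j] orthonormal_upto_ne[OF e', of "i - ?n" "j - ?n"]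
      by (simp add: E_def warped_cometric B.g.simps F.g.simps)
  qed
  then have "M.ricci_tensor p a b = (\<Sum>i<?n + ?m. M.g p (E i) (E i) * M.g p (M.curvature_tensor p a (E i) (E i)) b)"
    using M.ricci_tensor_eq[of p E a b] by simp
  also have "\<dots> = B.ricci_tensor (fst p) (restrict_fst a) (restrict_fst b) + F.ricci_tensor (snd p) (restrict_snd a) (restrict_snd b)"
    unfolding sum_lessThan_add B.ricci_tensor_eq[OF e] F.ricci_tensor_eq[OF e']
    by (intro arg_cong2[of _ _ _ _ "(+)"] sum.cong)
       (simp_all add: E_def warped_cometric curvature_tensor_split B.g.simps F.g.simps F.curvature_tensor_scale power2_eq_square)
  finally show ?thesis .
qed

text \<open>The condition on \<kappa>' is a genuine part of the equivalence: it forces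
  \<open>f\<close> to be constant unless \<kappa> is 0, in which case \<kappa>' is 0 as
  well.\<close>

lemma einstein_warped_iff:
  "einstein (prod_atlas AB AF) (prod_bivector PB PF) M.g D \<kappa> \<longleftrightarrow>
    einstein AB PB B.g DB \<kappa> \<and> (\<exists>\<kappa>'. (\<forall>x. \<kappa>' = \<kappa> / (f x)\<^sup>2) \<and> einstein AF PF F.g DF \<kappa>')"
  unfolding B.einstein_iff F.einstein_iff M.einstein_iff
proof (intro iffI conjI)
  assume M: "\<forall>p a b. M.ricci_tensor p a b = \<kappa> * M.g p a b"
  show "\<forall>x a b. B.ricci_tensor x a b = \<kappa> * B.g x a b"
  proof (intro allI)
    fix x a b
    show "B.ricci_tensor x a b = \<kappa> * B.g x a b"
      \<comment> \<open>Any fibre point will do, since a horizontal covector has no vertical part;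
        \<open>undefined\<close> only names one.\<close>
      using M[rule_format, of "(x, undefined)" "pullback fst a" "pullback fst b"]
      by (simp add: ricci_tensor_split warped_cometric F.g.simps)
  qed
  have F: "F.ricci_tensor y a b = \<kappa> / (f x)\<^sup>2 * F.g y a b" for x y a b
    using M[rule_format, of "(x, y)" "pullback snd a" "pullback snd b"]
    by (simp add: ricci_tensor_split warped_cometric B.g.simps)
  obtain i :: 'k where i: "i \<in> Basis" using nonempty_Basis by blast
  have "blinfun_apply (blinfun_inner_left i) i \<noteq> 0" using i by simp
  then have "blinfun_inner_left i \<noteq> 0" by (metis zero_blinfun.rep_eq)
  \<comment> \<open>A nonzero value of the fibre cometric, by which the equations for two base
    points can be divided.\<close>
  then obtain b where b: "F.g undefined (blinfun_inner_left i) b \<noteq> 0" using F.g.nondegenerate by blast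
  have "\<kappa> / (f x)\<^sup>2 = \<kappa> / (f x')\<^sup>2" for x x'
    using F[of undefined "blinfun_inner_left i" b x] F[of undefined "blinfun_inner_left i" b x'] b
    by (metis mult_right_cancel)
  then show "\<exists>\<kappa>'. (\<forall>x. \<kappa>' = \<kappa> / (f x)\<^sup>2) \<and> (\<forall>y a b. F.ricci_tensor y a b = \<kappa>' * F.g y a b)"
    using F by (intro exI[of _ "\<kappa> / (f undefined)\<^sup>2"]) blast
next
  assume "(\<forall>x a b. B.ricci_tensor x a b = \<kappa> * B.g x a b) \<and>
    (\<exists>\<kappa>'. (\<forall>x. \<kappa>' = \<kappa> / (f x)\<^sup>2) \<and> (\<forall>y a b. F.ricci_tensor y a b = \<kappa>' * F.g y a b))"
  then obtain \<kappa>' where B: "\<And>x a b. B.ricci_tensor x a b = \<kappa> * B.g x a b"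
    and \<kappa>': "\<And>x. \<kappa>' = \<kappa> / (f x)\<^sup>2" and F: "\<And>y a b. F.ricci_tensor y a b = \<kappa>' * F.g y a b"
    by blast
  show "\<forall>p a b. M.ricci_tensor p a b = \<kappa> * M.g p a b"
  proof (intro allI)
    fix p a b
    show "M.ricci_tensor p a b = \<kappa> * M.g p a b"
      by (simp add: ricci_tensor_split B F \<kappa>'[of "fst p"] warped_cometric algebra_simps)
  qed
qed

end

theorem theorem4p3:
  fixes AB :: "('b::{t2_space,second_countable_topology}, 'e::euclidean_space) atlas"
    and AF :: "('f::{t2_space,second_countable_topology}, 'k::euclidean_space) atlas"
    and hB :: "('b, 'e) metric" and hF :: "('f, 'k) metric"
    and PB :: "('b, 'e) bivector" and PF :: "('f, 'k) bivector"
    and f :: "'b \<Rightarrow> real"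
    and DB :: "('b, 'e) connection" and DF :: "('f, 'k) connection"
    and D :: "('b \<times> 'f, 'e \<times> 'k) connection"
    and \<kappa> :: real
  assumes "pseudo_riemannian_manifold AB hB" and "poisson_manifold AB PB"
    and "pseudo_riemannian_manifold AF hF" and "poisson_manifold AF PF"
    and "contravariant_levi_civita AB PB (cometric_of hB) DB"
    and "contravariant_levi_civita AF PF (cometric_of hF) DF"
    and "smooth_fun AB f" and "\<forall>x. f x > 0"
    and "riemannian_poisson_manifold (prod_atlas AB AF) (warped_metric f hB hF)
           (prod_bivector PB PF) D"
    and "casimir AB PB f"
  shows "einstein (prod_atlas AB AF) (prod_bivector PB PF)
           (cometric_of (warped_metric f hB hF)) D \<kappa> \<longleftrightarrow>
         einstein AB PB (cometric_of hB) DB \<kappa> \<and>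
         (\<exists>\<kappa>'. (\<forall>x. \<kappa>' = \<kappa> / (f x)\<^sup>2) \<and> einstein AF PF (cometric_of hF) DF \<kappa>')"
proof -
  interpret warped_product AB hB PB DB AF hF PF DF f D
    by unfold_locales
       (use assms in \<open>auto simp: riemannian_poisson_manifold_def pseudo_riemannian_manifold_def\<close>)
  show ?thesis by (rule einstein_warped_iff)
qed

end
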